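(* Let $(\mathcal{M},\otimes,I)$ be a monoidal category, regarded as a bicategory with one object, let $\mathrm{Iso}(\mathcal{M})$ be the class of invertible morphisms of $\mathcal{M}$, and let $X$ be a nonempty set. There is an equivalence (of categories, for the morphisms specified in the context) between the following data: (i) an $\overline{X}$-point of $(\mathcal{M},\mathrm{Iso}(\mathcal{M}))$; (ii) an enriched category over $\mathcal{M}$ having $X$ as set of objects.
   Context: $\overline{X}$ is the coarse category on $X$: its set of objects is $X$, and there is exactly one arrow, denoted $(A,B)$, from $A$ to $B$ for all $A,B\in X$. For a small category $\mathcal{C}$, the $2$-path-category $\mathscr{P}_{\mathcal{C}}$ is the following strict $2$-category. Its objects are those of $\mathcal{C}$. Objects of $\mathscr{P}_{\mathcal{C}}(A,B)$ are pairs $[n,s]$ with $s=(A=A_0\xrightarrow{f_0}A_1\to\cdots\xrightarrow{f_{n-1}}A_n=B)$ a chain of $n\ge1$ composable arrows of $\mathcal{C}$, and also one object $[0,A]$ if $A=B$. Writing $n=\{0,\dots,n-1\}$, a morphism $[n,s]\to[m,t]$ is a nondecreasing map $u:n\to m$ such that, for each $j<m$, the $j$-th arrow of $t$ is the composite, in order, of the arrows $f_i$ of $s$ with $u(i)=j$ (an identity if there are none). Composition of $1$-cells is concatenation, $t\otimes s=[n+m,\ s\text{ followed by }t]$, on $2$-cells it is the ordinal sum $u'\otimes u=u+u'$, and the identity of $A$ is $[0,A]$. A monoidal category is viewed as a bicategory with one object whose $1$-cells are the objects of $\mathcal{M}$, whose $2$-cells are its morphisms, and whose composition of $1$-cells is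 $\otimes$. For a class $\mathcal{W}$ of $2$-cells of a bicategory $\mathcal{M}$ containing the invertible $2$-cells, with the vertical $3$-out-of-$2$ property and stable under horizontal composition, a $\mathcal{C}$-point of $(\mathcal{M},\mathcal{W})$ is a colax morphism of bicategories $F=(F,\varphi):\mathscr{P}_{\mathcal{C}}\to\mathcal{M}$ (an oplax functor: functors $F_{AB}:\mathscr{P}_{\mathcal{C}}(A,B)\to\mathcal{M}(FA,FB)$, natural $2$-cells $\varphi(A,B,C)(t,s):F_{AC}(t\otimes s)\to F_{BC}(t)\otimes F_{AB}(s)$ and $2$-cells $\varphi_A:F_{AA}([0,A])\to I_{FA}$ satisfying the usual associativity and unit coherence axioms) such that all $\varphi(A,B,C)(t,s)$ and $\varphi_A$ are in $\mathcal{W}$. Morphisms in (i): from $(F,\varphi)$ to $(G,\psi)$, families of natural transformations $\sigma:F_{AB}\to G_{AB}$ with $\psi(t,s)\circ\sigma_{t\otimes s}=(\sigma_t\otimes\sigma_s)\circ\varphi(t,s)$ and $\psi_A\circ\sigma_{[0,A]}=\varphi_A$ (transformations whose $1$-cell components are identities). In (ii), enriched categories have composition maps $\mathcal{A}(B,C)\otimes\mathcal{A}(A,B)\to\mathcal{A}(A,C)$ and unit maps $I\to\mathcal{A}(A,A)$ with the usual axioms; morphisms are the $\mathcal{M}$-functors that are the identity on the object set $X$. *)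

theory Defs
  imports "HOL-Library.FuncSet"
begin

record ('o, 'a) cat =
  Obj :: "'o set"
  Arr :: "'a set"
  Dom :: "'a \<Rightarrow> 'o"
  Cod :: "'a \<Rightarrow> 'o"
  Ide :: "'o \<Rightarrow> 'a"
  Comp :: "'a \<Rightarrow> 'a \<Rightarrow> 'a" (infixl "\<cdot>\<index>" 70)

definition Hom :: "('o, 'a) cat \<Rightarrow> 'o \<Rightarrow> 'o \<Rightarrow> 'a set" where
  "Hom C A B = {f \<in> Arr C. Dom C f = A \<and> Cod C f = B}"

locale category =
  fixes C :: "('o, 'a) cat" (structure)
  assumes dom_closed: "f \<in> Arr C \<Longrightarrow> Dom C f \<in> Obj C"
    and cod_closed: "f \<in> Arr C \<Longrightarrow> Cod C f \<in> Obj C"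
    and ide_closed: "A \<in> Obj C \<Longrightarrow> Ide C A \<in> Hom C A A"
    and comp_closed: "\<lbrakk>f \<in> Hom C A B; g \<in> Hom C B D\<rbrakk> \<Longrightarrow> g \<cdot> f \<in> Hom C A D"
    and comp_ide_left: "f \<in> Hom C A B \<Longrightarrow> Ide C B \<cdot> f = f"
    and comp_ide_right: "f \<in> Hom C A B \<Longrightarrow> f \<cdot> Ide C A = f"
    and comp_assoc: "\<lbrakk>f \<in> Hom C A B; g \<in> Hom C B D; h \<in> Hom C D E\<rbrakk>
      \<Longrightarrow> h \<cdot> g \<cdot> f = h \<cdot> (g \<cdot> f)"

definition Isos :: "('o, 'a) cat \<Rightarrow> 'a set" where
  "Isos C = {f \<in> Arr C. \<exists>g \<in> Hom C (Cod C f) (Dom C f).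
     g \<cdot>\<^bsub>C\<^esub> f = Ide C (Dom C f) \<and> f \<cdot>\<^bsub>C\<^esub> g = Ide C (Cod C f)}"

text \<open>The families making up functors, transformations, colax functors and enriched categories are
  required to be \<^const>\<open>undefined\<close> outside their domain, so that HOL equality of such data is
  the mathematical one.\<close>

record ('o, 'a, 'p, 'b) func =
  omap :: "'o \<Rightarrow> 'p"
  amap :: "'a \<Rightarrow> 'b"

locale cat_functor = C: category C + D: category D
  for C :: "('o, 'a) cat" and D :: "('p, 'b) cat" +
  fixes F :: "('o, 'a, 'p, 'b) func"
  assumes omap_closed: "A \<in> Obj C \<Longrightarrow> omap F A \<in> Obj D"
    and amap_closed: "f \<in> Hom C A B \<Longrightarrow> amap F f \<in> Hom D (omap F A) (omap F B)"
    and amap_ide: "A \<in> Obj C \<Longrightarrow> amap F (Ide C A) = Ide D (omap F A)"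
    and amap_comp: "\<lbrakk>f \<in> Hom C A B; g \<in> Hom C B E\<rbrakk>
      \<Longrightarrow> amap F (g \<cdot>\<^bsub>C\<^esub> f) = amap F g \<cdot>\<^bsub>D\<^esub> amap F f"
    and omap_ext: "omap F \<in> extensional (Obj C)"
    and amap_ext: "amap F \<in> extensional (Arr C)"

locale natural_transformation = F: cat_functor C D F + G: cat_functor C D G
  for C :: "('o, 'a) cat" and D :: "('p, 'b) cat" and F G +
  fixes \<tau> :: "'o \<Rightarrow> 'b"
  assumes component_closed: "A \<in> Obj C \<Longrightarrow> \<tau> A \<in> Hom D (omap F A) (omap G A)"
    and naturality: "f \<in> Hom C A B \<Longrightarrow> \<tau> B \<cdot>\<^bsub>D\<^esub> amap F f = amap G f \<cdot>\<^bsub>D\<^esub> \<tau> A"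
    and component_ext: "\<tau> \<in> extensional (Obj C)"

definition natural_iso ::
  "('o, 'a) cat \<Rightarrow> ('p, 'b) cat \<Rightarrow> ('o, 'a, 'p, 'b) func \<Rightarrow> ('o, 'a, 'p, 'b) func
    \<Rightarrow> ('o \<Rightarrow> 'b) \<Rightarrow> bool" where
  "natural_iso C D F G \<tau> \<longleftrightarrow>
     natural_transformation C D F G \<tau> \<and> (\<forall>A \<in> Obj C. \<tau> A \<in> Isos D)"

definition id_func :: "('o, 'a) cat \<Rightarrow> ('o, 'a, 'o, 'a) func" where
  "id_func C = \<lparr>omap = restrict (\<lambda>A. A) (Obj C), amap = restrict (\<lambda>f. f) (Arr C)\<rparr>"

definition comp_func ::
  "('o, 'a) cat \<Rightarrow> ('p, 'b, 'q, 'c) func \<Rightarrow> ('o, 'a, 'p, 'b) func \<Rightarrow> ('o, 'a, 'q, 'c) func" where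
  "comp_func C G F =
     \<lparr>omap = compose (Obj C) (omap G) (omap F), amap = compose (Arr C) (amap G) (amap F)\<rparr>"

definition equivalent_categories :: "('o, 'a) cat \<Rightarrow> ('p, 'b) cat \<Rightarrow> bool" where
  "equivalent_categories C D \<longleftrightarrow> category C \<and> category D \<and>
     (\<exists>F G \<eta> \<epsilon>. cat_functor C D F \<and> cat_functor D C G \<and>
        natural_iso C C (id_func C) (comp_func C G F) \<eta> \<and>
        natural_iso D D (comp_func D F G) (id_func D) \<epsilon>)"

definition coarse :: "'x set \<Rightarrow> ('x, 'x \<times> 'x) cat" where
  "coarse X = \<lparr>Obj = X, Arr = X \<times> X, Dom = fst, Cod = snd,
     Ide = (\<lambda>A. (A, A)), Comp = (\<lambda>g f. (fst f, snd g))\<rparr>"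

lemma category_coarse: "category (coarse X)"
  by unfold_locales (auto simp: coarse_def Hom_def)


text \<open>\<open>Hc A B\<close> is the category of 1-cells \<open>A \<rightarrow> B\<close>. Horizontal composition is written in the order
  of composition of maps: for \<open>t\<close> in \<open>Hc B C\<close> and \<open>s\<close> in \<open>Hc A B\<close>, the composite
  \<open>hobj A B C t s\<close> lies in \<open>Hc A C\<close>; \<open>harr\<close> is the action on 2-cells. The associator
  \<open>assoc A B C D h g f\<close> goes from \<open>(h g) f\<close> to \<open>h (g f)\<close>.\<close>

record ('z, 'o, 'a) bicat =
  Cells0 :: "'z set"
  Hc :: "'z \<Rightarrow> 'z \<Rightarrow> ('o, 'a) cat"
  hobj :: "'z \<Rightarrow> 'z \<Rightarrow> 'z \<Rightarrow> 'o \<Rightarrow> 'o \<Rightarrow> 'o"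
  harr :: "'z \<Rightarrow> 'z \<Rightarrow> 'z \<Rightarrow> 'a \<Rightarrow> 'a \<Rightarrow> 'a"
  hunit :: "'z \<Rightarrow> 'o"
  assoc :: "'z \<Rightarrow> 'z \<Rightarrow> 'z \<Rightarrow> 'z \<Rightarrow> 'o \<Rightarrow> 'o \<Rightarrow> 'o \<Rightarrow> 'a"
  lunit :: "'z \<Rightarrow> 'z \<Rightarrow> 'o \<Rightarrow> 'a"
  runit :: "'z \<Rightarrow> 'z \<Rightarrow> 'o \<Rightarrow> 'a"

locale bicategory =
  fixes M :: "('z, 'o, 'a) bicat"
  assumes hom_category: "\<lbrakk>A \<in> Cells0 M; B \<in> Cells0 M\<rbrakk> \<Longrightarrow> category (Hc M A B)"
    and hobj_closed: "\<lbrakk>A \<in> Cells0 M; B \<in> Cells0 M; C \<in> Cells0 M;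
        t \<in> Obj (Hc M B C); s \<in> Obj (Hc M A B)\<rbrakk> \<Longrightarrow> hobj M A B C t s \<in> Obj (Hc M A C)"
    and harr_closed: "\<lbrakk>A \<in> Cells0 M; B \<in> Cells0 M; C \<in> Cells0 M;
        v \<in> Hom (Hc M B C) t t'; u \<in> Hom (Hc M A B) s s'\<rbrakk>
      \<Longrightarrow> harr M A B C v u \<in> Hom (Hc M A C) (hobj M A B C t s) (hobj M A B C t' s')"
    and harr_ide: "\<lbrakk>A \<in> Cells0 M; B \<in> Cells0 M; C \<in> Cells0 M;
        t \<in> Obj (Hc M B C); s \<in> Obj (Hc M A B)\<rbrakk>
      \<Longrightarrow> harr M A B C (Ide (Hc M B C) t) (Ide (Hc M A B) s) = Ide (Hc M A C) (hobj M A B C t s)"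
    and interchange: "\<lbrakk>A \<in> Cells0 M; B \<in> Cells0 M; C \<in> Cells0 M;
        v \<in> Hom (Hc M B C) t t'; v' \<in> Hom (Hc M B C) t' t'';
        u \<in> Hom (Hc M A B) s s'; u' \<in> Hom (Hc M A B) s' s''\<rbrakk>
      \<Longrightarrow> harr M A B C (v' \<cdot>\<^bsub>Hc M B C\<^esub> v) (u' \<cdot>\<^bsub>Hc M A B\<^esub> u)
          = harr M A B C v' u' \<cdot>\<^bsub>Hc M A C\<^esub> harr M A B C v u"
    and hunit_closed: "A \<in> Cells0 M \<Longrightarrow> hunit M A \<in> Obj (Hc M A A)"
    and assoc_closed: "\<lbrakk>A \<in> Cells0 M; B \<in> Cells0 M; C \<in> Cells0 M; D \<in> Cells0 M;
        h \<in> Obj (Hc M C D); g \<in> Obj (Hc M B C); f \<in> Obj (Hc M A B)\<rbrakk>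
      \<Longrightarrow> assoc M A B C D h g f \<in> Isos (Hc M A D)
            \<inter> Hom (Hc M A D) (hobj M A B D (hobj M B C D h g) f) (hobj M A C D h (hobj M A B C g f))"
    and assoc_natural: "\<lbrakk>A \<in> Cells0 M; B \<in> Cells0 M; C \<in> Cells0 M; D \<in> Cells0 M;
        w \<in> Hom (Hc M C D) h h'; v \<in> Hom (Hc M B C) g g'; u \<in> Hom (Hc M A B) f f'\<rbrakk>
      \<Longrightarrow> assoc M A B C D h' g' f' \<cdot>\<^bsub>Hc M A D\<^esub> harr M A B D (harr M B C D w v) u
          = harr M A C D w (harr M A B C v u) \<cdot>\<^bsub>Hc M A D\<^esub> assoc M A B C D h g f"
    and lunit_closed: "\<lbrakk>A \<in> Cells0 M; B \<in> Cells0 M; f \<in> Obj (Hc M A B)\<rbrakk>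
      \<Longrightarrow> lunit M A B f \<in> Isos (Hc M A B) \<inter> Hom (Hc M A B) (hobj M A B B (hunit M B) f) f"
    and lunit_natural: "\<lbrakk>A \<in> Cells0 M; B \<in> Cells0 M; u \<in> Hom (Hc M A B) f f'\<rbrakk>
      \<Longrightarrow> lunit M A B f' \<cdot>\<^bsub>Hc M A B\<^esub> harr M A B B (Ide (Hc M B B) (hunit M B)) u
          = u \<cdot>\<^bsub>Hc M A B\<^esub> lunit M A B f"
    and runit_closed: "\<lbrakk>A \<in> Cells0 M; B \<in> Cells0 M; f \<in> Obj (Hc M A B)\<rbrakk>
      \<Longrightarrow> runit M A B f \<in> Isos (Hc M A B) \<inter> Hom (Hc M A B) (hobj M A A B f (hunit M A)) f"
    and runit_natural: "\<lbrakk>A \<in> Cells0 M; B \<in> Cells0 M; u \<in> Hom (Hc M A B) f f'\<rbrakk>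
      \<Longrightarrow> runit M A B f' \<cdot>\<^bsub>Hc M A B\<^esub> harr M A A B u (Ide (Hc M A A) (hunit M A))
          = u \<cdot>\<^bsub>Hc M A B\<^esub> runit M A B f"
    and pentagon: "\<lbrakk>A \<in> Cells0 M; B \<in> Cells0 M; C \<in> Cells0 M; D \<in> Cells0 M; E \<in> Cells0 M;
        k \<in> Obj (Hc M D E); h \<in> Obj (Hc M C D); g \<in> Obj (Hc M B C); f \<in> Obj (Hc M A B)\<rbrakk>
      \<Longrightarrow> assoc M A C D E k h (hobj M A B C g f)
            \<cdot>\<^bsub>Hc M A E\<^esub> assoc M A B C E (hobj M C D E k h) g f
          = harr M A D E (Ide (Hc M D E) k) (assoc M A B C D h g f)
            \<cdot>\<^bsub>Hc M A E\<^esub> assoc M A B D E k (hobj M B C D h g) f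
            \<cdot>\<^bsub>Hc M A E\<^esub> harr M A B E (assoc M B C D E k h g) (Ide (Hc M A B) f)"
    and triangle: "\<lbrakk>A \<in> Cells0 M; B \<in> Cells0 M; C \<in> Cells0 M;
        g \<in> Obj (Hc M B C); f \<in> Obj (Hc M A B)\<rbrakk>
      \<Longrightarrow> harr M A B C (Ide (Hc M B C) g) (lunit M A B f) \<cdot>\<^bsub>Hc M A C\<^esub> assoc M A B B C g (hunit M B) f
          = harr M A B C (runit M B C g) (Ide (Hc M A B) f)"

locale two_cell_class = bicategory M
  for M :: "('z, 'o, 'a) bicat" +
  fixes W :: "'z \<Rightarrow> 'z \<Rightarrow> 'a set"
  assumes W_cells: "\<lbrakk>A \<in> Cells0 M; B \<in> Cells0 M\<rbrakk> \<Longrightarrow> W A B \<subseteq> Arr (Hc M A B)"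
    and W_isos: "\<lbrakk>A \<in> Cells0 M; B \<in> Cells0 M\<rbrakk> \<Longrightarrow> Isos (Hc M A B) \<subseteq> W A B"
    and W_three_out_of_two: "\<lbrakk>A \<in> Cells0 M; B \<in> Cells0 M;
        u \<in> Hom (Hc M A B) r s; v \<in> Hom (Hc M A B) s t;
        u \<in> W A B \<and> v \<in> W A B \<or> u \<in> W A B \<and> v \<cdot>\<^bsub>Hc M A B\<^esub> u \<in> W A B
          \<or> v \<in> W A B \<and> v \<cdot>\<^bsub>Hc M A B\<^esub> u \<in> W A B\<rbrakk>
      \<Longrightarrow> u \<in> W A B \<and> v \<in> W A B \<and> v \<cdot>\<^bsub>Hc M A B\<^esub> u \<in> W A B"
    and W_harr: "\<lbrakk>A \<in> Cells0 M; B \<in> Cells0 M; C \<in> Cells0 M; v \<in> W B C; u \<in> W A B\<rbrakk>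
      \<Longrightarrow> harr M A B C v u \<in> W A C"

definition Iso_cells :: "('z, 'o, 'a) bicat \<Rightarrow> 'z \<Rightarrow> 'z \<Rightarrow> 'a set" where
  "Iso_cells M A B = Isos (Hc M A B)"


text \<open>\<open>ccomp F A B C t s\<close> is the 2-cell \<open>F(t s) \<Rightarrow> F t F s\<close> and \<open>cunit F A\<close> is the
  2-cell \<open>F(1\<^sub>A) \<Rightarrow> 1\<^sub>F\<^sub>A\<close>.\<close>

record ('z, 'o, 'a, 'w, 'p, 'b) colax =
  cobj :: "'z \<Rightarrow> 'w"
  chom :: "'z \<Rightarrow> 'z \<Rightarrow> ('o, 'a, 'p, 'b) func"
  ccomp :: "'z \<Rightarrow> 'z \<Rightarrow> 'z \<Rightarrow> 'o \<Rightarrow> 'o \<Rightarrow> 'b"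
  cunit :: "'z \<Rightarrow> 'b"

locale colax_functor = P: bicategory P + M: bicategory M
  for P :: "('z, 'o, 'a) bicat" and M :: "('w, 'p, 'b) bicat" +
  fixes F :: "('z, 'o, 'a, 'w, 'p, 'b) colax"
  assumes cobj_closed: "A \<in> Cells0 P \<Longrightarrow> cobj F A \<in> Cells0 M"
    and chom_functor: "\<lbrakk>A \<in> Cells0 P; B \<in> Cells0 P\<rbrakk>
      \<Longrightarrow> cat_functor (Hc P A B) (Hc M (cobj F A) (cobj F B)) (chom F A B)"
    and ccomp_closed: "\<lbrakk>A \<in> Cells0 P; B \<in> Cells0 P; C \<in> Cells0 P;
        t \<in> Obj (Hc P B C); s \<in> Obj (Hc P A B)\<rbrakk>
      \<Longrightarrow> ccomp F A B C t s \<in> Hom (Hc M (cobj F A) (cobj F C))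
            (omap (chom F A C) (hobj P A B C t s))
            (hobj M (cobj F A) (cobj F B) (cobj F C) (omap (chom F B C) t) (omap (chom F A B) s))"
    and ccomp_natural: "\<lbrakk>A \<in> Cells0 P; B \<in> Cells0 P; C \<in> Cells0 P;
        v \<in> Hom (Hc P B C) t t'; u \<in> Hom (Hc P A B) s s'\<rbrakk>
      \<Longrightarrow> ccomp F A B C t' s' \<cdot>\<^bsub>Hc M (cobj F A) (cobj F C)\<^esub> amap (chom F A C) (harr P A B C v u)
          = harr M (cobj F A) (cobj F B) (cobj F C) (amap (chom F B C) v) (amap (chom F A B) u)
            \<cdot>\<^bsub>Hc M (cobj F A) (cobj F C)\<^esub> ccomp F A B C t s"
    and cunit_closed: "A \<in> Cells0 P
      \<Longrightarrow> cunit F A \<in> Hom (Hc M (cobj F A) (cobj F A))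
            (omap (chom F A A) (hunit P A)) (hunit M (cobj F A))"
    and ccomp_assoc: "\<lbrakk>A \<in> Cells0 P; B \<in> Cells0 P; C \<in> Cells0 P; D \<in> Cells0 P;
        h \<in> Obj (Hc P C D); g \<in> Obj (Hc P B C); f \<in> Obj (Hc P A B)\<rbrakk>
      \<Longrightarrow> assoc M (cobj F A) (cobj F B) (cobj F C) (cobj F D)
              (omap (chom F C D) h) (omap (chom F B C) g) (omap (chom F A B) f)
            \<cdot>\<^bsub>Hc M (cobj F A) (cobj F D)\<^esub> harr M (cobj F A) (cobj F B) (cobj F D)
              (ccomp F B C D h g) (Ide (Hc M (cobj F A) (cobj F B)) (omap (chom F A B) f))
            \<cdot>\<^bsub>Hc M (cobj F A) (cobj F D)\<^esub> ccomp F A B D (hobj P B C D h g) f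
          = harr M (cobj F A) (cobj F C) (cobj F D)
              (Ide (Hc M (cobj F C) (cobj F D)) (omap (chom F C D) h)) (ccomp F A B C g f)
            \<cdot>\<^bsub>Hc M (cobj F A) (cobj F D)\<^esub> ccomp F A C D h (hobj P A B C g f)
            \<cdot>\<^bsub>Hc M (cobj F A) (cobj F D)\<^esub> amap (chom F A D) (assoc P A B C D h g f)"
    and ccomp_lunit: "\<lbrakk>A \<in> Cells0 P; B \<in> Cells0 P; f \<in> Obj (Hc P A B)\<rbrakk>
      \<Longrightarrow> lunit M (cobj F A) (cobj F B) (omap (chom F A B) f)
            \<cdot>\<^bsub>Hc M (cobj F A) (cobj F B)\<^esub> harr M (cobj F A) (cobj F B) (cobj F B)
              (cunit F B) (Ide (Hc M (cobj F A) (cobj F B)) (omap (chom F A B) f))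
            \<cdot>\<^bsub>Hc M (cobj F A) (cobj F B)\<^esub> ccomp F A B B (hunit P B) f
          = amap (chom F A B) (lunit P A B f)"
    and ccomp_runit: "\<lbrakk>A \<in> Cells0 P; B \<in> Cells0 P; f \<in> Obj (Hc P A B)\<rbrakk>
      \<Longrightarrow> runit M (cobj F A) (cobj F B) (omap (chom F A B) f)
            \<cdot>\<^bsub>Hc M (cobj F A) (cobj F B)\<^esub> harr M (cobj F A) (cobj F A) (cobj F B)
              (Ide (Hc M (cobj F A) (cobj F B)) (omap (chom F A B) f)) (cunit F A)
            \<cdot>\<^bsub>Hc M (cobj F A) (cobj F B)\<^esub> ccomp F A A B f (hunit P A)
          = amap (chom F A B) (runit P A B f)"
    and cobj_ext: "cobj F \<in> extensional (Cells0 P)"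
    and chom_ext: "\<not> (A \<in> Cells0 P \<and> B \<in> Cells0 P) \<Longrightarrow> chom F A B = undefined"
    and ccomp_ext: "\<not> (A \<in> Cells0 P \<and> B \<in> Cells0 P \<and> C \<in> Cells0 P
        \<and> t \<in> Obj (Hc P B C) \<and> s \<in> Obj (Hc P A B)) \<Longrightarrow> ccomp F A B C t s = undefined"
    and cunit_ext: "cunit F \<in> extensional (Cells0 P)"

text \<open>Transformations of colax functors whose 1-cell components are identities; these exist only
  between functors that agree on 0-cells.\<close>

locale colax_transformation = F: colax_functor P M F + G: colax_functor P M G
  for P :: "('z, 'o, 'a) bicat" and M :: "('w, 'p, 'b) bicat" and F G +
  fixes \<sigma> :: "'z \<Rightarrow> 'z \<Rightarrow> 'o \<Rightarrow> 'b"
  assumes same_cobj: "cobj F = cobj G"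
    and component_natural: "\<lbrakk>A \<in> Cells0 P; B \<in> Cells0 P\<rbrakk>
      \<Longrightarrow> natural_transformation (Hc P A B) (Hc M (cobj F A) (cobj F B))
            (chom F A B) (chom G A B) (\<sigma> A B)"
    and component_ccomp: "\<lbrakk>A \<in> Cells0 P; B \<in> Cells0 P; C \<in> Cells0 P;
        t \<in> Obj (Hc P B C); s \<in> Obj (Hc P A B)\<rbrakk>
      \<Longrightarrow> ccomp G A B C t s \<cdot>\<^bsub>Hc M (cobj F A) (cobj F C)\<^esub> \<sigma> A C (hobj P A B C t s)
          = harr M (cobj F A) (cobj F B) (cobj F C) (\<sigma> B C t) (\<sigma> A B s)
            \<cdot>\<^bsub>Hc M (cobj F A) (cobj F C)\<^esub> ccomp F A B C t s"
    and component_cunit: "A \<in> Cells0 P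
      \<Longrightarrow> cunit G A \<cdot>\<^bsub>Hc M (cobj F A) (cobj F A)\<^esub> \<sigma> A A (hunit P A) = cunit F A"
    and component_ext: "\<not> (A \<in> Cells0 P \<and> B \<in> Cells0 P) \<Longrightarrow> \<sigma> A B = (\<lambda>_. undefined)"


text \<open>An object \<open>[n, s]\<close> of the category of paths from \<open>A\<close> to \<open>B\<close> is encoded by the list \<open>s\<close> of its
  arrows in the order of travel, with \<open>n = length s\<close>; the empty list is \<open>[0, A]\<close>.\<close>

fun chain :: "('o, 'a) cat \<Rightarrow> 'o \<Rightarrow> 'a list \<Rightarrow> 'o \<Rightarrow> bool" where
  "chain C A [] B \<longleftrightarrow> A \<in> Obj C \<and> A = B"
| "chain C A (f # fs) B \<longleftrightarrow> f \<in> Arr C \<and> Dom C f = A \<and> chain C (Cod C f) fs B"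

fun composite :: "('o, 'a) cat \<Rightarrow> 'o \<Rightarrow> 'a list \<Rightarrow> 'a" where
  "composite C A [] = Ide C A"
| "composite C A (f # fs) = composite C (Cod C f) fs \<cdot>\<^bsub>C\<^esub> f"

definition fibre :: "'a list \<Rightarrow> (nat \<Rightarrow> nat) \<Rightarrow> nat \<Rightarrow> 'a list" where
  "fibre s u j = map (\<lambda>i. s ! i) (filter (\<lambda>i. u i = j) [0..<length s])"

type_synonym 'a path_cell = "'a list \<times> (nat \<Rightarrow> nat) \<times> 'a list"

definition path_cells :: "('o, 'a) cat \<Rightarrow> 'o \<Rightarrow> 'o \<Rightarrow> 'a path_cell set" where
  "path_cells C A B = {(s, u, t). chain C A s B \<and> chain C A t B \<and>
     u \<in> {..<length s} \<rightarrow>\<^sub>E {..<length t} \<and> mono_on {..<length s} u \<and>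
     (\<forall>j < length t. t ! j = composite C (Dom C (t ! j)) (fibre s u j))}"

definition path_id :: "'a list \<Rightarrow> 'a path_cell" where
  "path_id s = (s, restrict (\<lambda>i. i) {..<length s}, s)"

fun path_vcomp :: "'a path_cell \<Rightarrow> 'a path_cell \<Rightarrow> 'a path_cell" where
  "path_vcomp (t', v, r) (s, u, t) = (s, compose {..<length s} v u, r)"

fun path_hcomp :: "'a path_cell \<Rightarrow> 'a path_cell \<Rightarrow> 'a path_cell" where
  "path_hcomp (t, v, t') (s, u, s') =
     (s @ t,
      restrict (\<lambda>i. if i < length s then u i else length s' + v (i - length s))
        {..<length s + length t},
      s' @ t')"

definition path_hom :: "('o, 'a) cat \<Rightarrow> 'o \<Rightarrow> 'o \<Rightarrow> ('a list, 'a path_cell) cat" where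
  "path_hom C A B = \<lparr>Obj = {s. chain C A s B}, Arr = path_cells C A B,
     Dom = fst, Cod = (\<lambda>w. snd (snd w)), Ide = path_id, Comp = path_vcomp\<rparr>"

definition path_bicat :: "('o, 'a) cat \<Rightarrow> ('o, 'a list, 'a path_cell) bicat" where
  "path_bicat C = \<lparr>Cells0 = Obj C, Hc = path_hom C,
     hobj = (\<lambda>_ _ _ t s. s @ t), harr = (\<lambda>_ _ _. path_hcomp), hunit = (\<lambda>_. []),
     assoc = (\<lambda>_ _ _ _ h g f. path_id (f @ g @ h)),
     lunit = (\<lambda>_ _. path_id), runit = (\<lambda>_ _. path_id)\<rparr>"


locale point = C: category C + two_cell_class M W + colax_functor "path_bicat C" M F
  for C :: "('o, 'a) cat" and M :: "('w, 'p, 'b) bicat" and W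
    and F :: "('o, 'a list, 'a path_cell, 'w, 'p, 'b) colax" +
  assumes ccomp_in_W: "\<lbrakk>A \<in> Obj C; B \<in> Obj C; E \<in> Obj C; chain C B t E; chain C A s B\<rbrakk>
      \<Longrightarrow> ccomp F A B E t s \<in> W (cobj F A) (cobj F E)"
    and cunit_in_W: "A \<in> Obj C \<Longrightarrow> cunit F A \<in> W (cobj F A) (cobj F A)"

text \<open>Arrows carry their source and target.\<close>

definition points ::
  "('o, 'a) cat \<Rightarrow> ('w, 'p, 'b) bicat \<Rightarrow> ('w \<Rightarrow> 'w \<Rightarrow> 'b set)
    \<Rightarrow> (('o, 'a list, 'a path_cell, 'w, 'p, 'b) colax,
        ('o, 'a list, 'a path_cell, 'w, 'p, 'b) colax \<times> ('o \<Rightarrow> 'o \<Rightarrow> 'a list \<Rightarrow> 'b)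
          \<times> ('o, 'a list, 'a path_cell, 'w, 'p, 'b) colax) cat" where
  "points C M W =
    \<lparr>Obj = {F. point C M W F},
     Arr = {(F, \<sigma>, G). point C M W F \<and> point C M W G
              \<and> colax_transformation (path_bicat C) M F G \<sigma>},
     Dom = fst,
     Cod = (\<lambda>w. snd (snd w)),
     Ide = (\<lambda>F. (F, (\<lambda>A B s. if A \<in> Obj C \<and> B \<in> Obj C \<and> chain C A s B
              then Ide (Hc M (cobj F A) (cobj F B)) (omap (chom F A B) s) else undefined), F)),
     Comp = (\<lambda>(_, \<tau>, H) (F, \<sigma>, _).
              (F, (\<lambda>A B s. if A \<in> Obj C \<and> B \<in> Obj C \<and> chain C A s B
                 then \<tau> A B s \<cdot>\<^bsub>Hc M (cobj F A) (cobj F B)\<^esub> \<sigma> A B s else undefined), H))\<rparr>"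


record ('o, 'a) moncat =
  mcat :: "('o, 'a) cat"
  tobj :: "'o \<Rightarrow> 'o \<Rightarrow> 'o" (infixr "\<otimes>\<^sub>o\<index>" 75)
  tarr :: "'a \<Rightarrow> 'a \<Rightarrow> 'a" (infixr "\<otimes>\<^sub>a\<index>" 75)
  munit :: "'o" ("\<I>\<index>")
  massoc :: "'o \<Rightarrow> 'o \<Rightarrow> 'o \<Rightarrow> 'a" ("\<alpha>\<index>")
  mlunit :: "'o \<Rightarrow> 'a" ("\<ll>\<index>")
  mrunit :: "'o \<Rightarrow> 'a" ("\<rr>\<index>")

abbreviation mcomp (infixl "\<odot>\<index>" 70) where
  "mcomp M g f \<equiv> Comp (mcat M) g f"

abbreviation mide ("\<one>\<index>") where
  "mide M \<equiv> Ide (mcat M)"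

locale monoidal_category =
  fixes M :: "('o, 'a) moncat" (structure)
  assumes underlying: "category (mcat M)"
    and tobj_closed: "\<lbrakk>a \<in> Obj (mcat M); b \<in> Obj (mcat M)\<rbrakk> \<Longrightarrow> a \<otimes>\<^sub>o b \<in> Obj (mcat M)"
    and tarr_closed: "\<lbrakk>g \<in> Hom (mcat M) b b'; f \<in> Hom (mcat M) a a'\<rbrakk>
      \<Longrightarrow> g \<otimes>\<^sub>a f \<in> Hom (mcat M) (b \<otimes>\<^sub>o a) (b' \<otimes>\<^sub>o a')"
    and tarr_ide: "\<lbrakk>a \<in> Obj (mcat M); b \<in> Obj (mcat M)\<rbrakk> \<Longrightarrow> \<one> a \<otimes>\<^sub>a \<one> b = \<one> (a \<otimes>\<^sub>o b)"
    and tarr_comp: "\<lbrakk>g \<in> Hom (mcat M) b b'; g' \<in> Hom (mcat M) b' b'';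
        f \<in> Hom (mcat M) a a'; f' \<in> Hom (mcat M) a' a''\<rbrakk>
      \<Longrightarrow> (g' \<odot> g) \<otimes>\<^sub>a (f' \<odot> f) = (g' \<otimes>\<^sub>a f') \<odot> (g \<otimes>\<^sub>a f)"
    and munit_closed: "\<I> \<in> Obj (mcat M)"
    and massoc_closed: "\<lbrakk>a \<in> Obj (mcat M); b \<in> Obj (mcat M); c \<in> Obj (mcat M)\<rbrakk>
      \<Longrightarrow> \<alpha> a b c \<in> Isos (mcat M) \<inter> Hom (mcat M) ((a \<otimes>\<^sub>o b) \<otimes>\<^sub>o c) (a \<otimes>\<^sub>o (b \<otimes>\<^sub>o c))"
    and massoc_natural: "\<lbrakk>f \<in> Hom (mcat M) a a'; g \<in> Hom (mcat M) b b'; h \<in> Hom (mcat M) c c'\<rbrakk>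
      \<Longrightarrow> \<alpha> a' b' c' \<odot> ((f \<otimes>\<^sub>a g) \<otimes>\<^sub>a h) = (f \<otimes>\<^sub>a (g \<otimes>\<^sub>a h)) \<odot> \<alpha> a b c"
    and mlunit_closed: "a \<in> Obj (mcat M) \<Longrightarrow> \<ll> a \<in> Isos (mcat M) \<inter> Hom (mcat M) (\<I> \<otimes>\<^sub>o a) a"
    and mlunit_natural: "f \<in> Hom (mcat M) a a' \<Longrightarrow> \<ll> a' \<odot> (\<one> \<I> \<otimes>\<^sub>a f) = f \<odot> \<ll> a"
    and mrunit_closed: "a \<in> Obj (mcat M) \<Longrightarrow> \<rr> a \<in> Isos (mcat M) \<inter> Hom (mcat M) (a \<otimes>\<^sub>o \<I>) a"
    and mrunit_natural: "f \<in> Hom (mcat M) a a' \<Longrightarrow> \<rr> a' \<odot> (f \<otimes>\<^sub>a \<one> \<I>) = f \<odot> \<rr> a"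
    and mpentagon: "\<lbrakk>a \<in> Obj (mcat M); b \<in> Obj (mcat M); c \<in> Obj (mcat M); d \<in> Obj (mcat M)\<rbrakk>
      \<Longrightarrow> \<alpha> a b (c \<otimes>\<^sub>o d) \<odot> \<alpha> (a \<otimes>\<^sub>o b) c d
          = (\<one> a \<otimes>\<^sub>a \<alpha> b c d) \<odot> \<alpha> a (b \<otimes>\<^sub>o c) d \<odot> (\<alpha> a b c \<otimes>\<^sub>a \<one> d)"
    and mtriangle: "\<lbrakk>a \<in> Obj (mcat M); b \<in> Obj (mcat M)\<rbrakk>
      \<Longrightarrow> (\<one> a \<otimes>\<^sub>a \<ll> b) \<odot> \<alpha> a \<I> b = \<rr> a \<otimes>\<^sub>a \<one> b"

definition deloop :: "('o, 'a) moncat \<Rightarrow> (unit, 'o, 'a) bicat" where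
  "deloop M = \<lparr>Cells0 = {()}, Hc = (\<lambda>_ _. mcat M), hobj = (\<lambda>_ _ _. tobj M),
     harr = (\<lambda>_ _ _. tarr M), hunit = (\<lambda>_. munit M), assoc = (\<lambda>_ _ _ _. massoc M),
     lunit = (\<lambda>_ _. mlunit M), runit = (\<lambda>_ _. mrunit M)\<rparr>"

lemma bicategory_deloop:
  assumes "monoidal_category M"
  shows "bicategory (deloop M)"
proof -
  interpret monoidal_category M by fact
  show ?thesis
    by (rule bicategory.intro)
      (simp_all add: deloop_def underlying tobj_closed tarr_closed tarr_ide tarr_comp munit_closed
        massoc_closed[simplified] massoc_natural mlunit_closed[simplified] mlunit_natural
        mrunit_closed[simplified] mrunit_natural mpentagon mtriangle)
qed


record ('x, 'o, 'a) ecat =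
  ehom :: "'x \<Rightarrow> 'x \<Rightarrow> 'o"
  ecomp :: "'x \<Rightarrow> 'x \<Rightarrow> 'x \<Rightarrow> 'a"
  eunit :: "'x \<Rightarrow> 'a"

locale enriched_category = monoidal_category M
  for M :: "('o, 'a) moncat" (structure) and X :: "'x set" and E :: "('x, 'o, 'a) ecat" +
  assumes ehom_closed: "\<lbrakk>A \<in> X; B \<in> X\<rbrakk> \<Longrightarrow> ehom E A B \<in> Obj (mcat M)"
    and ecomp_closed: "\<lbrakk>A \<in> X; B \<in> X; C \<in> X\<rbrakk>
      \<Longrightarrow> ecomp E A B C \<in> Hom (mcat M) (ehom E B C \<otimes>\<^sub>o ehom E A B) (ehom E A C)"
    and eunit_closed: "A \<in> X \<Longrightarrow> eunit E A \<in> Hom (mcat M) \<I> (ehom E A A)"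
    and ecomp_assoc: "\<lbrakk>A \<in> X; B \<in> X; C \<in> X; D \<in> X\<rbrakk>
      \<Longrightarrow> ecomp E A B D \<odot> (ecomp E B C D \<otimes>\<^sub>a \<one> (ehom E A B))
          = ecomp E A C D \<odot> (\<one> (ehom E C D) \<otimes>\<^sub>a ecomp E A B C)
              \<odot> \<alpha> (ehom E C D) (ehom E B C) (ehom E A B)"
    and ecomp_lunit: "\<lbrakk>A \<in> X; B \<in> X\<rbrakk>
      \<Longrightarrow> ecomp E A B B \<odot> (eunit E B \<otimes>\<^sub>a \<one> (ehom E A B)) = \<ll> (ehom E A B)"
    and ecomp_runit: "\<lbrakk>A \<in> X; B \<in> X\<rbrakk>
      \<Longrightarrow> ecomp E A A B \<odot> (\<one> (ehom E A B) \<otimes>\<^sub>a eunit E A) = \<rr> (ehom E A B)"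
    and ehom_ext: "\<not> (A \<in> X \<and> B \<in> X) \<Longrightarrow> ehom E A B = undefined"
    and ecomp_ext: "\<not> (A \<in> X \<and> B \<in> X \<and> C \<in> X) \<Longrightarrow> ecomp E A B C = undefined"
    and eunit_ext: "eunit E \<in> extensional X"

text \<open>Enriched functors that are the identity on objects.\<close>

locale enriched_functor = E: enriched_category M X E + E': enriched_category M X E'
  for M :: "('o, 'a) moncat" (structure) and X :: "'x set" and E E' +
  fixes T :: "'x \<Rightarrow> 'x \<Rightarrow> 'a"
  assumes efun_closed: "\<lbrakk>A \<in> X; B \<in> X\<rbrakk> \<Longrightarrow> T A B \<in> Hom (mcat M) (ehom E A B) (ehom E' A B)"
    and efun_comp: "\<lbrakk>A \<in> X; B \<in> X; C \<in> X\<rbrakk>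
      \<Longrightarrow> T A C \<odot> ecomp E A B C = ecomp E' A B C \<odot> (T B C \<otimes>\<^sub>a T A B)"
    and efun_unit: "A \<in> X \<Longrightarrow> T A A \<odot> eunit E A = eunit E' A"
    and efun_ext: "\<not> (A \<in> X \<and> B \<in> X) \<Longrightarrow> T A B = undefined"

definition enriched_categories ::
  "('o, 'a) moncat \<Rightarrow> 'x set
    \<Rightarrow> (('x, 'o, 'a) ecat, ('x, 'o, 'a) ecat \<times> ('x \<Rightarrow> 'x \<Rightarrow> 'a) \<times> ('x, 'o, 'a) ecat) cat" where
  "enriched_categories M X =
    \<lparr>Obj = {E. enriched_category M X E},
     Arr = {(E, T, E'). enriched_functor M X E E' T},
     Dom = fst,
     Cod = (\<lambda>w. snd (snd w)),
     Ide = (\<lambda>E. (E, (\<lambda>A B. if A \<in> X \<and> B \<in> X then Ide (mcat M) (ehom E A B) else undefined), E)),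
     Comp = (\<lambda>(_, T', E'') (E, T, _).
              (E, (\<lambda>A B. if A \<in> X \<and> B \<in> X then T' A B \<cdot>\<^bsub>mcat M\<^esub> T A B else undefined), E''))\<rparr>"

end

theory Submission
  imports Defs
begin

text \<open>
  A point \<open>F\<close> over the coarse category gives the hom objects \<open>F[(A, B)]\<close>; the composition is the
  image of the 2-cell \<open>[(A, B), (B, D)] \<rightarrow> [(A, D)]\<close> precomposed with the inverse of the structure
  2-cell of \<open>F\<close>, and the unit is obtained in the same way from \<open>[] \<rightarrow> [(A, A)]\<close>. This functor to
  enriched categories is an equivalence because it is fully faithful and essentially surjective.

  Since the structure 2-cells are invertible, \<open>F\<close> of a path is determined by its values on single
  arrows, and a transformation is determined by its components there; these extend recursively along
  paths. Every 2-cell of paths is an ordinal sum of collapses of a path to a single arrow, so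
  naturality has to be checked for collapses only, where it is compatibility with composition and
  unit. Conversely, an enriched category \<open>E\<close> defines a point sending a path to the iterated tensor
  product of its hom objects and a collapse to the iterated composition; its enriched category
  is isomorphic to \<open>E\<close> by the left unit constraints.
\<close>

text \<open>The obstacle is that paths concatenate strictly while \<open>M\<close> need not be
  strict. Mac Lane's coherence theorem is not invoked: all rebracketing is done by one family,
  \<open>path_assoc\<close>, recursive in the path travelled first, and its coherence reduces to the
  pentagon, the triangle and Kelly's unit laws. Iterated tensor products and iterated compositions
  start from the unit, which keeps the recursion uniform down to the empty path. The price is that a
  path with one arrow goes to \<I> tensored with its hom object, so that an enriched category is
  recovered only up to \<ll>. How a 2-cell is cut into collapses depends on its target. For a
  vertical composite, induction therefore runs over the later 2-cell, and the earlier one is split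
  along its blocks. The fact that makes this work, that a 2-cell followed by a collapse is a
  collapse, is also what makes the enriched composition associative. No inverse functor is written
  down: the general criterion produces it by choice from fullness, faithfulness and essential
  surjectivity.\<close>

section \<open>Isomorphisms and equivalences of categories\<close>

context category
begin

lemma in_Hom_iff: "f \<in> Hom C A B \<longleftrightarrow> f \<in> Arr C \<and> Dom C f = A \<and> Cod C f = B"
  by (simp add: Hom_def)

lemma arr_in_Hom: "f \<in> Arr C \<Longrightarrow> f \<in> Hom C (Dom C f) (Cod C f)"
  by (simp add: Hom_def)

lemma Hom_objs: "f \<in> Hom C A B \<Longrightarrow> A \<in> Obj C \<and> B \<in> Obj C"
  using dom_closed cod_closed by (auto simp: Hom_def)

lemma ide_simps:
  assumes "A \<in> Obj C"
  shows "Ide C A \<in> Arr C" "Dom C (Ide C A) = A" "Cod C (Ide C A) = A"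
  using ide_closed[OF assms] by (auto simp: Hom_def)

lemma comp_simps:
  assumes "f \<in> Arr C" "g \<in> Arr C" "Cod C f = Dom C g"
  shows "g \<cdot> f \<in> Arr C" "Dom C (g \<cdot> f) = Dom C f" "Cod C (g \<cdot> f) = Cod C g"
  using comp_closed[of f "Dom C f" "Dom C g" g "Cod C g"] assms by (auto simp: Hom_def)

lemma comp_assoc_arr:
  assumes "f \<in> Arr C" "g \<in> Arr C" "h \<in> Arr C" "Cod C f = Dom C g" "Cod C g = Dom C h"
  shows "h \<cdot> g \<cdot> f = h \<cdot> (g \<cdot> f)"
  using assms by (intro comp_assoc) (auto simp: Hom_def)

lemma ide_comp:
  assumes "f \<in> Arr C"
  shows "Cod C f = B \<Longrightarrow> Ide C B \<cdot> f = f" "Dom C f = A \<Longrightarrow> f \<cdot> Ide C A = f"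
  using comp_ide_left comp_ide_right assms by (auto simp: Hom_def)

lemmas cat_simps = dom_closed cod_closed ide_simps comp_simps comp_assoc_arr ide_comp

end

definition cinv :: "('o, 'a) cat \<Rightarrow> 'a \<Rightarrow> 'a" where
  "cinv C f = (SOME g. g \<in> Hom C (Cod C f) (Dom C f) \<and>
     g \<cdot>\<^bsub>C\<^esub> f = Ide C (Dom C f) \<and> f \<cdot>\<^bsub>C\<^esub> g = Ide C (Cod C f))"

context category
begin

lemma cinv_props:
  assumes "f \<in> Isos C"
  shows "cinv C f \<in> Hom C (Cod C f) (Dom C f) \<and>
     cinv C f \<cdot> f = Ide C (Dom C f) \<and> f \<cdot> cinv C f = Ide C (Cod C f)"
  unfolding cinv_def by (rule someI_ex) (use assms in \<open>auto simp: Isos_def\<close>)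

lemma Isos_arr: "f \<in> Isos C \<Longrightarrow> f \<in> Arr C"
  by (simp add: Isos_def)

lemma cinv_simps:
  assumes "f \<in> Isos C"
  shows "cinv C f \<in> Arr C" "Dom C (cinv C f) = Cod C f" "Cod C (cinv C f) = Dom C f"
    "cinv C f \<cdot> f = Ide C (Dom C f)" "f \<cdot> cinv C f = Ide C (Cod C f)"
  using cinv_props[OF assms] by (auto simp: Hom_def)

text \<open>Stated for right-nested composites, the form that \<open>comp_assoc_arr\<close> produces
  as a rewrite rule; \<open>cinv_simps\<close> would not match there.\<close>

lemma cinv_cancel:
  assumes "f \<in> Isos C" "g \<in> Arr C"
  shows "Cod C g = Dom C f \<Longrightarrow> cinv C f \<cdot> (f \<cdot> g) = g"
    "Cod C g = Cod C f \<Longrightarrow> f \<cdot> (cinv C f \<cdot> g) = g"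
  using assms by (simp_all add: cinv_simps Isos_arr cat_simps flip: comp_assoc_arr)

lemma IsosI:
  assumes "f \<in> Hom C A B" "g \<in> Hom C B A" "g \<cdot> f = Ide C A" "f \<cdot> g = Ide C B"
  shows "f \<in> Isos C"
  using assms by (auto simp: Isos_def Hom_def)

lemma Isos_cinv: "f \<in> Isos C \<Longrightarrow> cinv C f \<in> Isos C"
  by (rule IsosI[of _ "Cod C f" "Dom C f" f]) (simp_all add: cinv_simps Isos_arr Hom_def)

lemma Isos_ide: "A \<in> Obj C \<Longrightarrow> Ide C A \<in> Isos C"
  by (rule IsosI[of _ A A "Ide C A"]) (auto simp: ide_closed cat_simps)

lemma Isos_comp:
  assumes "f \<in> Isos C" "g \<in> Isos C" "Cod C f = Dom C g"
  shows "g \<cdot> f \<in> Isos C"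
  by (rule IsosI[of _ "Dom C f" "Cod C g" "cinv C f \<cdot> cinv C g"])
    (use assms in \<open>simp_all add: Hom_def cat_simps cinv_simps Isos_arr cinv_cancel\<close>)

lemma iso_cancel_left:
  assumes "h \<in> Isos C" "f \<in> Arr C" "g \<in> Arr C" "Cod C f = Dom C h" "Cod C g = Dom C h"
    "h \<cdot> f = h \<cdot> g"
  shows "f = g"
  using assms cinv_cancel(1) by metis

lemma iso_cancel_right:
  assumes "h \<in> Isos C" "f \<in> Arr C" "g \<in> Arr C" "Dom C f = Cod C h" "Dom C g = Cod C h"
    "f \<cdot> h = g \<cdot> h"
  shows "f = g"
proof -
  have "f \<cdot> h \<cdot> cinv C h = g \<cdot> h \<cdot> cinv C h"
    using assms by simp
  then show ?thesis
    using assms(1-5) by (simp add: cat_simps cinv_simps Isos_arr)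
qed

lemma Isos_left_factor:
  assumes "u \<in> Isos C" "v \<cdot> u \<in> Isos C" "v \<in> Arr C" "Cod C u = Dom C v"
  shows "v \<in> Isos C"
proof -
  have "v = v \<cdot> u \<cdot> cinv C u"
    using assms by (simp add: cat_simps cinv_simps Isos_arr)
  then show ?thesis
    using Isos_comp[OF Isos_cinv[OF assms(1)] assms(2)] assms by (simp add: cinv_simps cat_simps Isos_arr)
qed

lemma Isos_right_factor:
  assumes "v \<in> Isos C" "v \<cdot> u \<in> Isos C" "u \<in> Arr C" "Cod C u = Dom C v"
  shows "u \<in> Isos C"
proof -
  have "u = cinv C v \<cdot> (v \<cdot> u)"
    using assms by (simp add: cinv_cancel)
  then show ?thesis
    using Isos_comp[OF assms(2) Isos_cinv[OF assms(1)]] assms by (simp add: cinv_simps cat_simps Isos_arr)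
qed

end

text \<open>\<open>point\<close> asks for a class of 2-cells with these closure properties. A
  horizontal composite of isomorphisms is inverted by the horizontal composite of the inverses, by
  interchange.\<close>

lemma (in bicategory) two_cell_class_Iso_cells: "two_cell_class M (Iso_cells M)"
proof (unfold_locales; unfold Iso_cells_def)
  fix A B assume AB: "A \<in> Cells0 M" "B \<in> Cells0 M"
  interpret H: category "Hc M A B" using AB by (rule hom_category)
  show "Isos (Hc M A B) \<subseteq> Arr (Hc M A B)"
    using H.Isos_arr by blast
  fix u r s v t
  assume "u \<in> Hom (Hc M A B) r s" "v \<in> Hom (Hc M A B) s t"
    "u \<in> Isos (Hc M A B) \<and> v \<in> Isos (Hc M A B)
      \<or> u \<in> Isos (Hc M A B) \<and> v \<cdot>\<^bsub>Hc M A B\<^esub> u \<in> Isos (Hc M A B)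
      \<or> v \<in> Isos (Hc M A B) \<and> v \<cdot>\<^bsub>Hc M A B\<^esub> u \<in> Isos (Hc M A B)"
  then show "u \<in> Isos (Hc M A B) \<and> v \<in> Isos (Hc M A B) \<and> v \<cdot>\<^bsub>Hc M A B\<^esub> u \<in> Isos (Hc M A B)"
    using H.Isos_comp[of u v] H.Isos_left_factor[of u v] H.Isos_right_factor[of v u]
    by (auto simp: Hom_def)
next
  fix A B C v u
  assume A: "A \<in> Cells0 M" and B: "B \<in> Cells0 M" and C: "C \<in> Cells0 M"
    and v: "v \<in> Isos (Hc M B C)" and u: "u \<in> Isos (Hc M A B)"
  interpret U: category "Hc M A B" using A B by (rule hom_category)
  interpret V: category "Hc M B C" using B C by (rule hom_category)
  interpret W: category "Hc M A C" using A C by (rule hom_category)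
  note vH = V.arr_in_Hom[OF V.Isos_arr[OF v]] V.cinv_props[OF v]
  note uH = U.arr_in_Hom[OF U.Isos_arr[OF u]] U.cinv_props[OF u]
  show "harr M A B C v u \<in> Isos (Hc M A C)"
    by (rule W.IsosI[of _ _ _ "harr M A B C (cinv (Hc M B C) v) (cinv (Hc M A B) u)"])
      (use A B C vH uH U.Hom_objs V.Hom_objs in
        \<open>auto intro!: harr_closed simp flip: interchange harr_ide\<close>)
qed auto

section \<open>Fully faithful and essentially surjective functors are equivalences\<close>

lemma cat_functor_id:
  assumes "category C"
  shows "cat_functor C C (id_func C)"
proof -
  interpret category C by fact
  show ?thesis
    by unfold_locales (auto simp: id_func_def in_Hom_iff cat_simps)
qed

lemma cat_functor_comp:
  assumes "cat_functor C D F" "cat_functor D E G"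
  shows "cat_functor C E (comp_func C G F)"
proof -
  interpret F: cat_functor C D F by fact
  interpret G: cat_functor D E G by fact
  show ?thesis
  proof unfold_locales
    fix f A B assume f: "f \<in> Hom C A B"
    then show "amap (comp_func C G F) f
        \<in> Hom E (omap (comp_func C G F) A) (omap (comp_func C G F) B)"
      using G.amap_closed[OF F.amap_closed[OF f]] F.C.Hom_objs[OF f]
      by (simp add: comp_func_def F.C.in_Hom_iff compose_def)
    fix g H assume g: "g \<in> Hom C B H"
    then show "amap (comp_func C G F) (g \<cdot>\<^bsub>C\<^esub> f)
        = amap (comp_func C G F) g \<cdot>\<^bsub>E\<^esub> amap (comp_func C G F) f"
      using f F.C.comp_closed[OF f g] G.amap_comp[OF F.amap_closed[OF f] F.amap_closed[OF g]]
      by (simp add: comp_func_def compose_def F.C.in_Hom_iff F.amap_comp[OF f g])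
  qed (auto simp: comp_func_def compose_def F.omap_closed G.omap_closed F.amap_ide G.amap_ide
      F.C.ide_simps)
qed

text \<open>Preimages of objects and isomorphisms to them are chosen, and an arrow of
  \<open>D\<close> is conjugated with these before it is lifted. Functoriality of \<open>G\<close>,
  and naturality and invertibility of \<eta>, are equations in \<open>C\<close>; they hold because
  they hold after applying the faithful \<open>F\<close>.\<close>

lemma equivalent_categories_fully_faithful:
  fixes C :: "('o, 'a) cat" and D :: "('p, 'b) cat"
  assumes "cat_functor C D F"
    and full: "\<And>A B g. \<lbrakk>A \<in> Obj C; B \<in> Obj C; g \<in> Hom D (omap F A) (omap F B)\<rbrakk>
      \<Longrightarrow> \<exists>f \<in> Hom C A B. amap F f = g"
    and faithful: "\<And>A B f f'. \<lbrakk>f \<in> Hom C A B; f' \<in> Hom C A B; amap F f = amap F f'\<rbrakk> \<Longrightarrow> f = f'"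
    and surj: "\<And>B. B \<in> Obj D \<Longrightarrow> \<exists>A \<in> Obj C. Isos D \<inter> Hom D (omap F A) B \<noteq> {}"
  shows "equivalent_categories C D"
proof -
  interpret F: cat_functor C D F by fact
  obtain g i where gi: "\<And>B. B \<in> Obj D \<Longrightarrow> g B \<in> Obj C \<and> i B \<in> Isos D \<inter> Hom D (omap F (g B)) B"
    using surj unfolding Bex_def ex_in_conv[symmetric] by metis
  note i_simps = F.D.cinv_simps F.D.cinv_cancel F.D.cat_simps F.D.Isos_arr
  have g: "g B \<in> Obj C" and i: "i B \<in> Isos D" "i B \<in> Arr D" "Dom D (i B) = omap F (g B)" "Cod D (i B) = B"
    if "B \<in> Obj D" for B
    using gi[OF that] by (auto simp: Hom_def)
  define lift where "lift A B h = (SOME f. f \<in> Hom C A B \<and> amap F f = h)" for A B h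
  have lift: "lift A B h \<in> Hom C A B \<and> amap F (lift A B h) = h"
    if "A \<in> Obj C" "B \<in> Obj C" "h \<in> Hom D (omap F A) (omap F B)" for A B h
    unfolding lift_def by (rule someI_ex) (use full[OF that] in blast)
  \<comment> \<open>Conjugation with \<open>i\<close> makes \<open>i\<close> itself the counit: its
    naturality is mere cancellation.\<close>
  define ga where "ga h = lift (g (Dom D h)) (g (Cod D h))
     (cinv D (i (Cod D h)) \<cdot>\<^bsub>D\<^esub> h \<cdot>\<^bsub>D\<^esub> i (Dom D h))" for h
  define G where "G = \<lparr>omap = restrict g (Obj D), amap = restrict ga (Arr D)\<rparr>"
  have ga: "ga h \<in> Hom C (g A) (g B) \<and> amap F (ga h) = cinv D (i B) \<cdot>\<^bsub>D\<^esub> h \<cdot>\<^bsub>D\<^esub> i A"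
    if "h \<in> Hom D A B" for A B h
  proof -
    have "A \<in> Obj D" "B \<in> Obj D" using F.D.Hom_objs[OF that] by auto
    then show ?thesis
      using that lift[of "g A" "g B" "cinv D (i B) \<cdot>\<^bsub>D\<^esub> h \<cdot>\<^bsub>D\<^esub> i A"]
      by (simp add: ga_def Hom_def g i i_simps)
  qed
  have amapF: "amap F f \<in> Arr D" "Dom D (amap F f) = omap F A" "Cod D (amap F f) = omap F B"
    if "f \<in> Hom C A B" for f A B
    using F.amap_closed[OF that] by (auto simp: Hom_def)
  have G: "cat_functor D C G"
  proof unfold_locales
    fix f A B assume f: "f \<in> Hom D A B"
    then have AB: "A \<in> Obj D" "B \<in> Obj D" using F.D.Hom_objs by blast+
    show "amap G f \<in> Hom C (omap G A) (omap G B)"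
      using ga[OF f] f AB by (simp add: G_def Hom_def)
    fix k E assume k: "k \<in> Hom D B E"
    then have E: "E \<in> Obj D" using F.D.Hom_objs by blast
    have kf: "k \<cdot>\<^bsub>D\<^esub> f \<in> Hom D A E" using F.D.comp_closed f k by blast
    note gas = ga[OF f] ga[OF k] ga[OF kf]
    have "ga (k \<cdot>\<^bsub>D\<^esub> f) = ga k \<cdot>\<^bsub>C\<^esub> ga f"
    proof (rule faithful[of _ "g A" "g E"])
      show "amap F (ga (k \<cdot>\<^bsub>D\<^esub> f)) = amap F (ga k \<cdot>\<^bsub>C\<^esub> ga f)"
        using gas f k AB E F.amap_comp[of "ga f" "g A" "g B" "ga k" "g E"]
        by (simp add: F.D.in_Hom_iff i i_simps)
    qed (use gas in \<open>auto intro: F.C.comp_closed\<close>)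
    then show "amap G (k \<cdot>\<^bsub>D\<^esub> f) = amap G k \<cdot>\<^bsub>C\<^esub> amap G f"
      using f k kf by (simp add: G_def Hom_def)
  next
    fix A assume A: "A \<in> Obj D"
    have "ga (Ide D A) = Ide C (g A)"
      by (rule faithful[of _ "g A" "g A"])
        (use A g ga[OF F.D.ide_closed[OF A]] in
          \<open>auto simp: F.C.ide_closed F.amap_ide i i_simps\<close>)
    then show "amap G (Ide D A) = Ide C (omap G A)"
      using A by (simp add: G_def F.D.ide_simps)
  qed (auto simp: G_def g)
  interpret G: cat_functor D C G by (fact G)
  define \<epsilon> where "\<epsilon> = restrict i (Obj D)"
  have "natural_iso D D (comp_func D F G) (id_func D) \<epsilon>"
    unfolding natural_iso_def
  proof (intro conjI ballI natural_transformation.intro natural_transformation_axioms.intro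
      cat_functor_id cat_functor_comp[OF G assms(1)] F.D.category_axioms)
    fix f A B assume f: "f \<in> Hom D A B"
    then have AB: "A \<in> Obj D" "B \<in> Obj D" using F.D.Hom_objs by blast+
    show "\<epsilon> B \<cdot>\<^bsub>D\<^esub> amap (comp_func D F G) f = amap (id_func D) f \<cdot>\<^bsub>D\<^esub> \<epsilon> A"
      using f ga[OF f] AB
      by (simp add: \<epsilon>_def comp_func_def id_func_def compose_def G_def F.D.in_Hom_iff i i_simps)
  qed (auto simp: \<epsilon>_def i comp_func_def id_func_def compose_def G_def F.D.in_Hom_iff)
  moreover
  \<comment> \<open>Chosen so that \<open>amap F\<close> sends it to the inverse of the counit at
    \<open>omap F A\<close>.\<close>
  define \<eta> where "\<eta> = restrict (\<lambda>A. lift A (g (omap F A)) (cinv D (i (omap F A)))) (Obj C)"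
  have gF: "g (omap F A) \<in> Obj C" if "A \<in> Obj C" for A
    using that by (simp add: g F.omap_closed)
  have inv_i: "cinv D (i (omap F A)) \<in> Hom D (omap F A) (omap F (g (omap F A)))"
    "i (omap F A) \<in> Hom D (omap F (g (omap F A))) (omap F A)" if "A \<in> Obj C" for A
    using F.omap_closed[OF that] by (simp_all add: F.D.in_Hom_iff i i_simps)
  have \<eta>: "\<eta> A \<in> Hom C A (g (omap F A)) \<and> amap F (\<eta> A) = cinv D (i (omap F A))"
    if "A \<in> Obj C" for A
    using that lift[OF that gF[OF that] inv_i(1)[OF that]] by (simp add: \<eta>_def)
  have "natural_iso C C (id_func C) (comp_func C G F) \<eta>"
    unfolding natural_iso_def
  proof (intro conjI ballI natural_transformation.intro natural_transformation_axioms.intro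
      cat_functor_id cat_functor_comp[OF assms(1) G] F.C.category_axioms)
    fix f A B assume f: "f \<in> Hom C A B"
    then have AB: "A \<in> Obj C" "B \<in> Obj C" using F.C.Hom_objs by blast+
    note \<eta>A = \<eta>[OF AB(1)] and \<eta>B = \<eta>[OF AB(2)]
    note Ff = F.amap_closed[OF f]
    note gaf = ga[OF Ff]
    have "\<eta> B \<cdot>\<^bsub>C\<^esub> f = ga (amap F f) \<cdot>\<^bsub>C\<^esub> \<eta> A"
    proof (rule faithful[of _ A "g (omap F B)"])
      have "amap F (\<eta> B \<cdot>\<^bsub>C\<^esub> f) = cinv D (i (omap F B)) \<cdot>\<^bsub>D\<^esub> amap F f"
        using \<eta>B F.amap_comp[OF f, of "\<eta> B" "g (omap F B)"] by simp
      also have "\<dots> = amap F (ga (amap F f)) \<cdot>\<^bsub>D\<^esub> cinv D (i (omap F A))"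
        using gaf inv_i[OF AB(1)] inv_i[OF AB(2)] Ff AB
        by (simp add: F.D.in_Hom_iff i i_simps F.omap_closed)
      also have "\<dots> = amap F (ga (amap F f) \<cdot>\<^bsub>C\<^esub> \<eta> A)"
        using \<eta>A F.amap_comp[of "\<eta> A" A "g (omap F A)" "ga (amap F f)" "g (omap F B)"] gaf by simp
      finally show "amap F (\<eta> B \<cdot>\<^bsub>C\<^esub> f) = amap F (ga (amap F f) \<cdot>\<^bsub>C\<^esub> \<eta> A)" .
    qed (use \<eta>A \<eta>B f gaf in \<open>auto intro: F.C.comp_closed\<close>)
    then show "\<eta> B \<cdot>\<^bsub>C\<^esub> amap (id_func C) f = amap (comp_func C G F) f \<cdot>\<^bsub>C\<^esub> \<eta> A"
      using f Ff by (simp add: comp_func_def id_func_def compose_def G_def F.D.in_Hom_iff F.C.in_Hom_iff)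
  next
    fix A assume A: "A \<in> Obj C"
    note FA = F.omap_closed[OF A]
    show "\<eta> A \<in> Hom C (omap (id_func C) A) (omap (comp_func C G F) A)"
      using \<eta>[OF A] A FA by (simp add: comp_func_def id_func_def compose_def G_def)
    \<comment> \<open>A lift of \<open>i\<close> itself. Since \<open>\<eta> A\<close> lifts the
      inverse of \<open>i\<close>, faithfulness makes \<open>k\<close> inverse to
      \<open>\<eta> A\<close>.\<close>
    obtain k where k: "k \<in> Hom C (g (omap F A)) A" "amap F k = i (omap F A)"
      using full[OF gF[OF A] A inv_i(2)[OF A]] by blast
    show "\<eta> A \<in> Isos C"
    proof (rule F.C.IsosI[of _ A "g (omap F A)" k])
      show "k \<cdot>\<^bsub>C\<^esub> \<eta> A = Ide C A"
        by (rule faithful[of _ A A])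
          (use \<eta>[OF A] k A FA F.amap_comp[of "\<eta> A" A "g (omap F A)" k A] in
            \<open>auto intro: F.C.comp_closed simp: F.C.ide_closed F.amap_ide i i_simps\<close>)
      show "\<eta> A \<cdot>\<^bsub>C\<^esub> k = Ide C (g (omap F A))"
        by (rule faithful[of _ "g (omap F A)" "g (omap F A)"])
          (use \<eta>[OF A] k A FA gF[OF A] F.amap_comp[of k "g (omap F A)" A "\<eta> A" "g (omap F A)"] in
            \<open>auto intro: F.C.comp_closed simp: F.C.ide_closed F.amap_ide i i_simps\<close>)
    qed (use \<eta>[OF A] k in auto)
  qed (auto simp: \<eta>_def)
  ultimately show ?thesis
    unfolding equivalent_categories_def
    using assms(1) G F.C.category_axioms F.D.category_axioms by blast
qed

section \<open>The bicategory of paths\<close>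

context category
begin

lemma chain_objs: "chain C A s B \<Longrightarrow> A \<in> Obj C \<and> B \<in> Obj C"
  by (induction s arbitrary: A) (auto simp: dom_closed)

lemma chain_append_iff: "chain C A (s @ t) D \<longleftrightarrow> (\<exists>B. chain C A s B \<and> chain C B t D)"
  by (induction s arbitrary: A) (auto dest: chain_objs)

lemma chain_append: "chain C A s B \<Longrightarrow> chain C B t D \<Longrightarrow> chain C A (s @ t) D"
  using chain_append_iff by blast

lemma chain_unique: "chain C A s B \<Longrightarrow> chain C A s B' \<Longrightarrow> B = B'"
  by (induction s arbitrary: A) auto

lemma composite_closed: "chain C A s B \<Longrightarrow> composite C A s \<in> Hom C A B"
  by (induction s arbitrary: A) (auto simp: in_Hom_iff cat_simps)

lemma composite_append:
  "chain C A s B \<Longrightarrow> chain C B t D \<Longrightarrow> composite C A (s @ t) = composite C B t \<cdot> composite C A s"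
proof (induction s arbitrary: A)
  case Nil
  then show ?case using composite_closed[OF Nil(2)] by (simp add: in_Hom_iff cat_simps)
next
  case (Cons f s)
  then show ?case using composite_closed[of "Cod C f" s B] composite_closed[of B t D]
    by (simp add: in_Hom_iff cat_simps)
qed

end

section \<open>Ordinal sums of path 2-cells\<close>

lemma filter_upt_append:
  "filter P [0..<n + m] = filter P [0..<n] @ map (\<lambda>i. n + i) (filter (\<lambda>i. P (n + i)) [0..<m])"
proof -
  have "[0..<n + m] = [0..<n] @ map (\<lambda>i. n + i) [0..<m]"
    using upt_add_eq_append[of 0 n m] map_add_upt[of n m] by (simp add: add.commute)
  then show ?thesis
    by (simp add: filter_map o_def)
qed

text \<open>The two summands land in disjoint ranges: \<open>u\<close> below \<open>m\<close> by
  hypothesis, the shifted \<open>v\<close> from \<open>m\<close> on. So an arrow of the target sees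
  arrows of one summand only.\<close>

lemma fibre_hcomp:
  assumes "u \<in> {..<length s} \<rightarrow>\<^sub>E {..<m}"
  shows "fibre (s @ t) (restrict (\<lambda>i. if i < length s then u i else m + v (i - length s))
      {..<length s + length t}) j = (if j < m then fibre s u j else fibre t v (j - m))"
proof -
  have 1: "filter (\<lambda>i. restrict (\<lambda>i. if i < length s then u i else m + v (i - length s))
      {..<length s + length t} i = j) [0..<length s] = (if j < m then filter (\<lambda>i. u i = j) [0..<length s] else [])"
    using assms by (auto intro!: filter_cong simp: filter_empty_conv PiE_iff)
  have 2: "filter (\<lambda>i. restrict (\<lambda>i. if i < length s then u i else m + v (i - length s))
      {..<length s + length t} (length s + i) = j) [0..<length t] =
      (if j < m then [] else filter (\<lambda>i. v i = j - m) [0..<length t])"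
    by (auto intro!: filter_cong simp: filter_empty_conv)
  show ?thesis
    unfolding fibre_def length_append filter_upt_append 1 2
    by (auto simp: nth_append)
qed

context category
begin

lemma path_hcomp_closed:
  assumes "w \<in> path_cells C B D" "z \<in> path_cells C A B"
  shows "path_hcomp w z \<in> path_cells C A D"
proof -
  obtain t v t' where w: "w = (t, v, t')" by (cases w)
  obtain s u s' where z: "z = (s, u, s')" by (cases z)
  define x where "x = restrict (\<lambda>i. if i < length s then u i else length s' + v (i - length s))
      {..<length s + length t}"
  have u: "u \<in> {..<length s} \<rightarrow>\<^sub>E {..<length s'}" "mono_on {..<length s} u"
    and v: "v \<in> {..<length t} \<rightarrow>\<^sub>E {..<length t'}" "mono_on {..<length t} v"
    using assms by (auto simp: path_cells_def w z)
  have "x \<in> {..<length (s @ t)} \<rightarrow>\<^sub>E {..<length (s' @ t')}"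
  proof (rule PiE_I)
    fix i assume "i \<in> {..<length (s @ t)}"
    then show "x i \<in> {..<length (s' @ t')}"
      using PiE_mem[OF u(1), of i] PiE_mem[OF v(1), of "i - length s"]
      by (auto simp: x_def)
  qed (simp add: x_def)
  moreover have "mono_on {..<length (s @ t)} x"
  proof (rule mono_onI)
    fix i j assume "i \<in> {..<length (s @ t)}" "j \<in> {..<length (s @ t)}" "i \<le> j"
    \<comment> \<open>If \<open>i\<close> lies in \<open>s\<close> and \<open>j\<close> in
      \<open>t\<close>, the bound on \<open>u\<close> decides, as the shifted values of
      \<open>v\<close> start at \<open>length s'\<close>.\<close>
    then show "x i \<le> x j"
      using PiE_mem[OF u(1), of i] mono_onD[OF u(2), of i j]
        mono_onD[OF v(2), of "i - length s" "j - length s"]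
      by (auto simp: x_def)
  qed
  moreover have "(s' @ t') ! j = composite C (Dom C ((s' @ t') ! j)) (fibre (s @ t) x j)"
    if "j < length (s' @ t')" for j
    using that assms unfolding x_def fibre_hcomp[OF u(1)]
    by (auto simp: path_cells_def w z nth_append)
  ultimately show ?thesis
    using assms unfolding w z
    by (auto simp: path_cells_def x_def[symmetric] intro: chain_append)
qed

end

section \<open>Collapses, and the decomposition of 2-cells into them\<close>

lemma fibre_const: "fibre s (restrict (\<lambda>_. 0) {..<length s}) 0 = s"
proof -
  have "filter (\<lambda>i. restrict (\<lambda>_. 0::nat) {..<length s} i = 0) [0..<length s] = [0..<length s]"
    by (auto simp: filter_id_conv)
  then show ?thesis by (simp add: fibre_def map_nth)
qed

lemma path_hcomp_assoc: "path_hcomp (path_hcomp w z) y = path_hcomp w (path_hcomp z y)"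
  by (cases w; cases z; cases y) (auto simp: fun_eq_iff restrict_def)

text \<open>The unique 2-cell from \<open>s\<close> to a path with one arrow: the map must be
  constant, and the arrow must be the composite. For \<open>s = []\<close> the arrow is an identity,
  so units as well as compositions come from collapses.\<close>

definition collapse :: "('o, 'a) cat \<Rightarrow> 'o \<Rightarrow> 'a list \<Rightarrow> 'a path_cell" where
  "collapse C A s = (s, restrict (\<lambda>_. 0) {..<length s}, [composite C A s])"

lemma path_hcomp_id: "path_hcomp (path_id t) (path_id s) = path_id (s @ t)"
  by (auto simp: path_id_def restrict_def fun_eq_iff)

lemma path_hcomp_id_Nil:
  assumes "w \<in> path_cells C A B"
  shows "path_hcomp w (path_id []) = w" "path_hcomp (path_id []) w = w"
  using assms by (auto simp: path_cells_def path_id_def PiE_iff extensional_def fun_eq_iff)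

context category
begin

lemma path_id_mem:
  assumes "chain C A s B"
  shows "path_id s \<in> path_cells C A B"
proof -
  have "s ! j \<in> Arr C" if "j < length s" for j
    using that assms by (induction s arbitrary: A j) (auto simp: nth_Cons split: nat.splits)
  moreover have "filter (\<lambda>i. (if i < length s then i else undefined) = j) [0..<length s] = [j]"
    if "j < length s" for j
  proof -
    have "[0..<length s] = [0..<j] @ j # [Suc j..<length s]"
      using that upt_add_eq_append[of 0 j "length s - j"] by (simp add: upt_conv_Cons)
    then show ?thesis
      using that by (auto simp: filter_empty_conv)
  qed
  ultimately show ?thesis
    using assms by (auto simp: path_id_def path_cells_def fibre_def restrict_def mono_on_def
        cat_simps split: if_splits)
qed

lemma collapse_closed:
  assumes "chain C A s B"
  shows "collapse C A s \<in> path_cells C A B"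
  using assms composite_closed[OF assms] chain_objs[OF assms] fibre_const[of s]
  by (auto simp: collapse_def path_cells_def mono_on_def in_Hom_iff)

text \<open>Lets ordinal sums of collapses reproduce identity 2-cells: an arrow that is left alone
  is collapsed by itself.\<close>

lemma collapse_single: "f \<in> Arr C \<Longrightarrow> Dom C f = A \<Longrightarrow> collapse C A [f] = path_id [f]"
  by (auto simp: collapse_def path_id_def cat_simps fun_eq_iff restrict_def)

text \<open>The block of \<open>s\<close> over the first arrow of the target splits off, so that every 2-cell is an
  ordinal sum of collapses.\<close>

lemma path_cell_Cons_decomp:
  assumes "(s, u, g # t) \<in> path_cells C A D"
  obtains B s0 s1 v where "s = s0 @ s1" "chain C A s0 B" "g = composite C A s0"
    "(s1, v, t) \<in> path_cells C B D" "(s, u, g # t) = path_hcomp (s1, v, t) (collapse C A s0)"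
proof -
  let ?n = "length s"
  have ch: "chain C A s D" "chain C A (g # t) D"
    and u: "u \<in> {..<?n} \<rightarrow>\<^sub>E {..<Suc (length t)}" "mono_on {..<?n} u"
    and fib: "\<And>j. j < Suc (length t) \<Longrightarrow> (g # t) ! j = composite C (Dom C ((g # t) ! j)) (fibre s u j)"
    using assms by (auto simp: path_cells_def)
  \<comment> \<open>By monotonicity the indices with value 0 form an initial segment; its length
    \<open>k\<close> may be 0 as well as \<open>?n\<close>.\<close>
  have "\<exists>k\<le>?n. (\<forall>i<k. u i = 0) \<and> (\<forall>i. k \<le> i \<and> i < ?n \<longrightarrow> 0 < u i)"
  proof (cases "\<exists>i<?n. 0 < u i")
    case True
    define k where "k = (LEAST i. i < ?n \<and> 0 < u i)"
    have k: "k < ?n" "0 < u k"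
      using LeastI_ex[OF True] by (simp_all add: k_def)
    have "u i = 0" if "i < k" for i
      using not_less_Least[of i "\<lambda>i. i < ?n \<and> 0 < u i"] that k by (auto simp: k_def)
    moreover have "0 < u i" if "k \<le> i" "i < ?n" for i
      using mono_onD[OF u(2), of k i] that k by auto
    ultimately show ?thesis using k(1) by (intro exI[of _ k]) auto
  next
    case False
    then show ?thesis by (intro exI[of _ ?n]) auto
  qed
  then obtain k where k: "k \<le> ?n" "\<And>i. i < k \<Longrightarrow> u i = 0" "\<And>i. k \<le> i \<Longrightarrow> i < ?n \<Longrightarrow> 0 < u i"
    by blast
  define s0 s1 where "s0 = take k s" and "s1 = drop k s"
  \<comment> \<open>No truncation occurs in the subtraction, since \<open>u\<close> is positive from
    \<open>k\<close> on.\<close>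
  define v where "v = restrict (\<lambda>i. u (k + i) - 1) {..<length s1}"
  have s: "s = s0 @ s1" and len: "length s0 = k" "length s = k + length s1"
    using k(1) by (auto simp: s0_def s1_def)
  obtain B where B: "chain C A s0 B" "chain C B s1 D"
    using ch(1) unfolding s chain_append_iff by blast
  have ueq: "u = restrict (\<lambda>i. if i < length s0 then restrict (\<lambda>_. 0) {..<length s0} i
      else 1 + v (i - length s0)) {..<length s0 + length s1}"
  proof
    fix i
    show "u i = restrict (\<lambda>i. if i < length s0 then restrict (\<lambda>_. 0) {..<length s0} i
      else 1 + v (i - length s0)) {..<length s0 + length s1} i"
    proof (cases "i < k")
      case True
      then show ?thesis using k(2) by (simp add: len)
    next
      case False
      then show ?thesis
        using k(3)[of i] PiE_arb[OF u(1), of i] len(2) by (cases "i < ?n") (auto simp: len(1) v_def)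
    qed
  qed
  have z: "restrict (\<lambda>_. 0) {..<length s0} \<in> {..<length s0} \<rightarrow>\<^sub>E {..<1::nat}" by auto
  have fibs: "fibre s u j = (if j < 1 then fibre s0 (restrict (\<lambda>_. 0) {..<length s0}) j
      else fibre s1 v (j - 1))" for j
    by (subst ueq, subst s, rule fibre_hcomp[OF z])
  \<comment> \<open>The fibre condition at index 0 determines \<open>g\<close>; at the successors it
    is the fibre condition for \<open>(s1, v, t)\<close>.\<close>
  have g: "g = composite C A s0"
    using fib[of 0] ch(2) fibre_const[of s0] by (simp add: fibs)
  then have "Cod C g = B" using composite_closed[OF B(1)] by (simp add: in_Hom_iff)
  then have tch: "chain C B t D" using ch(2) by simp
  have vm: "v \<in> {..<length s1} \<rightarrow>\<^sub>E {..<length t}"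
  proof (rule PiE_I)
    fix i assume "i \<in> {..<length s1}"
    then show "v i \<in> {..<length t}"
      using PiE_mem[OF u(1), of "k + i"] k(3)[of "k + i"] len by (auto simp: v_def)
  qed (simp add: v_def)
  have vmono: "mono_on {..<length s1} v"
    using mono_onD[OF u(2)] len by (auto simp: v_def mono_on_def diff_le_mono)
  have "t ! j = composite C (Dom C (t ! j)) (fibre s1 v j)" if "j < length t" for j
    using fib[of "Suc j"] that by (simp add: fibs)
  then have "(s1, v, t) \<in> path_cells C B D"
    using vm vmono tch B(2) by (auto simp: path_cells_def)
  moreover have "(s, u, g # t) = path_hcomp (s1, v, t) (collapse C A s0)"
    using ueq g s by (simp add: collapse_def cong: if_cong)
  ultimately show thesis
    using that s B(1) g by blast
qed

text \<open>A map into the empty ordinal has empty domain.\<close>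

lemma path_cell_Nil:
  assumes "(s, u, []) \<in> path_cells C A B"
  shows "(s, u, []) = path_id [] \<and> A = B \<and> A \<in> Obj C"
proof -
  have "s = []"
  proof (cases s)
    case (Cons a l)
    then have "u 0 \<in> {..<0}" using assms PiE_mem[of u "{..<length s}" _ 0]
      by (fastforce simp: path_cells_def)
    then show ?thesis by simp
  qed simp
  then show ?thesis
    using assms by (auto simp: path_cells_def path_id_def PiE_iff extensional_def fun_eq_iff)
qed

text \<open>Induction on the target by \<open>path_cell_Cons_decomp\<close>. The starting object is
  a parameter of \<open>P\<close> because removing the first block moves it to the end of that
  block. Statements about arbitrary 2-cells are reduced to collapses in this way.\<close>

lemma path_cells_induct [consumes 1, case_names Nil hcomp]:
  assumes "w \<in> path_cells C A D"
    and "\<And>A. A \<in> Obj C \<Longrightarrow> P A A (path_id [])"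
    and "\<And>A B D w s. \<lbrakk>w \<in> path_cells C B D; P B D w; chain C A s B\<rbrakk>
      \<Longrightarrow> P A D (path_hcomp w (collapse C A s))"
  shows "P A D w"
proof -
  obtain s u t where w: "w = (s, u, t)" by (cases w)
  show ?thesis
    using assms(1) unfolding w
  proof (induction t arbitrary: A s u)
    case Nil
    then show ?case using path_cell_Nil[OF Nil] assms(2) by auto
  next
    case (Cons g t)
    then show ?case
      by (elim path_cell_Cons_decomp) (metis assms(3))
  qed
qed

text \<open>The blocks over \<open>t0\<close> form an initial segment of the source, so a 2-cell can
  be cut wherever its target is cut. The arrows of \<open>t0\<close> are peeled off one by
  one.\<close>

lemma path_cell_split:
  assumes "(s, u, t0 @ t1) \<in> path_cells C A D"
  shows "\<exists>B w z. w \<in> path_cells C B D \<and> z \<in> path_cells C A B \<and> snd (snd w) = t1 \<and> snd (snd z) = t0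
    \<and> (s, u, t0 @ t1) = path_hcomp w z"
  using assms
proof (induction t0 arbitrary: s u A)
  case Nil
  show ?case
  proof (intro exI conjI)
    show "(s, u, t1) \<in> path_cells C A D"
      using Nil by simp
    then show "(s, u, [] @ t1) = path_hcomp (s, u, t1) (path_id [])"
      by (simp only: path_hcomp_id_Nil append_Nil)
    show "path_id [] \<in> path_cells C A A"
      using Nil chain_objs[of A s D] by (intro path_id_mem) (simp add: path_cells_def)
  qed (simp_all add: path_id_def)
next
  case (Cons g t0)
  from Cons.prems have "(s, u, g # (t0 @ t1)) \<in> path_cells C A D" by simp
  then obtain B s0 s1 v where c: "s = s0 @ s1" "chain C A s0 B" "g = composite C A s0"
    "(s1, v, t0 @ t1) \<in> path_cells C B D"
    "(s, u, g # (t0 @ t1)) = path_hcomp (s1, v, t0 @ t1) (collapse C A s0)"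
    by (rule path_cell_Cons_decomp)
  from Cons.IH[OF c(4)] obtain E w z where wz: "w \<in> path_cells C E D" "z \<in> path_cells C B E"
    "snd (snd w) = t1" "snd (snd z) = t0" "(s1, v, t0 @ t1) = path_hcomp w z"
    by metis
  have "path_hcomp z (collapse C A s0) \<in> path_cells C A E"
    using path_hcomp_closed wz(2) collapse_closed[OF c(2)] by blast
  moreover have "snd (snd (path_hcomp z (collapse C A s0))) = g # t0"
    using wz(4) c(3) by (cases z) (simp add: collapse_def)
  moreover have "(s, u, (g # t0) @ t1) = path_hcomp w (path_hcomp z (collapse C A s0))"
    unfolding append_Cons c(5) wz(5) by (rule path_hcomp_assoc)
  ultimately show ?case
    using wz(1,3)
    by - (rule exI[of _ E], rule exI[of _ w], rule exI[of _ "path_hcomp z (collapse C A s0)"],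
      intro conjI; assumption)
qed

section \<open>Vertical composition of path 2-cells\<close>

lemma path_hvcomp:
  assumes "w \<in> path_cells C B D" "z \<in> path_cells C A B" "w' \<in> path_cells C B D" "z' \<in> path_cells C A B"
    "fst w' = snd (snd w)" "fst z' = snd (snd z)"
  shows "path_vcomp (path_hcomp w' z') (path_hcomp w z) = path_hcomp (path_vcomp w' w) (path_vcomp z' z)"
proof -
  obtain t v t' where w: "w = (t, v, t')" by (cases w)
  obtain s u s' where z: "z = (s, u, s')" by (cases z)
  obtain v' t'' where w': "w' = (t', v', t'')" using assms(5) w by (cases w') auto
  obtain u' s'' where z': "z' = (s', u', s'')" using assms(6) z by (cases z') auto
  have u: "u \<in> {..<length s} \<rightarrow>\<^sub>E {..<length s'}" and v: "v \<in> {..<length t} \<rightarrow>\<^sub>E {..<length t'}"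
    using assms by (auto simp: path_cells_def w z)
  show ?thesis
    unfolding w z w' z' path_hcomp.simps path_vcomp.simps prod.inject
  proof (intro conjI refl ext)
    fix i
    show "compose {..<length (s @ t)}
        (restrict (\<lambda>i. if i < length s' then u' i else length s'' + v' (i - length s'))
          {..<length s' + length t'})
        (restrict (\<lambda>i. if i < length s then u i else length s' + v (i - length s))
          {..<length s + length t}) i =
      restrict (\<lambda>i. if i < length s then compose {..<length s} u' u i
          else length s'' + compose {..<length t} v' v (i - length s)) {..<length s + length t} i"
      using PiE_mem[OF u, of i] PiE_mem[OF v, of "i - length s"]
      by (cases "i < length s"; cases "i < length s + length t") (auto simp: compose_def)
  qed
qed

text \<open>Replacing consecutive blocks of arrows by their composites does not change the overall
  composite. Hence the target of a collapse is still right after precomposition, as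
  \<open>collapse_vcomp\<close> needs.\<close>

lemma composite_path_cell:
  assumes "w \<in> path_cells C A B"
  shows "composite C A (snd (snd w)) = composite C A (fst w)"
  using assms
proof (induction rule: path_cells_induct)
  case (hcomp A B D w s)
  obtain t v t' where w: "w = (t, v, t')" by (cases w)
  have "chain C B t D" "chain C B t' D" using hcomp.hyps(1) by (auto simp: path_cells_def w)
  then have "composite C A (s @ t) = composite C B t \<cdot> composite C A s"
    using composite_append hcomp.hyps(2) by blast
  moreover have "Cod C (composite C A s) = B"
    using composite_closed[OF hcomp.hyps(2)] by (simp add: in_Hom_iff)
  moreover have "composite C B t' = composite C B t"
    using hcomp.IH by (simp add: w)
  ultimately show ?case
    by (simp add: collapse_def w)
qed (simp add: path_id_def)

text \<open>There is only one map to the one-element ordinal, and the composites agree. This is the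
  combinatorial source of associativity: multiplying in two stages is multiplying at once.\<close>

lemma collapse_vcomp:
  assumes "z \<in> path_cells C A B"
  shows "path_vcomp (collapse C A (snd (snd z))) z = collapse C A (fst z)"
proof -
  obtain s u s' where z: "z = (s, u, s')" by (cases z)
  have u: "u \<in> {..<length s} \<rightarrow>\<^sub>E {..<length s'}"
    using assms by (auto simp: path_cells_def z)
  show ?thesis
    using composite_path_cell[OF assms] PiE_mem[OF u]
    by (auto simp: z collapse_def compose_def restrict_def fun_eq_iff)
qed

lemma path_vcomp_id:
  assumes "w \<in> path_cells C A B"
  shows "path_vcomp w (path_id (fst w)) = w" "path_vcomp (path_id (snd (snd w))) w = w"
proof -
  obtain s u s' where w: "w = (s, u, s')" by (cases w)
  have u: "u \<in> {..<length s} \<rightarrow>\<^sub>E {..<length s'}"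
    using assms by (auto simp: path_cells_def w)
  show "path_vcomp w (path_id (fst w)) = w" "path_vcomp (path_id (snd (snd w))) w = w"
    using compose_Id[of u "{..<length s}" "{..<length s'}"] Id_compose[of u "{..<length s}" "{..<length s'}"] u
    by (simp_all add: w path_id_def PiE_def)
qed

text \<open>Splitting \<open>w\<close> along its target \<open>t @ fst z\<close> lets
  \<open>path_hvcomp\<close> compose both layers blockwise; the first block becomes a single
  collapse by \<open>collapse_vcomp\<close>. This is the induction step for statements about
  vertical composites.\<close>

lemma path_vcomp_hcomp_collapse:
  assumes z: "z \<in> path_cells C B D" and t: "chain C A t B"
    and w: "w \<in> path_cells C A D" "snd (snd w) = t @ fst z"
  obtains x y where "x \<in> path_cells C B D" "y \<in> path_cells C A B" "snd (snd x) = fst z"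
    "snd (snd y) = t" "w = path_hcomp x y"
    "path_vcomp (path_hcomp z (collapse C A t)) w = path_hcomp (path_vcomp z x) (collapse C A (fst y))"
proof -
  obtain B' x y where xy: "x \<in> path_cells C B' D" "y \<in> path_cells C A B'" "snd (snd x) = fst z"
     "snd (snd y) = t" "w = path_hcomp x y"
    using path_cell_split[of "fst w" "fst (snd w)" t "fst z" A D] w by (metis prod.collapse)
  have "chain C A t B'" using xy(2,4) by (auto simp: path_cells_def)
  then have [simp]: "B' = B" using chain_unique t by blast
  have y: "path_vcomp (collapse C A t) y = collapse C A (fst y)"
    using collapse_vcomp[OF xy(2)] xy(4) by simp
  have "path_vcomp (path_hcomp z (collapse C A t)) w = path_hcomp (path_vcomp z x) (collapse C A (fst y))"
    unfolding xy(5) y[symmetric]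
    using xy(1-4) z collapse_closed[OF t] by (intro path_hvcomp) (simp_all add: collapse_def)
  then show thesis using that xy by simp
qed

text \<open>The fibre condition is awkward to check for a composite map. Induction over the later
  2-cell \<open>z\<close> avoids it, as each step is again an ordinal sum with a collapse.\<close>

lemma path_vcomp_closed:
  assumes "w \<in> path_cells C A B" "z \<in> path_cells C A B" "snd (snd w) = fst z"
  shows "path_vcomp z w \<in> path_cells C A B"
  using assms(2,1,3)
proof (induction arbitrary: w rule: path_cells_induct)
  case (Nil A)
  then show ?case using path_vcomp_id(2)[OF Nil(2)] by (simp add: path_id_def)
next
  case (hcomp A B D z t)
  have "snd (snd w) = t @ fst z"
    using hcomp.prems(2) by (cases z) (simp add: collapse_def)
  then obtain x y where xy: "x \<in> path_cells C B D" "y \<in> path_cells C A B" "snd (snd x) = fst z"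
    "path_vcomp (path_hcomp z (collapse C A t)) w = path_hcomp (path_vcomp z x) (collapse C A (fst y))"
    using path_vcomp_hcomp_collapse[OF hcomp.hyps hcomp.prems(1)] by metis
  have "chain C A (fst y) B" using xy(2) by (auto simp: path_cells_def)
  then show ?case
    unfolding xy(4) using hcomp.IH[OF xy(1,3)] collapse_closed path_hcomp_closed by blast
qed

lemma path_vcomp_assoc:
  assumes "w \<in> path_cells C A B" "z \<in> path_cells C A B" "snd (snd w) = fst z" "snd (snd z) = fst y"
  shows "path_vcomp (path_vcomp y z) w = path_vcomp y (path_vcomp z w)"
proof -
  obtain s u t where w: "w = (s, u, t)" by (cases w)
  have u: "u \<in> {..<length s} \<rightarrow>\<^sub>E {..<length t}"
    using assms by (auto simp: path_cells_def w)
  show ?thesis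
    using PiE_mem[OF u] assms(3,4)
    by (cases z; cases y) (auto simp: w compose_def restrict_def fun_eq_iff)
qed

section \<open>The axioms of a bicategory for paths\<close>

lemma path_hom_simps:
  "Obj (path_hom C A B) = {s. chain C A s B}" "Arr (path_hom C A B) = path_cells C A B"
  "Dom (path_hom C A B) = fst" "Cod (path_hom C A B) = (\<lambda>w. snd (snd w))"
  "Ide (path_hom C A B) = path_id" "Comp (path_hom C A B) = path_vcomp"
  by (simp_all add: path_hom_def)

lemma in_Hom_path_hom:
  "w \<in> Hom (path_hom C A B) s t \<longleftrightarrow> w \<in> path_cells C A B \<and> fst w = s \<and> snd (snd w) = t"
  by (simp add: path_hom_simps Hom_def)

lemma path_cell_chains: "w \<in> path_cells C A B \<Longrightarrow> chain C A (fst w) B \<and> chain C A (snd (snd w)) B"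
  by (auto simp: path_cells_def)

lemma path_hom_category: "category (path_hom C A B)"
proof -
  have vc: "fst (path_vcomp z w) = fst w" "snd (snd (path_vcomp z w)) = snd (snd z)" for z w :: "'b path_cell"
    by (cases z; cases w; simp)+
  show ?thesis
    by unfold_locales
      (auto simp: path_hom_simps in_Hom_path_hom vc path_vcomp_closed path_vcomp_id path_vcomp_assoc
        path_id_mem path_cell_chains, auto simp: path_id_def)
qed

lemma path_id_Isos:
  assumes "chain C A s B"
  shows "path_id s \<in> Isos (path_hom C A B)"
proof -
  interpret H: category "path_hom C A B" by (rule path_hom_category)
  show ?thesis
    using assms H.Isos_ide[of s] by (simp add: path_hom_simps)
qed

text \<open>Concatenation is strictly associative and unital, so the constraints are identities and
  the content lies in closure and interchange.\<close>

lemma bicategory_path_bicat: "bicategory (path_bicat C)"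
proof -
  have hc: "fst (path_hcomp z w) = fst w @ fst z"
    "snd (snd (path_hcomp z w)) = snd (snd w) @ snd (snd z)" for z w :: "'b path_cell"
    by (cases z; cases w; simp)+
  have vc: "path_vcomp (path_id t) w = w" "path_vcomp w (path_id s) = w"
    if "w \<in> path_cells C A B" "fst w = s" "snd (snd w) = t" for w s t A B
    using path_vcomp_id[OF that(1)] that by auto
  have pid: "fst (path_id s) = s" "snd (snd (path_id s)) = s" for s :: "'b list"
    by (simp_all add: path_id_def)
  have vid: "path_vcomp (path_id s) (path_id s) = path_id s" for s :: "'b list"
    by (auto simp: path_id_def compose_def restrict_def)
  \<comment> \<open>Naturality of the associator: strictness leaves one 2-cell, composed with an
    identity on either side.\<close>
  have vc3: "path_vcomp (path_id t) (path_hcomp w (path_hcomp v u))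
      = path_vcomp (path_hcomp w (path_hcomp v u)) (path_id s)"
    if "w \<in> path_cells C D E" "v \<in> path_cells C B D" "u \<in> path_cells C A B"
      "s = fst u @ fst v @ fst w" "t = snd (snd u) @ snd (snd v) @ snd (snd w)" for w v u s t A B D E
    using vc[OF path_hcomp_closed[OF that(1) path_hcomp_closed[OF that(2,3)]], of s t] that(4,5)
    by (simp add: hc)
  show ?thesis
    by (rule bicategory.intro; simp only: path_bicat_def bicat.simps path_hom_simps mem_Collect_eq
        in_Hom_path_hom Int_iff)
      (auto simp: path_hom_category path_hcomp_assoc path_hcomp_id chain_append in_Hom_path_hom
        path_id_Isos hc pid path_id_mem path_hvcomp path_hcomp_id_Nil vc vc3 vid
        simp del: path_hcomp.simps path_vcomp.simps split_paired_all
        intro: path_hcomp_closed chain_append)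
qed

end

section \<open>Unit coherence in monoidal categories\<close>

sublocale monoidal_category \<subseteq> U: category "mcat M"
  by (rule underlying)

context monoidal_category
begin

lemma tarr_simps:
  assumes "g \<in> Arr (mcat M)" "f \<in> Arr (mcat M)"
  shows "g \<otimes>\<^sub>a f \<in> Arr (mcat M)"
    "Dom (mcat M) (g \<otimes>\<^sub>a f) = Dom (mcat M) g \<otimes>\<^sub>o Dom (mcat M) f"
    "Cod (mcat M) (g \<otimes>\<^sub>a f) = Cod (mcat M) g \<otimes>\<^sub>o Cod (mcat M) f"
  using tarr_closed[OF U.arr_in_Hom[OF assms(1)] U.arr_in_Hom[OF assms(2)]]
  by (auto simp: U.in_Hom_iff)

lemma interchange:
  assumes "g \<in> Arr (mcat M)" "f \<in> Arr (mcat M)" "g' \<in> Arr (mcat M)" "f' \<in> Arr (mcat M)"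
    "Cod (mcat M) g = Dom (mcat M) g'" "Cod (mcat M) f = Dom (mcat M) f'"
  shows "(g' \<otimes>\<^sub>a f') \<odot> (g \<otimes>\<^sub>a f) = (g' \<odot> g) \<otimes>\<^sub>a (f' \<odot> f)"
  using assms by (intro tarr_comp[symmetric]) (auto simp: U.in_Hom_iff)

lemma interchange_assoc:
  assumes "g \<in> Arr (mcat M)" "f \<in> Arr (mcat M)" "g' \<in> Arr (mcat M)" "f' \<in> Arr (mcat M)"
    "Cod (mcat M) g = Dom (mcat M) g'" "Cod (mcat M) f = Dom (mcat M) f'"
    "h \<in> Arr (mcat M)" "Cod (mcat M) h = Dom (mcat M) g \<otimes>\<^sub>o Dom (mcat M) f"
  shows "(g' \<otimes>\<^sub>a f') \<odot> ((g \<otimes>\<^sub>a f) \<odot> h) = ((g' \<odot> g) \<otimes>\<^sub>a (f' \<odot> f)) \<odot> h"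
  using assms by (simp add: interchange tarr_simps flip: U.comp_assoc_arr)

lemma massoc_simps:
  assumes "a \<in> Obj (mcat M)" "b \<in> Obj (mcat M)" "c \<in> Obj (mcat M)"
  shows "\<alpha> a b c \<in> Isos (mcat M)" "\<alpha> a b c \<in> Arr (mcat M)"
    "Dom (mcat M) (\<alpha> a b c) = (a \<otimes>\<^sub>o b) \<otimes>\<^sub>o c" "Cod (mcat M) (\<alpha> a b c) = a \<otimes>\<^sub>o (b \<otimes>\<^sub>o c)"
  using massoc_closed[OF assms] by (auto simp: U.in_Hom_iff)

lemma mlunit_simps:
  assumes "a \<in> Obj (mcat M)"
  shows "\<ll> a \<in> Isos (mcat M)" "\<ll> a \<in> Arr (mcat M)"
    "Dom (mcat M) (\<ll> a) = \<I> \<otimes>\<^sub>o a" "Cod (mcat M) (\<ll> a) = a"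
  using mlunit_closed[OF assms] by (auto simp: U.in_Hom_iff)

lemma mrunit_simps:
  assumes "a \<in> Obj (mcat M)"
  shows "\<rr> a \<in> Isos (mcat M)" "\<rr> a \<in> Arr (mcat M)"
    "Dom (mcat M) (\<rr> a) = a \<otimes>\<^sub>o \<I>" "Cod (mcat M) (\<rr> a) = a"
  using mrunit_closed[OF assms] by (auto simp: U.in_Hom_iff)

lemmas mon_simps = U.cat_simps tarr_simps interchange interchange_assoc tarr_ide tobj_closed munit_closed
  massoc_simps mlunit_simps mrunit_simps

lemma massoc_nat:
  assumes "f \<in> Arr (mcat M)" "g \<in> Arr (mcat M)" "h \<in> Arr (mcat M)"
    "Cod (mcat M) f = a" "Cod (mcat M) g = b" "Cod (mcat M) h = c"
  shows "\<alpha> a b c \<odot> ((f \<otimes>\<^sub>a g) \<otimes>\<^sub>a h)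
    = (f \<otimes>\<^sub>a (g \<otimes>\<^sub>a h)) \<odot> \<alpha> (Dom (mcat M) f) (Dom (mcat M) g) (Dom (mcat M) h)"
  using assms by (intro massoc_natural) (auto simp: U.in_Hom_iff)

lemma mlunit_nat:
  assumes "f \<in> Arr (mcat M)" "Cod (mcat M) f = a"
  shows "\<ll> a \<odot> (\<one> \<I> \<otimes>\<^sub>a f) = f \<odot> \<ll> (Dom (mcat M) f)"
  using assms by (intro mlunit_natural) (auto simp: U.in_Hom_iff)

lemma mrunit_nat:
  assumes "f \<in> Arr (mcat M)" "Cod (mcat M) f = a"
  shows "\<rr> a \<odot> (f \<otimes>\<^sub>a \<one> \<I>) = f \<odot> \<rr> (Dom (mcat M) f)"
  using assms by (intro mrunit_natural) (auto simp: U.in_Hom_iff)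

lemma tarr_Isos:
  assumes "g \<in> Isos (mcat M)" "f \<in> Isos (mcat M)"
  shows "g \<otimes>\<^sub>a f \<in> Isos (mcat M)"
  by (rule U.IsosI[of _ "Dom (mcat M) g \<otimes>\<^sub>o Dom (mcat M) f" "Cod (mcat M) g \<otimes>\<^sub>o Cod (mcat M) f"
        "cinv (mcat M) g \<otimes>\<^sub>a cinv (mcat M) f"])
    (use assms in \<open>simp_all add: U.in_Hom_iff mon_simps U.cinv_simps U.Isos_arr\<close>)

text \<open>Naturality of \<ll> turns the hypothesis into an equation between \<open>f\<close> and
  \<open>g\<close> precomposed with \<ll>, which is invertible.\<close>

lemma unit_tensor_cancel:
  assumes "f \<in> Arr (mcat M)" "g \<in> Arr (mcat M)" "Dom (mcat M) f = Dom (mcat M) g"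
    "Cod (mcat M) f = Cod (mcat M) g" "\<one> \<I> \<otimes>\<^sub>a f = \<one> \<I> \<otimes>\<^sub>a g"
  shows "f = g"
  by (rule U.iso_cancel_right[of "\<ll> (Dom (mcat M) f)"])
    (use assms mlunit_nat[of f] mlunit_nat[of g] in \<open>simp_all add: mon_simps\<close>)

lemma tensor_unit_cancel:
  assumes "f \<in> Arr (mcat M)" "g \<in> Arr (mcat M)" "Dom (mcat M) f = Dom (mcat M) g"
    "Cod (mcat M) f = Cod (mcat M) g" "f \<otimes>\<^sub>a \<one> \<I> = g \<otimes>\<^sub>a \<one> \<I>"
  shows "f = g"
  by (rule U.iso_cancel_right[of "\<rr> (Dom (mcat M) f)"])
    (use assms mrunit_nat[of f] mrunit_nat[of g] in \<open>simp_all add: mon_simps\<close>)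

text \<open>Kelly's unit coherences, which are not among the axioms, follow from the pentagon and the
  triangle because tensoring with the unit is faithful.\<close>

lemma mlunit_tensor:
  assumes [simp]: "a \<in> Obj (mcat M)" "b \<in> Obj (mcat M)"
  shows "\<ll> (a \<otimes>\<^sub>o b) \<odot> \<alpha> \<I> a b = \<ll> a \<otimes>\<^sub>a \<one> b"
proof (rule unit_tensor_cancel)
  \<comment> \<open>Two consecutive arrows of the pentagon for \<I>, \<I>, \<open>a\<close>,
    \<open>b\<close>. They are invertible, so both sides may be compared after precomposition with
    them.\<close>
  let ?k = "\<alpha> \<I> (\<I> \<otimes>\<^sub>o a) b \<odot> (\<alpha> \<I> \<I> a \<otimes>\<^sub>a \<one> b)"
  have "(\<one> \<I> \<otimes>\<^sub>a (\<ll> (a \<otimes>\<^sub>o b) \<odot> \<alpha> \<I> a b)) \<odot> ?k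
      = (\<one> \<I> \<otimes>\<^sub>a \<ll> (a \<otimes>\<^sub>o b)) \<odot> ((\<one> \<I> \<otimes>\<^sub>a \<alpha> \<I> a b) \<odot> \<alpha> \<I> (\<I> \<otimes>\<^sub>o a) b \<odot> (\<alpha> \<I> \<I> a \<otimes>\<^sub>a \<one> b))"
    by (simp add: mon_simps)
  also have "\<dots> = ((\<one> \<I> \<otimes>\<^sub>a \<ll> (a \<otimes>\<^sub>o b)) \<odot> \<alpha> \<I> \<I> (a \<otimes>\<^sub>o b)) \<odot> \<alpha> (\<I> \<otimes>\<^sub>o \<I>) a b"
    by (subst mpentagon[symmetric]) (simp_all add: mon_simps)
  also have "\<dots> = (\<rr> \<I> \<otimes>\<^sub>a (\<one> a \<otimes>\<^sub>a \<one> b)) \<odot> \<alpha> (\<I> \<otimes>\<^sub>o \<I>) a b"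
    by (simp add: mtriangle tarr_ide mon_simps)
  also have "\<dots> = \<alpha> \<I> a b \<odot> ((\<rr> \<I> \<otimes>\<^sub>a \<one> a) \<otimes>\<^sub>a \<one> b)"
    using massoc_nat[of "\<rr> \<I>" "\<one> a" "\<one> b" \<I> a b] by (simp add: mon_simps)
  also have "\<dots> = \<alpha> \<I> a b \<odot> ((\<one> \<I> \<otimes>\<^sub>a \<ll> a) \<otimes>\<^sub>a \<one> b) \<odot> (\<alpha> \<I> \<I> a \<otimes>\<^sub>a \<one> b)"
    by (subst mtriangle[symmetric]) (simp_all add: mon_simps)
  also have "\<dots> = (\<one> \<I> \<otimes>\<^sub>a (\<ll> a \<otimes>\<^sub>a \<one> b)) \<odot> ?k"
    using massoc_nat[of "\<one> \<I>" "\<ll> a" "\<one> b" \<I> a b] by (simp add: mon_simps del: interchange interchange_assoc)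
  finally show "\<one> \<I> \<otimes>\<^sub>a (\<ll> (a \<otimes>\<^sub>o b) \<odot> \<alpha> \<I> a b) = \<one> \<I> \<otimes>\<^sub>a (\<ll> a \<otimes>\<^sub>a \<one> b)"
    by (rule U.iso_cancel_right[rotated 5])
      (auto simp: mon_simps intro!: U.Isos_comp tarr_Isos U.Isos_ide)
qed (simp_all add: mon_simps)

lemma mrunit_tensor:
  assumes [simp]: "a \<in> Obj (mcat M)" "b \<in> Obj (mcat M)"
  shows "(\<one> a \<otimes>\<^sub>a \<rr> b) \<odot> \<alpha> a b \<I> = \<rr> (a \<otimes>\<^sub>o b)"
proof (rule tensor_unit_cancel)
  \<comment> \<open>Composing with \<open>\<alpha> a b \<I>\<close> exposes naturality squares of
    \<alpha> at both ends of the calculation; between them stands the pentagon for \<open>a\<close>,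
    \<open>b\<close>, \<I>, \<I>.\<close>
  have "\<alpha> a b \<I> \<odot> (\<rr> (a \<otimes>\<^sub>o b) \<otimes>\<^sub>a \<one> \<I>)
      = \<alpha> a b \<I> \<odot> ((\<one> a \<otimes>\<^sub>a \<one> b) \<otimes>\<^sub>a \<ll> \<I>) \<odot> \<alpha> (a \<otimes>\<^sub>o b) \<I> \<I>"
    by (subst mtriangle[symmetric]) (simp_all add: mon_simps)
  also have "\<dots> = (\<one> a \<otimes>\<^sub>a (\<one> b \<otimes>\<^sub>a \<ll> \<I>)) \<odot> (\<alpha> a b (\<I> \<otimes>\<^sub>o \<I>) \<odot> \<alpha> (a \<otimes>\<^sub>o b) \<I> \<I>)"
    by (subst massoc_nat) (simp_all add: mon_simps)
  also have "\<dots> = (\<one> a \<otimes>\<^sub>a ((\<one> b \<otimes>\<^sub>a \<ll> \<I>) \<odot> \<alpha> b \<I> \<I>)) \<odot> \<alpha> a (b \<otimes>\<^sub>o \<I>) \<I> \<odot> (\<alpha> a b \<I> \<otimes>\<^sub>a \<one> \<I>)"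
    by (subst mpentagon) (simp_all add: mon_simps)
  also have "\<dots> = (\<one> a \<otimes>\<^sub>a (\<rr> b \<otimes>\<^sub>a \<one> \<I>)) \<odot> \<alpha> a (b \<otimes>\<^sub>o \<I>) \<I> \<odot> (\<alpha> a b \<I> \<otimes>\<^sub>a \<one> \<I>)"
    by (simp add: mtriangle munit_closed)
  also have "\<dots> = \<alpha> a b \<I> \<odot> ((\<one> a \<otimes>\<^sub>a \<rr> b) \<otimes>\<^sub>a \<one> \<I>) \<odot> (\<alpha> a b \<I> \<otimes>\<^sub>a \<one> \<I>)"
    by (subst massoc_nat) (simp_all add: mon_simps)
  also have "\<dots> = \<alpha> a b \<I> \<odot> (((\<one> a \<otimes>\<^sub>a \<rr> b) \<odot> \<alpha> a b \<I>) \<otimes>\<^sub>a \<one> \<I>)"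
    by (simp add: mon_simps)
  finally have eq: "\<alpha> a b \<I> \<odot> (\<rr> (a \<otimes>\<^sub>o b) \<otimes>\<^sub>a \<one> \<I>)
      = \<alpha> a b \<I> \<odot> (((\<one> a \<otimes>\<^sub>a \<rr> b) \<odot> \<alpha> a b \<I>) \<otimes>\<^sub>a \<one> \<I>)" .
  show "((\<one> a \<otimes>\<^sub>a \<rr> b) \<odot> \<alpha> a b \<I>) \<otimes>\<^sub>a \<one> \<I> = \<rr> (a \<otimes>\<^sub>o b) \<otimes>\<^sub>a \<one> \<I>"
    by (rule U.iso_cancel_left[OF _ _ _ _ _ eq[symmetric]]) (simp_all add: mon_simps)
qed (simp_all add: mon_simps)

text \<open>Once \<open>\<one> \<I> \<otimes>\<^sub>a \<ll> \<I>\<close> is known to be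
  \<open>\<ll> (\<I> \<otimes>\<^sub>o \<I>)\<close>, \<open>mlunit_tensor\<close> and the triangle
  at \<I> have the same left-hand side. The equation reconciles the two unit constraints on the
  empty path in \<open>path_assoc_counit_left\<close>.\<close>

lemma mlunit_munit: "\<ll> \<I> = \<rr> \<I>"
proof (rule tensor_unit_cancel)
  \<comment> \<open>Naturality of \<ll> at the arrow \<open>\<ll> \<I>\<close> itself, which is then
    cancelled.\<close>
  have eq: "\<ll> \<I> \<odot> (\<one> \<I> \<otimes>\<^sub>a \<ll> \<I>) = \<ll> \<I> \<odot> \<ll> (\<I> \<otimes>\<^sub>o \<I>)"
    by (subst mlunit_nat) (simp_all add: mon_simps)
  have "\<one> \<I> \<otimes>\<^sub>a \<ll> \<I> = \<ll> (\<I> \<otimes>\<^sub>o \<I>)"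
    by (rule U.iso_cancel_left[OF _ _ _ _ _ eq]) (simp_all add: mon_simps)
  then show "\<ll> \<I> \<otimes>\<^sub>a \<one> \<I> = \<rr> \<I> \<otimes>\<^sub>a \<one> \<I>"
    using mlunit_tensor[of \<I> \<I>] mtriangle[of \<I> \<I>] by (simp add: munit_closed)
qed (simp_all add: mon_simps)

end

section \<open>Points of a coarse category and their enriched categories\<close>

lemma deloop_simps:
  "Cells0 (deloop M) = {()}" "Hc (deloop M) a b = mcat M" "hobj (deloop M) a b c = tobj M"
  "harr (deloop M) a b c = tarr M" "hunit (deloop M) a = munit M" "assoc (deloop M) a b c d = massoc M"
  "lunit (deloop M) a b = mlunit M" "runit (deloop M) a b = mrunit M"
  by (simp_all add: deloop_def)

lemma path_bicat_simps:
  "Cells0 (path_bicat C) = Obj C" "Hc (path_bicat C) A B = path_hom C A B"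
  "hobj (path_bicat C) A B D t s = s @ t" "harr (path_bicat C) A B D = path_hcomp"
  "hunit (path_bicat C) A = []" "assoc (path_bicat C) A B D E h g f = path_id (f @ g @ h)"
  "lunit (path_bicat C) A B = path_id" "runit (path_bicat C) A B = path_id"
  by (simp_all add: path_bicat_def)

lemma coarse_simps [simp]:
  "Obj (coarse X) = X" "Arr (coarse X) = X \<times> X" "Dom (coarse X) = fst" "Cod (coarse X) = snd"
  by (simp_all add: coarse_def)

interpretation coarse: category "coarse X" for X
  by (rule category_coarse)

abbreviation "cells X \<equiv> path_cells (coarse X)"
abbreviation "chn X \<equiv> chain (coarse X)"
abbreviation "col X \<equiv> collapse (coarse X)"
abbreviation "fo F A B \<equiv> omap (chom F A B)"
abbreviation "fa F A B \<equiv> amap (chom F A B)"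


lemma chn_objs: "chn X A s B \<Longrightarrow> A \<in> X \<and> B \<in> X"
  using coarse.chain_objs by (fastforce simp: coarse_simps)

lemma cell_objs: "w \<in> cells X A B \<Longrightarrow> A \<in> X \<and> B \<in> X"
  by (rule chn_objs[OF conjunct1[OF coarse.path_cell_chains]])

text \<open>In a coarse category the composite of a path depends on its ends only, so the target of
  a collapse can be named without computing it.\<close>

lemma collapse_coarse:
  assumes "chn X A s B"
  shows "collapse (coarse X) A s = (s, restrict (\<lambda>_. 0) {..<length s}, [(A, B)])"
  using coarse.composite_closed[OF assms]
  by (cases "composite (coarse X) A s") (simp add: collapse_def Hom_def coarse_simps)

lemma fst_col: "fst (col X A s) = s"
  by (simp add: collapse_def)

lemma snd_col: "chn X A s B \<Longrightarrow> snd (snd (col X A s)) = [(A, B)]"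
  by (simp add: collapse_coarse)

lemma path_hcomp_ends:
  "fst (path_hcomp w z) = fst z @ fst w" "snd (snd (path_hcomp w z)) = snd (snd z) @ snd (snd w)"
  by (cases w; cases z; simp)+

lemma path_id_ends: "fst (path_id s) = s" "snd (snd (path_id s)) = s"
  by (simp_all add: path_id_def)

text \<open>A point with the bicategorical packaging removed. The constraints of paths are
  identities, whose images drop out of the coherence laws, and membership of the structure 2-cells
  in the class becomes invertibility.\<close>

locale coarse_point = monoidal_category M
  for M :: "('o, 'a) moncat" (structure) and X :: "'x set"
    and F :: "('x, ('x \<times> 'x) list, ('x \<times> 'x) path_cell, unit, 'o, 'a) colax" +
  assumes chom_func: "\<lbrakk>A \<in> X; B \<in> X\<rbrakk> \<Longrightarrow> cat_functor (path_hom (coarse X) A B) (mcat M) (chom F A B)"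
    and ccomp_iso: "\<lbrakk>chn X A s B; chn X B t D\<rbrakk> \<Longrightarrow> ccomp F A B D t s
      \<in> Isos (mcat M) \<inter> Hom (mcat M) (fo F A D (s @ t)) (fo F B D t \<otimes>\<^sub>o fo F A B s)"
    and ccomp_nat: "\<lbrakk>w \<in> cells X B D; z \<in> cells X A B\<rbrakk>
      \<Longrightarrow> ccomp F A B D (snd (snd w)) (snd (snd z)) \<odot> fa F A D (path_hcomp w z)
        = (fa F B D w \<otimes>\<^sub>a fa F A B z) \<odot> ccomp F A B D (fst w) (fst z)"
    and cunit_iso: "A \<in> X \<Longrightarrow> cunit F A \<in> Isos (mcat M) \<inter> Hom (mcat M) (fo F A A []) \<I>"
    and ccomp_coassoc: "\<lbrakk>chn X A f B; chn X B g D; chn X D h E\<rbrakk>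
      \<Longrightarrow> \<alpha> (fo F D E h) (fo F B D g) (fo F A B f)
            \<odot> ((ccomp F B D E h g \<otimes>\<^sub>a \<one> (fo F A B f)) \<odot> ccomp F A B E (g @ h) f)
          = (\<one> (fo F D E h) \<otimes>\<^sub>a ccomp F A B D g f) \<odot> ccomp F A D E h (f @ g)"
    and ccomp_counit_left: "chn X A f B
      \<Longrightarrow> \<ll> (fo F A B f) \<odot> ((cunit F B \<otimes>\<^sub>a \<one> (fo F A B f)) \<odot> ccomp F A B B [] f) = \<one> (fo F A B f)"
    and ccomp_counit_right: "chn X A f B
      \<Longrightarrow> \<rr> (fo F A B f) \<odot> ((\<one> (fo F A B f) \<otimes>\<^sub>a cunit F A) \<odot> ccomp F A A B f []) = \<one> (fo F A B f)"
    and cobj_extensional: "cobj F \<in> extensional X"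
    and chom_undefined: "\<not> (A \<in> X \<and> B \<in> X) \<Longrightarrow> chom F A B = undefined"
    and ccomp_undefined: "\<not> (chn X A s B \<and> chn X B t D) \<Longrightarrow> ccomp F A B D t s = undefined"
    and cunit_extensional: "cunit F \<in> extensional X"
begin

lemma fo_closed: "chn X A s B \<Longrightarrow> fo F A B s \<in> Obj (mcat M)"
  using chn_objs[of X A s B] cat_functor.omap_closed[OF chom_func, of A B s]
  by (simp add: coarse.path_hom_simps)

lemma fa_simps:
  assumes "w \<in> cells X A B"
  shows "fa F A B w \<in> Arr (mcat M)" "Dom (mcat M) (fa F A B w) = fo F A B (fst w)"
    "Cod (mcat M) (fa F A B w) = fo F A B (snd (snd w))"
  using cat_functor.amap_closed[OF chom_func, of A B w "fst w" "snd (snd w)"] assms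
    cell_objs[OF assms]
  by (auto simp: coarse.in_Hom_path_hom U.in_Hom_iff)

lemma fa_id: "chn X A s B \<Longrightarrow> fa F A B (path_id s) = \<one> (fo F A B s)"
  using chn_objs[of X A s B] cat_functor.amap_ide[OF chom_func, of A B s]
  by (simp add: coarse.path_hom_simps)

lemma fa_comp:
  assumes "w \<in> cells X A B" "z \<in> cells X A B" "snd (snd w) = fst z"
  shows "fa F A B (path_vcomp z w) = fa F A B z \<odot> fa F A B w"
  using cat_functor.amap_comp[OF chom_func, of A B w "fst w" "fst z" z "snd (snd z)"] assms
    cell_objs[OF assms(1)]
  by (auto simp: coarse.in_Hom_path_hom coarse.path_hom_simps)

lemma ccomp_simps:
  assumes "chn X A s B" "chn X B t D"
  shows "ccomp F A B D t s \<in> Isos (mcat M)" "ccomp F A B D t s \<in> Arr (mcat M)"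
    "Dom (mcat M) (ccomp F A B D t s) = fo F A D (s @ t)"
    "Cod (mcat M) (ccomp F A B D t s) = fo F B D t \<otimes>\<^sub>o fo F A B s"
  using ccomp_iso[OF assms] by (auto simp: U.in_Hom_iff)

lemma cunit_simps:
  assumes "A \<in> X"
  shows "cunit F A \<in> Isos (mcat M)" "cunit F A \<in> Arr (mcat M)"
    "Dom (mcat M) (cunit F A) = fo F A A []" "Cod (mcat M) (cunit F A) = \<I>"
  using cunit_iso[OF assms] by (auto simp: U.in_Hom_iff)

lemmas point_simps = fo_closed fa_simps fa_id ccomp_simps cunit_simps

end

lemma (in monoidal_category) coarse_point_iff:
  "point (coarse X) (deloop M) (Iso_cells (deloop M)) F \<longleftrightarrow> coarse_point M X F"
proof
  assume "point (coarse X) (deloop M) (Iso_cells (deloop M)) F"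
  then interpret point "coarse X" "deloop M" "Iso_cells (deloop M)" F .
  have func: "cat_functor (path_hom (coarse X) A B) (mcat M) (chom F A B)" if "A \<in> X" "B \<in> X" for A B
    using chom_functor[of A B] that by (simp add: deloop_simps path_bicat_simps coarse_simps)
  have obj: "fo F A B s \<in> Obj (mcat M)" if "chn X A s B" for A B s
    using chn_objs[OF that] cat_functor.omap_closed[OF func, of A B s] that by (simp add: coarse.path_hom_simps)
  have fid: "fa F A B (path_id s) = \<one> (fo F A B s)" if "chn X A s B" for A B s
    using chn_objs[OF that] cat_functor.amap_ide[OF func, of A B s] that by (simp add: coarse.path_hom_simps)
  have comp_iso: "ccomp F A B D t s
      \<in> Isos (mcat M) \<inter> Hom (mcat M) (fo F A D (s @ t)) (fo F B D t \<otimes>\<^sub>o fo F A B s)"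
    if "chn X A s B" "chn X B t D" for A B D s t
    using that chn_objs[OF that(1)] chn_objs[OF that(2)] ccomp_closed[of A B D t s] ccomp_in_W[of A B D t s]
    by (simp add: deloop_simps path_bicat_simps coarse_simps coarse.path_hom_simps Iso_cells_def)
  have unit_iso: "cunit F A \<in> Isos (mcat M) \<inter> Hom (mcat M) (fo F A A []) \<I>" if "A \<in> X" for A
    using that cunit_closed[of A] cunit_in_W[of A]
    by (simp add: deloop_simps path_bicat_simps coarse_simps coarse.path_hom_simps Iso_cells_def)
  note arrs = comp_iso[unfolded U.in_Hom_iff Int_iff] unit_iso[unfolded U.in_Hom_iff Int_iff]
  show "coarse_point M X F"
  proof (intro coarse_point.intro coarse_point_axioms.intro monoidal_category_axioms func comp_iso unit_iso)
    fix A B D w z assume wz: "w \<in> cells X B D" "z \<in> cells X A B"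
    then show "ccomp F A B D (snd (snd w)) (snd (snd z)) \<odot> fa F A D (path_hcomp w z)
        = (fa F B D w \<otimes>\<^sub>a fa F A B z) \<odot> ccomp F A B D (fst w) (fst z)"
      using ccomp_natural[of A B D w "fst w" "snd (snd w)" z "fst z" "snd (snd z)"]
        cell_objs[OF wz(1)]
        cell_objs[OF wz(2)]
      by (simp add: deloop_simps path_bicat_simps coarse_simps coarse.in_Hom_path_hom)
  next
    fix A B D E f g h assume fgh: "chn X A f B" "chn X B g D" "chn X D h E"
    then have "chn X A (f @ g @ h) E" "chn X B (g @ h) E" "chn X A (f @ g) D"
      by (auto simp: coarse.chain_append_iff)
    then show "\<alpha> (fo F D E h) (fo F B D g) (fo F A B f)
            \<odot> ((ccomp F B D E h g \<otimes>\<^sub>a \<one> (fo F A B f)) \<odot> ccomp F A B E (g @ h) f)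
          = (\<one> (fo F D E h) \<otimes>\<^sub>a ccomp F A B D g f) \<odot> ccomp F A D E h (f @ g)"
      using ccomp_assoc[of A B D E h g f] fgh chn_objs[OF fgh(1)] chn_objs[OF fgh(2)] chn_objs[OF fgh(3)]
      by (simp add: deloop_simps path_bicat_simps coarse_simps coarse.path_hom_simps mon_simps obj fid arrs)
  next
    fix A B f assume f: "chn X A f B"
    then show "\<ll> (fo F A B f) \<odot> ((cunit F B \<otimes>\<^sub>a \<one> (fo F A B f)) \<odot> ccomp F A B B [] f) = \<one> (fo F A B f)"
      using ccomp_lunit[of A B f] chn_objs[OF f]
      by (simp add: deloop_simps path_bicat_simps coarse_simps coarse.path_hom_simps mon_simps obj fid arrs)
    show "\<rr> (fo F A B f) \<odot> ((\<one> (fo F A B f) \<otimes>\<^sub>a cunit F A) \<odot> ccomp F A A B f []) = \<one> (fo F A B f)"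
      using ccomp_runit[of A B f] chn_objs[OF f] f
      by (simp add: deloop_simps path_bicat_simps coarse_simps coarse.path_hom_simps mon_simps obj fid arrs)
  next
    fix A B D s t assume "\<not> (chn X A s B \<and> chn X B t D)"
    then show "ccomp F A B D t s = undefined"
      using ccomp_ext[of A B D t s] by (auto simp: path_bicat_simps coarse.path_hom_simps)
  qed (use cobj_ext chom_ext cunit_ext in \<open>simp_all add: path_bicat_simps coarse_simps\<close>)
next
  assume "coarse_point M X F"
  then interpret coarse_point M X F .
  interpret D: bicategory "deloop M"
    by (rule bicategory_deloop) (rule monoidal_category_axioms)
  have chn_app: "chn X A (s @ t) D" if "chn X A s B" "chn X B t D" for A B D s t
    using that by (rule coarse.chain_append)
  show "point (coarse X) (deloop M) (Iso_cells (deloop M)) F"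
  proof (intro point.intro category_coarse D.two_cell_class_Iso_cells colax_functor.intro
      coarse.bicategory_path_bicat D.bicategory_axioms point_axioms.intro colax_functor_axioms.intro;
      (unfold deloop_simps path_bicat_simps coarse_simps coarse.path_hom_simps coarse.in_Hom_path_hom
        Iso_cells_def mem_Collect_eq)?)
    fix A B D E h g f
    assume fgh: "chn X D h E" "chn X B g D" "chn X A f B"
    have fgh': "chn X A (f @ g @ h) E" "chn X B (g @ h) E" "chn X A (f @ g) D"
      using fgh by (auto simp: coarse.chain_append_iff)
    show "\<alpha> (fo F D E h) (fo F B D g) (fo F A B f) \<odot> (ccomp F B D E h g \<otimes>\<^sub>a \<one> (fo F A B f))
          \<odot> ccomp F A B E (g @ h) f
        = (\<one> (fo F D E h) \<otimes>\<^sub>a ccomp F A B D g f) \<odot> ccomp F A D E h (f @ g)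
          \<odot> fa F A E (path_id (f @ g @ h))"
      using ccomp_coassoc[OF fgh(3,2,1)] fgh fgh' by (simp add: mon_simps point_simps)
  next
    fix A B f assume f: "chn X A f B"
    note AB = chn_objs[OF f]
    show "\<ll> (fo F A B f) \<odot> (cunit F B \<otimes>\<^sub>a \<one> (fo F A B f)) \<odot> ccomp F A B B [] f = fa F A B (path_id f)"
      using ccomp_counit_left[OF f] f AB by (simp add: mon_simps point_simps coarse_simps)
    show "\<rr> (fo F A B f) \<odot> (\<one> (fo F A B f) \<otimes>\<^sub>a cunit F A) \<odot> ccomp F A A B f [] = fa F A B (path_id f)"
      using ccomp_counit_right[OF f] f AB by (simp add: mon_simps point_simps coarse_simps)
  next
    fix A B D w t t' z s s'
    assume "w \<in> cells X B D \<and> fst w = t \<and> snd (snd w) = t'" "z \<in> cells X A B \<and> fst z = s \<and> snd (snd z) = s'"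
    then show "ccomp F A B D t' s' \<odot> fa F A D (path_hcomp w z) = (fa F B D w \<otimes>\<^sub>a fa F A B z) \<odot> ccomp F A B D t s"
      using ccomp_nat by blast
  next
    fix A B D t s assume "\<not> (A \<in> X \<and> B \<in> X \<and> D \<in> X \<and> chn X B t D \<and> chn X A s B)"
    then have "\<not> (chn X A s B \<and> chn X B t D)" using chn_objs[of X A s B] chn_objs[of X B t D] by auto
    then show "ccomp F A B D t s = undefined" by (rule ccomp_undefined)
  qed (use chom_func ccomp_iso cunit_iso cobj_extensional chom_undefined cunit_extensional in auto)
qed

locale point_map = F: coarse_point M X F + G: coarse_point M X G
  for M :: "('o, 'a) moncat" (structure) and X :: "'x set"
    and F G :: "('x, ('x \<times> 'x) list, ('x \<times> 'x) path_cell, unit, 'o, 'a) colax" +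
  fixes \<sigma> :: "'x \<Rightarrow> 'x \<Rightarrow> ('x \<times> 'x) list \<Rightarrow> 'a"
  assumes sigma_closed: "chn X A s B \<Longrightarrow> \<sigma> A B s \<in> Hom (mcat M) (fo F A B s) (fo G A B s)"
    and sigma_natural: "w \<in> cells X A B
      \<Longrightarrow> \<sigma> A B (snd (snd w)) \<odot> fa F A B w = fa G A B w \<odot> \<sigma> A B (fst w)"
    and sigma_ccomp: "\<lbrakk>chn X A s B; chn X B t D\<rbrakk>
      \<Longrightarrow> ccomp G A B D t s \<odot> \<sigma> A D (s @ t) = (\<sigma> B D t \<otimes>\<^sub>a \<sigma> A B s) \<odot> ccomp F A B D t s"
    and sigma_cunit: "A \<in> X \<Longrightarrow> cunit G A \<odot> \<sigma> A A [] = cunit F A"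
    and sigma_undefined: "\<not> chn X A s B \<Longrightarrow> \<sigma> A B s = undefined"
begin

lemma sigma_simps:
  assumes "chn X A s B"
  shows "\<sigma> A B s \<in> Arr (mcat M)" "Dom (mcat M) (\<sigma> A B s) = fo F A B s"
    "Cod (mcat M) (\<sigma> A B s) = fo G A B s"
  using sigma_closed[OF assms] by (auto simp: F.U.in_Hom_iff)

end

lemma (in monoidal_category) point_map_iff:
  assumes "coarse_point M X F" "coarse_point M X G"
  shows "colax_transformation (path_bicat (coarse X)) (deloop M) F G \<sigma> \<longleftrightarrow> point_map M X F G \<sigma>"
proof
  assume "colax_transformation (path_bicat (coarse X)) (deloop M) F G \<sigma>"
  then interpret T: colax_transformation "path_bicat (coarse X)" "deloop M" F G \<sigma> .
  have nt: "natural_transformation (path_hom (coarse X) A B) (mcat M) (chom F A B) (chom G A B) (\<sigma> A B)"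
    if "A \<in> X" "B \<in> X" for A B
    using T.component_natural[of A B] that by (simp add: deloop_simps path_bicat_simps coarse_simps)
  show "point_map M X F G \<sigma>"
  proof (intro point_map.intro point_map_axioms.intro assms)
    fix A B s assume s: "chn X A s B"
    then show "\<sigma> A B s \<in> Hom (mcat M) (fo F A B s) (fo G A B s)"
      using natural_transformation.component_closed[OF nt, of A B s] chn_objs[OF s]
      by (simp add: coarse.path_hom_simps)
  next
    fix A B w assume w: "w \<in> cells X A B"
    then show "\<sigma> A B (snd (snd w)) \<odot> fa F A B w = fa G A B w \<odot> \<sigma> A B (fst w)"
      using natural_transformation.naturality[OF nt, of A B w "fst w" "snd (snd w)"]
        cell_objs[OF w]
      by (simp add: coarse.in_Hom_path_hom)
  next
    fix A B D s t assume st: "chn X A s B" "chn X B t D"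
    then show "ccomp G A B D t s \<odot> \<sigma> A D (s @ t) = (\<sigma> B D t \<otimes>\<^sub>a \<sigma> A B s) \<odot> ccomp F A B D t s"
      using T.component_ccomp[of A B D t s] chn_objs[OF st(1)] chn_objs[OF st(2)]
      by (simp add: deloop_simps path_bicat_simps coarse_simps coarse.path_hom_simps)
  next
    fix A B s assume s: "\<not> chn X A s B"
    show "\<sigma> A B s = undefined"
    proof (cases "A \<in> X \<and> B \<in> X")
      case True
      then show ?thesis
        using natural_transformation.component_ext[OF nt, of A B] s
        by (simp add: coarse.path_hom_simps extensional_def)
    next
      case False
      then show ?thesis using T.component_ext[of A B] by (auto simp: path_bicat_simps coarse_simps)
    qed
  qed (use T.component_cunit in \<open>simp add: deloop_simps path_bicat_simps coarse_simps\<close>)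
next
  assume "point_map M X F G \<sigma>"
  then interpret point_map M X F G \<sigma> .
  have "point (coarse X) (deloop M) (Iso_cells (deloop M)) F"
    "point (coarse X) (deloop M) (Iso_cells (deloop M)) G"
    using assms coarse_point_iff by blast+
  then have "colax_functor (path_bicat (coarse X)) (deloop M) F"
    "colax_functor (path_bicat (coarse X)) (deloop M) G"
    by (simp_all add: point_def)
  then show "colax_transformation (path_bicat (coarse X)) (deloop M) F G \<sigma>"
  proof (intro colax_transformation.intro colax_transformation_axioms.intro)
    fix A B assume "A \<in> Cells0 (path_bicat (coarse X))" "B \<in> Cells0 (path_bicat (coarse X))"
    then have AB: "A \<in> X" "B \<in> X" by (simp_all add: path_bicat_simps coarse_simps)
    show "natural_transformation (Hc (path_bicat (coarse X)) A B) (Hc (deloop M) (cobj F A) (cobj F B))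
      (chom F A B) (chom G A B) (\<sigma> A B)"
      unfolding deloop_simps path_bicat_simps
      by (intro natural_transformation.intro natural_transformation_axioms.intro
          F.chom_func G.chom_func AB)
        (use sigma_closed sigma_natural sigma_undefined in
          \<open>auto simp: coarse.path_hom_simps coarse.in_Hom_path_hom extensional_def\<close>)
  next
    fix A B assume "\<not> (A \<in> Cells0 (path_bicat (coarse X)) \<and> B \<in> Cells0 (path_bicat (coarse X)))"
    then show "\<sigma> A B = (\<lambda>_. undefined)"
      using sigma_undefined chn_objs[of X A _ B] by (auto simp: fun_eq_iff path_bicat_simps coarse_simps)
  next
    show "cobj F = cobj G" by (simp add: fun_eq_iff)
  qed (use sigma_ccomp sigma_cunit in
      \<open>simp_all add: deloop_simps path_bicat_simps coarse_simps coarse.path_hom_simps\<close>)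
qed

section \<open>The enriched category of a point and the enriched functor of a morphism\<close>

lemma chn_simps:
  "chn X A [] B \<longleftrightarrow> A \<in> X \<and> A = B"
  "chn X A (f # s) B \<longleftrightarrow> A \<in> X \<and> snd f \<in> X \<and> fst f = A \<and> chn X (snd f) s B"
  by (auto simp: coarse_simps mem_Times_iff)

text \<open>An instance of \<open>collapse_vcomp\<close> for the ordinal sum of two
  collapses.\<close>

lemma col_append:
  assumes "chn X A s B" "chn X B t D"
  shows "path_vcomp (col X A [(A, B), (B, D)]) (path_hcomp (col X B t) (col X A s)) = col X A (s @ t)"
  using coarse.collapse_vcomp[OF coarse.path_hcomp_closed[OF coarse.collapse_closed[OF assms(2)] coarse.collapse_closed[OF assms(1)]]]
  by (simp add: path_hcomp_ends fst_col snd_col[OF assms(1)] snd_col[OF assms(2)])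

lemma col_single: "A \<in> X \<Longrightarrow> B \<in> X \<Longrightarrow> col X A [(A, B)] = path_id [(A, B)]"
  by (rule coarse.collapse_single) (simp_all add: coarse_simps)

context coarse_point
begin

definition comp_of :: "'x \<Rightarrow> 'x \<Rightarrow> 'x \<Rightarrow> 'a" where
  "comp_of A B D = fa F A D (col X A [(A, B), (B, D)]) \<odot> cinv (mcat M) (ccomp F A B D [(B, D)] [(A, B)])"

definition unit_of :: "'x \<Rightarrow> 'a" where
  "unit_of A = fa F A A (col X A []) \<odot> cinv (mcat M) (cunit F A)"

definition enriched :: "('x, 'o, 'a) ecat" where
  "enriched = \<lparr>ehom = (\<lambda>A B. if A \<in> X \<and> B \<in> X then fo F A B [(A, B)] else undefined),
     ecomp = (\<lambda>A B D. if A \<in> X \<and> B \<in> X \<and> D \<in> X then comp_of A B D else undefined),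
     eunit = restrict unit_of X\<rparr>"

lemma enriched_simps:
  "A \<in> X \<Longrightarrow> B \<in> X \<Longrightarrow> ehom enriched A B = fo F A B [(A, B)]"
  "A \<in> X \<Longrightarrow> B \<in> X \<Longrightarrow> D \<in> X \<Longrightarrow> ecomp enriched A B D = comp_of A B D"
  "A \<in> X \<Longrightarrow> eunit enriched A = unit_of A"
  by (simp_all add: enriched_def)

lemma fa_col_simps:
  assumes "chn X A s B"
  shows "fa F A B (col X A s) \<in> Arr (mcat M)" "Dom (mcat M) (fa F A B (col X A s)) = fo F A B s"
    "Cod (mcat M) (fa F A B (col X A s)) = fo F A B [(A, B)]"
  using fa_simps[OF coarse.collapse_closed[OF assms]] by (simp_all add: fst_col snd_col[OF assms])

lemma comp_of_simps:
  assumes "A \<in> X" "B \<in> X" "D \<in> X"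
  shows "comp_of A B D \<in> Arr (mcat M)"
    "Dom (mcat M) (comp_of A B D) = fo F B D [(B, D)] \<otimes>\<^sub>o fo F A B [(A, B)]"
    "Cod (mcat M) (comp_of A B D) = fo F A D [(A, D)]"
  using fa_col_simps[of A "[(A, B), (B, D)]" D] ccomp_simps[of A "[(A, B)]" B "[(B, D)]" D] assms
  by (simp_all add: comp_of_def chn_simps mon_simps U.cinv_simps)

lemma unit_of_simps:
  assumes "A \<in> X"
  shows "unit_of A \<in> Arr (mcat M)" "Dom (mcat M) (unit_of A) = \<I>"
    "Cod (mcat M) (unit_of A) = fo F A A [(A, A)]"
  using fa_col_simps[of A "[]" A] cunit_simps[OF assms] assms
  by (simp_all add: unit_of_def chn_simps mon_simps U.cinv_simps)

lemma fa_single: "A \<in> X \<Longrightarrow> B \<in> X \<Longrightarrow> fa F A B (col X A [(A, B)]) = \<one> (fo F A B [(A, B)])"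
  by (simp add: col_single fa_id chn_simps)

text \<open>Naturality of \<open>ccomp\<close> at the two collapses moves them inside
  \<open>F\<close>; the structure 2-cell then meets its inverse in \<open>comp_of\<close>, and
  \<open>col_append\<close> merges the collapses. Later proofs know \<open>comp_of\<close> only
  through this equation and its domain and codomain.\<close>

lemma comp_of_col:
  assumes s: "chn X A s B" and t: "chn X B t D"
  shows "comp_of A B D \<odot> ((fa F B D (col X B t) \<otimes>\<^sub>a fa F A B (col X A s)) \<odot> ccomp F A B D t s)
    = fa F A D (col X A (s @ t))"
proof -
  note X = chn_objs[OF s] chn_objs[OF t]
  note cells = coarse.collapse_closed[OF s] coarse.collapse_closed[OF t]
  let ?h = "path_hcomp (col X B t) (col X A s)"
  have h: "?h \<in> cells X A D" using cells by (intro coarse.path_hcomp_closed)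
  have m: "col X A [(A, B), (B, D)] \<in> cells X A D"
    using X by (intro coarse.collapse_closed) (simp add: chn_simps)
  have "(fa F B D (col X B t) \<otimes>\<^sub>a fa F A B (col X A s)) \<odot> ccomp F A B D t s
      = ccomp F A B D [(B, D)] [(A, B)] \<odot> fa F A D ?h"
    using ccomp_nat[OF cells(2,1)] by (simp add: fst_col snd_col[OF s] snd_col[OF t])
  moreover have "comp_of A B D \<odot> (ccomp F A B D [(B, D)] [(A, B)] \<odot> fa F A D ?h)
      = fa F A D (col X A [(A, B), (B, D)]) \<odot> fa F A D ?h"
    using X s t h fa_simps[OF m] fa_simps[OF h]
      ccomp_simps[of A "[(A, B)]" B "[(B, D)]" D] fa_col_simps[of A "[(A, B), (B, D)]" D]
    by (simp add: comp_of_def mon_simps U.cinv_simps U.cinv_cancel chn_simps path_hcomp_ends fst_col snd_col[OF s] snd_col[OF t])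
  moreover have "\<dots> = fa F A D (col X A (s @ t))"
    using h m X s t
    by (simp add: col_append[OF s t, symmetric] fa_comp path_hcomp_ends fst_col snd_col[OF s] snd_col[OF t])
  ultimately show ?thesis by simp
qed

lemma unit_of_col: "A \<in> X \<Longrightarrow> unit_of A \<odot> cunit F A = fa F A A (col X A [])"
  using fa_col_simps[of A "[]" A] cunit_simps[of A]
  by (simp add: unit_of_def mon_simps U.cinv_simps chn_simps)

text \<open>All laws are checked after composing with an invertible structure 2-cell of \<open>F\<close>, where both
  sides become the image of the collapse of a whole path.\<close>

lemma enriched_category_enriched: "enriched_category M X enriched"
proof (intro enriched_category.intro enriched_category_axioms.intro monoidal_category_axioms)
  fix A B D E assume X: "A \<in> X" "B \<in> X" "D \<in> X" "E \<in> X"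
  let ?f = "[(A, B)]" and ?g = "[(B, D)]" and ?h = "[(D, E)]"
  have ch: "chn X A ?f B" "chn X B ?g D" "chn X D ?h E" "chn X A (?f @ ?g) D" "chn X B (?g @ ?h) E"
      "chn X A (?f @ ?g @ ?h) E"
    using X by (simp_all add: chn_simps)
  note ch' = ch[simplified]
  let ?k = "(ccomp F B D E ?h ?g \<otimes>\<^sub>a \<one> (fo F A B ?f)) \<odot> ccomp F A B E (?g @ ?h) ?f"
  have k: "?k \<in> Isos (mcat M)" "?k \<in> Arr (mcat M)" "Dom (mcat M) ?k = fo F A E (?f @ ?g @ ?h)"
    "Cod (mcat M) ?k = (fo F D E ?h \<otimes>\<^sub>o fo F B D ?g) \<otimes>\<^sub>o fo F A B ?f"
    using ch' by (auto simp: mon_simps point_simps intro!: U.Isos_comp tarr_Isos U.Isos_ide)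
  have "comp_of A B E \<odot> (comp_of B D E \<otimes>\<^sub>a \<one> (fo F A B ?f)) \<odot> ?k
      = comp_of A B E \<odot> (((comp_of B D E \<odot> ccomp F B D E ?h ?g) \<otimes>\<^sub>a \<one> (fo F A B ?f)) \<odot> ccomp F A B E (?g @ ?h) ?f)"
    using X ch' by (simp add: mon_simps point_simps comp_of_simps)
  also have "comp_of B D E \<odot> ccomp F B D E ?h ?g = fa F B E (col X B (?g @ ?h))"
    using comp_of_col[OF ch(2,3)] X ch' by (simp add: fa_single mon_simps point_simps comp_of_simps)
  also have "comp_of A B E \<odot> ((fa F B E (col X B (?g @ ?h)) \<otimes>\<^sub>a \<one> (fo F A B ?f)) \<odot> ccomp F A B E (?g @ ?h) ?f)
      = fa F A E (col X A (?f @ ?g @ ?h))"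
    using comp_of_col[OF ch(1,5)] X ch' by (simp add: fa_single)
  also have "\<dots> = comp_of A D E \<odot> ((\<one> (fo F D E ?h) \<otimes>\<^sub>a fa F A D (col X A (?f @ ?g))) \<odot> ccomp F A D E ?h (?f @ ?g))"
    using comp_of_col[OF ch(4,3)] X ch' by (simp add: fa_single)
  also have "fa F A D (col X A (?f @ ?g)) = comp_of A B D \<odot> ccomp F A B D ?g ?f"
    using comp_of_col[OF ch(1,2)] X ch' by (simp add: fa_single mon_simps point_simps comp_of_simps)
  also have "comp_of A D E \<odot> ((\<one> (fo F D E ?h) \<otimes>\<^sub>a (comp_of A B D \<odot> ccomp F A B D ?g ?f)) \<odot> ccomp F A D E ?h (?f @ ?g))
      = comp_of A D E \<odot> ((\<one> (fo F D E ?h) \<otimes>\<^sub>a comp_of A B D)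
          \<odot> ((\<one> (fo F D E ?h) \<otimes>\<^sub>a ccomp F A B D ?g ?f) \<odot> ccomp F A D E ?h (?f @ ?g)))"
    using X ch' by (simp add: mon_simps point_simps comp_of_simps)
  \<comment> \<open>Both bracketings have met in the collapse of the whole path.
    \<open>ccomp_coassoc\<close> trades the structure 2-cells of the right-hand one for \<alpha>
    after \<open>?k\<close>, so that \<open>?k\<close> can be cancelled.\<close>
  also have "\<dots> = comp_of A D E \<odot> ((\<one> (fo F D E ?h) \<otimes>\<^sub>a comp_of A B D)
          \<odot> (\<alpha> (fo F D E ?h) (fo F B D ?g) (fo F A B ?f) \<odot> ?k))"
    by (simp only: ccomp_coassoc[OF ch(1-3)])
  also have "\<dots> = comp_of A D E \<odot> (\<one> (fo F D E ?h) \<otimes>\<^sub>a comp_of A B D)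
          \<odot> \<alpha> (fo F D E ?h) (fo F B D ?g) (fo F A B ?f) \<odot> ?k"
    using X ch' by (simp add: mon_simps point_simps comp_of_simps)
  finally have eq: "comp_of A B E \<odot> (comp_of B D E \<otimes>\<^sub>a \<one> (fo F A B ?f)) \<odot> ?k = \<dots>" .
  have "comp_of A B E \<odot> (comp_of B D E \<otimes>\<^sub>a \<one> (fo F A B ?f))
      = comp_of A D E \<odot> (\<one> (fo F D E ?h) \<otimes>\<^sub>a comp_of A B D) \<odot> \<alpha> (fo F D E ?h) (fo F B D ?g) (fo F A B ?f)"
    by (rule U.iso_cancel_right[OF k(1) _ _ _ _ eq])
      (use X ch' k in \<open>simp_all add: mon_simps point_simps comp_of_simps\<close>)
  then show "ecomp enriched A B E \<odot> (ecomp enriched B D E \<otimes>\<^sub>a \<one> (ehom enriched A B))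
      = ecomp enriched A D E \<odot> (\<one> (ehom enriched D E) \<otimes>\<^sub>a ecomp enriched A B D)
        \<odot> \<alpha> (ehom enriched D E) (ehom enriched B D) (ehom enriched A B)"
    using X by (simp add: enriched_simps)
next
  fix A B assume X: "A \<in> X" "B \<in> X"
  let ?f = "[(A, B)]"
  have ch: "chn X A ?f B" "chn X A [] A" "chn X B [] B" using X by (simp_all add: chn_simps)
  let ?k = "(cunit F B \<otimes>\<^sub>a \<one> (fo F A B ?f)) \<odot> ccomp F A B B [] ?f"
  have k: "?k \<in> Isos (mcat M)" "?k \<in> Arr (mcat M)" "Dom (mcat M) ?k = fo F A B ?f"
    "Cod (mcat M) ?k = \<I> \<otimes>\<^sub>o fo F A B ?f"
    using X ch ccomp_simps[OF ch(1,3)]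
    by (auto simp: mon_simps point_simps intro!: U.Isos_comp tarr_Isos U.Isos_ide)
  have "comp_of A B B \<odot> (unit_of B \<otimes>\<^sub>a \<one> (fo F A B ?f)) \<odot> ?k
      = comp_of A B B \<odot> (((unit_of B \<odot> cunit F B) \<otimes>\<^sub>a \<one> (fo F A B ?f)) \<odot> ccomp F A B B [] ?f)"
    using X ch ccomp_simps[OF ch(1,3)] by (simp add: mon_simps point_simps comp_of_simps unit_of_simps)
  also have "\<dots> = fa F A B (col X A (?f @ []))"
    using comp_of_col[OF ch(1,3)] X by (simp add: fa_single unit_of_col)
  \<comment> \<open>The collapse of a single arrow is an identity, which the counit law writes as
    \<ll> after \<open>?k\<close>.\<close>
  also have "\<dots> = \<ll> (fo F A B ?f) \<odot> ?k"
    unfolding ccomp_counit_left[OF ch(1)] using X by (simp add: fa_single)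
  finally have eq: "comp_of A B B \<odot> (unit_of B \<otimes>\<^sub>a \<one> (fo F A B ?f)) \<odot> ?k = \<ll> (fo F A B ?f) \<odot> ?k" .
  have "comp_of A B B \<odot> (unit_of B \<otimes>\<^sub>a \<one> (fo F A B ?f)) = \<ll> (fo F A B ?f)"
    by (rule U.iso_cancel_right[OF k(1) _ _ _ _ eq])
      (use X ch k in \<open>simp_all add: mon_simps point_simps comp_of_simps unit_of_simps\<close>)
  then show "ecomp enriched A B B \<odot> (eunit enriched B \<otimes>\<^sub>a \<one> (ehom enriched A B)) = \<ll> (ehom enriched A B)"
    using X by (simp add: enriched_simps)
  let ?k = "(\<one> (fo F A B ?f) \<otimes>\<^sub>a cunit F A) \<odot> ccomp F A A B ?f []"
  have k: "?k \<in> Isos (mcat M)" "?k \<in> Arr (mcat M)" "Dom (mcat M) ?k = fo F A B ?f"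
    "Cod (mcat M) ?k = fo F A B ?f \<otimes>\<^sub>o \<I>"
    using X ch ccomp_simps[OF ch(2,1)]
    by (auto simp: mon_simps point_simps intro!: U.Isos_comp tarr_Isos U.Isos_ide)
  have "comp_of A A B \<odot> (\<one> (fo F A B ?f) \<otimes>\<^sub>a unit_of A) \<odot> ?k
      = comp_of A A B \<odot> ((\<one> (fo F A B ?f) \<otimes>\<^sub>a (unit_of A \<odot> cunit F A)) \<odot> ccomp F A A B ?f [])"
    using X ch ccomp_simps[OF ch(2,1)] by (simp add: mon_simps point_simps comp_of_simps unit_of_simps)
  also have "\<dots> = fa F A B (col X A ([] @ ?f))"
    using comp_of_col[OF ch(2,1)] X by (simp add: fa_single unit_of_col)
  also have "\<dots> = \<rr> (fo F A B ?f) \<odot> ?k"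
    unfolding ccomp_counit_right[OF ch(1)] using X by (simp add: fa_single)
  finally have eq: "comp_of A A B \<odot> (\<one> (fo F A B ?f) \<otimes>\<^sub>a unit_of A) \<odot> ?k = \<rr> (fo F A B ?f) \<odot> ?k" .
  have "comp_of A A B \<odot> (\<one> (fo F A B ?f) \<otimes>\<^sub>a unit_of A) = \<rr> (fo F A B ?f)"
    by (rule U.iso_cancel_right[OF k(1) _ _ _ _ eq])
      (use X ch k in \<open>simp_all add: mon_simps point_simps comp_of_simps unit_of_simps\<close>)
  then show "ecomp enriched A A B \<odot> (\<one> (ehom enriched A B) \<otimes>\<^sub>a eunit enriched A) = \<rr> (ehom enriched A B)"
    using X by (simp add: enriched_simps)
qed (auto simp: enriched_simps comp_of_simps unit_of_simps U.in_Hom_iff fo_closed chn_simps, auto simp: enriched_def)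

end

context point_map
begin

definition enriched_map :: "'x \<Rightarrow> 'x \<Rightarrow> 'a" where
  "enriched_map A B = (if A \<in> X \<and> B \<in> X then \<sigma> A B [(A, B)] else undefined)"

text \<open>Naturality of \<sigma> at the collapse of two arrows yields compatibility with
  composition, at the collapse of the empty path compatibility with units; the structure 2-cells of
  \<open>F\<close> are cancelled on the right.\<close>

lemma enriched_functor_enriched_map: "enriched_functor M X F.enriched G.enriched enriched_map"
proof (intro enriched_functor.intro enriched_functor_axioms.intro F.enriched_category_enriched
    G.enriched_category_enriched)
  fix A B D assume X: "A \<in> X" "B \<in> X" "D \<in> X"
  let ?f = "[(A, B)]" and ?g = "[(B, D)]"
  have ch: "chn X A ?f B" "chn X B ?g D" "chn X A (?f @ ?g) D" "chn X A [(A, D)] D"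
    using X by (simp_all add: chn_simps)
  note ch' = ch[simplified]
  have FG: "F.comp_of A B D \<odot> ccomp F A B D ?g ?f = fa F A D (col X A (?f @ ?g))"
    "G.comp_of A B D \<odot> ccomp G A B D ?g ?f = fa G A D (col X A (?f @ ?g))"
    using F.comp_of_col[OF ch(1,2)] G.comp_of_col[OF ch(1,2)] X ch'
    by (simp_all add: F.fa_single G.fa_single F.mon_simps F.point_simps G.point_simps)
  have "\<sigma> A D [(A, D)] \<odot> F.comp_of A B D \<odot> ccomp F A B D ?g ?f
      = \<sigma> A D [(A, D)] \<odot> fa F A D (col X A (?f @ ?g))"
    using X ch' FG(1) by (simp add: F.mon_simps sigma_simps F.point_simps F.comp_of_simps)
  also have "\<dots> = fa G A D (col X A (?f @ ?g)) \<odot> \<sigma> A D (?f @ ?g)"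
    using sigma_natural[OF coarse.collapse_closed[OF ch(3)]] by (simp only: fst_col snd_col[OF ch(3)])
  also have "\<dots> = G.comp_of A B D \<odot> (ccomp G A B D ?g ?f \<odot> \<sigma> A D (?f @ ?g))"
    using X ch' by (simp add: FG(2)[symmetric, unfolded append.simps] F.mon_simps sigma_simps G.point_simps G.comp_of_simps)
  also have "\<dots> = G.comp_of A B D \<odot> (\<sigma> B D ?g \<otimes>\<^sub>a \<sigma> A B ?f) \<odot> ccomp F A B D ?g ?f"
    using X ch' by (simp add: sigma_ccomp[OF ch(1,2), simplified] F.mon_simps sigma_simps F.point_simps G.comp_of_simps)
  finally have eq: "\<sigma> A D [(A, D)] \<odot> F.comp_of A B D \<odot> ccomp F A B D ?g ?f = \<dots>" .
  have "\<sigma> A D [(A, D)] \<odot> F.comp_of A B D = G.comp_of A B D \<odot> (\<sigma> B D ?g \<otimes>\<^sub>a \<sigma> A B ?f)"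
    by (rule F.U.iso_cancel_right[OF _ _ _ _ _ eq])
      (use X ch' in \<open>simp_all add: F.mon_simps sigma_simps F.point_simps F.comp_of_simps G.comp_of_simps\<close>)
  then show "enriched_map A D \<odot> ecomp F.enriched A B D
      = ecomp G.enriched A B D \<odot> (enriched_map B D \<otimes>\<^sub>a enriched_map A B)"
    using X by (simp add: enriched_map_def F.enriched_simps G.enriched_simps)
next
  fix A assume X: "A \<in> X"
  have ch: "chn X A [] A" "chn X A [(A, A)] A" using X by (simp_all add: chn_simps)
  have "\<sigma> A A [(A, A)] \<odot> F.unit_of A \<odot> cunit F A = \<sigma> A A [(A, A)] \<odot> fa F A A (col X A [])"
    using X ch by (simp add: F.mon_simps sigma_simps F.point_simps F.unit_of_simps F.unit_of_col)
  also have "\<dots> = fa G A A (col X A []) \<odot> \<sigma> A A []"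
    using sigma_natural[OF coarse.collapse_closed[OF ch(1)]] by (simp only: fst_col snd_col[OF ch(1)])
  also have "\<dots> = G.unit_of A \<odot> (cunit G A \<odot> \<sigma> A A [])"
    using X ch by (simp add: G.unit_of_col[symmetric] F.mon_simps sigma_simps G.point_simps G.unit_of_simps)
  also have "\<dots> = G.unit_of A \<odot> cunit F A"
    using X by (simp add: sigma_cunit)
  finally have eq: "\<sigma> A A [(A, A)] \<odot> F.unit_of A \<odot> cunit F A = \<dots>" .
  have "\<sigma> A A [(A, A)] \<odot> F.unit_of A = G.unit_of A"
    by (rule F.U.iso_cancel_right[OF _ _ _ _ _ eq])
      (use X ch in \<open>simp_all add: F.mon_simps sigma_simps F.point_simps F.unit_of_simps G.unit_of_simps\<close>)
  then show "enriched_map A A \<odot> eunit F.enriched A = eunit G.enriched A"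
    using X by (simp add: enriched_map_def F.enriched_simps G.enriched_simps)
qed (auto simp: enriched_map_def F.enriched_simps G.enriched_simps chn_simps intro!: sigma_closed)

end

text \<open>The structure 2-cells of \<open>G\<close> are left cancellable, so the compatibility law
  computes the component at a path from those at its first arrow and at the rest. The recursion ends
  at the empty path, where \<open>sigma_cunit\<close> decides.\<close>

lemma point_map_eqI:
  assumes "point_map M X F G \<sigma>" "point_map M X F G \<tau>"
    and single: "\<And>A B. A \<in> X \<Longrightarrow> B \<in> X \<Longrightarrow> \<sigma> A B [(A, B)] = \<tau> A B [(A, B)]"
  shows "\<sigma> = \<tau>"
proof -
  interpret S: point_map M X F G \<sigma> by fact
  interpret T: point_map M X F G \<tau> by fact
  have "\<sigma> A B s = \<tau> A B s" if "chn X A s B" for A B s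
    using that
  proof (induction s arbitrary: A)
    case Nil
    then have X: "A \<in> X" "B = A" by auto
    then have "cunit G A \<odot>\<^bsub>M\<^esub> \<sigma> A A [] = cunit G A \<odot>\<^bsub>M\<^esub> \<tau> A A []"
      using S.sigma_cunit T.sigma_cunit by simp
    then show ?case unfolding X(2)
      by (rule S.F.U.iso_cancel_left[rotated 5])
        (use X in \<open>simp_all add: S.sigma_simps T.sigma_simps S.G.point_simps chn_simps\<close>)
  next
    case (Cons f s)
    obtain E where f: "f = (A, E)" using Cons.prems by (cases f) (simp add: chn_simps)
    have ch: "A \<in> X" "E \<in> X" "chn X E s B" "chn X A [(A, E)] E" "chn X A ((A, E) # s) B"
      using Cons.prems by (simp_all add: f chn_simps)
    have "ccomp G A E B s [(A, E)] \<odot>\<^bsub>M\<^esub> \<sigma> A B ((A, E) # s) = ccomp G A E B s [(A, E)] \<odot>\<^bsub>M\<^esub> \<tau> A B ((A, E) # s)"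
      using S.sigma_ccomp[OF ch(4,3)] T.sigma_ccomp[OF ch(4,3)] Cons.IH[OF ch(3)] single[OF ch(1,2)] by simp
    then show ?case unfolding f
      by (rule S.F.U.iso_cancel_left[rotated 5])
        (use ch in \<open>simp_all add: S.sigma_simps T.sigma_simps S.G.point_simps\<close>)
  qed
  then show ?thesis
    using S.sigma_undefined T.sigma_undefined by (metis ext)
qed

section \<open>Lifting enriched functors to points\<close>

locale enriched_lift = F: coarse_point M X F + G: coarse_point M X G +
    enriched_functor M X F.enriched G.enriched T
  for M :: "('o, 'a) moncat" (structure) and X :: "'x set"
    and F G :: "('x, ('x \<times> 'x) list, ('x \<times> 'x) path_cell, unit, 'o, 'a) colax"
    and T :: "'x \<Rightarrow> 'x \<Rightarrow> 'a"
begin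

text \<open>Obtained by solving \<open>sigma_cunit\<close>, and \<open>sigma_ccomp\<close> for a
  single first arrow, for the unknown component, so no other extension of \<open>T\<close> is
  possible. A path with one arrow is not a base case; \<open>lift_single\<close> recovers
  \<open>T\<close> there.\<close>

primrec lift :: "('x \<times> 'x) list \<Rightarrow> 'x \<Rightarrow> 'x \<Rightarrow> 'a" where
  "lift [] A B = cinv (mcat M) (cunit G A) \<odot> cunit F A"
| "lift (f # s) A B = cinv (mcat M) (ccomp G A (snd f) B s [f])
     \<odot> ((lift s (snd f) B \<otimes>\<^sub>a T A (snd f)) \<odot> ccomp F A (snd f) B s [f])"

lemma T_simps:
  assumes "A \<in> X" "B \<in> X"
  shows "T A B \<in> Arr (mcat M)" "Dom (mcat M) (T A B) = fo F A B [(A, B)]"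
    "Cod (mcat M) (T A B) = fo G A B [(A, B)]"
  using efun_closed[OF assms] assms by (auto simp: F.U.in_Hom_iff F.enriched_simps G.enriched_simps)

lemma T_comp:
  assumes "A \<in> X" "B \<in> X" "D \<in> X"
  shows "T A D \<odot> F.comp_of A B D = G.comp_of A B D \<odot> (T B D \<otimes>\<^sub>a T A B)"
  using efun_comp[OF assms] assms by (simp add: F.enriched_simps G.enriched_simps)

lemma T_unit: "A \<in> X \<Longrightarrow> T A A \<odot> F.unit_of A = G.unit_of A"
  using efun_unit[of A] by (simp add: F.enriched_simps G.enriched_simps)

lemma lift_simps:
  assumes "chn X A s B"
  shows "lift s A B \<in> Arr (mcat M) \<and> Dom (mcat M) (lift s A B) = fo F A B s
    \<and> Cod (mcat M) (lift s A B) = fo G A B s"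
  using assms
proof (induction s arbitrary: A)
  case Nil
  then show ?case
    by (auto simp: F.mon_simps F.U.cinv_simps F.cunit_simps G.cunit_simps)
next
  case (Cons f s)
  obtain E where f: "f = (A, E)" using Cons.prems by (cases f) simp
  have ch: "A \<in> X" "E \<in> X" "chn X E s B" "chn X A [(A, E)] E"
    using Cons.prems by (simp_all add: f)
  show ?case
    using ch Cons.IH[OF ch(3)] F.ccomp_simps[OF ch(4,3)] G.ccomp_simps[OF ch(4,3)]
    by (simp add: f F.mon_simps F.U.cinv_simps T_simps)
qed

lemmas lift_simps' = lift_simps[THEN conjunct1] lift_simps[THEN conjunct2, THEN conjunct1]
  lift_simps[THEN conjunct2, THEN conjunct2]

lemma cunit_lift: "A \<in> X \<Longrightarrow> cunit G A \<odot> lift [] A A = cunit F A"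
  by (simp add: F.mon_simps F.U.cinv_simps F.U.cinv_cancel F.cunit_simps G.cunit_simps)

lemma ccomp_lift_Cons:
  assumes "A \<in> X" "chn X B s D"
  shows "ccomp G A B D s [(A, B)] \<odot> lift ((A, B) # s) A D
    = (lift s B D \<otimes>\<^sub>a T A B) \<odot> ccomp F A B D s [(A, B)]"
proof -
  have "B \<in> X" and ch: "chn X A [(A, B)] B" using assms chn_objs[OF assms(2)] by simp_all
  then show ?thesis
    using assms F.ccomp_simps[OF ch assms(2)] G.ccomp_simps[OF ch assms(2)]
    by (simp add: F.mon_simps F.U.cinv_simps F.U.cinv_cancel T_simps lift_simps')
qed

text \<open>The recursion runs down to the empty path, so the value at one arrow is \<open>T\<close>
  with a unit factor attached. The left counit laws of \<open>F\<close> and \<open>G\<close> and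
  naturality of \<ll> remove this factor.\<close>

lemma lift_single:
  assumes X: "A \<in> X" "B \<in> X"
  shows "lift [(A, B)] A B = T A B"
proof -
  let ?f = "[(A, B)]"
  have ch: "chn X A ?f B" "chn X B [] B" using X by simp_all
  note simps = F.mon_simps F.point_simps G.point_simps F.ccomp_simps[OF ch, simplified]
    G.ccomp_simps[OF ch, simplified] lift_simps' T_simps
  \<comment> \<open>An identity is inserted in the form of the left counit law of
    \<open>G\<close>.\<close>
  have "lift ?f A B = (\<ll> (fo G A B ?f) \<odot> ((cunit G B \<otimes>\<^sub>a \<one> (fo G A B ?f)) \<odot> ccomp G A B B [] ?f)) \<odot> lift ?f A B"
    unfolding G.ccomp_counit_left[OF ch(1)] using lift_simps[OF ch(1)] by (simp add: F.mon_simps del: lift.simps)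
  also have "\<dots> = \<ll> (fo G A B ?f) \<odot> ((cunit G B \<otimes>\<^sub>a \<one> (fo G A B ?f)) \<odot> (ccomp G A B B [] ?f \<odot> lift ?f A B))"
    using X ch by (simp add: simps del: lift.simps)
  also have "\<dots> = \<ll> (fo G A B ?f) \<odot> (((cunit G B \<odot> lift [] B B) \<otimes>\<^sub>a T A B) \<odot> ccomp F A B B [] ?f)"
    unfolding ccomp_lift_Cons[OF X(1) ch(2)] using X ch by (simp add: simps del: lift.simps)
  also have "\<dots> = \<ll> (fo G A B ?f) \<odot> ((\<one> \<I> \<otimes>\<^sub>a T A B) \<odot> ((cunit F B \<otimes>\<^sub>a \<one> (fo F A B ?f)) \<odot> ccomp F A B B [] ?f))"
    unfolding cunit_lift[OF X(2)] using X ch by (simp add: simps)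
  also have "\<dots> = (\<ll> (fo G A B ?f) \<odot> (\<one> \<I> \<otimes>\<^sub>a T A B)) \<odot> ((cunit F B \<otimes>\<^sub>a \<one> (fo F A B ?f)) \<odot> ccomp F A B B [] ?f)"
    using X ch by (simp add: simps)
  also have "\<dots> = T A B \<odot> (\<ll> (fo F A B ?f) \<odot> ((cunit F B \<otimes>\<^sub>a \<one> (fo F A B ?f)) \<odot> ccomp F A B B [] ?f))"
    using X ch by (subst F.mlunit_nat) (simp_all add: simps)
  also have "\<dots> = T A B"
    unfolding F.ccomp_counit_left[OF ch(1)] using X by (simp add: simps)
  finally show ?thesis .
qed

text \<open>\<open>ccomp_lift_Cons\<close> is the case of a single first arrow. A longer
  \<open>s\<close> is cut after its first arrow by coassociativity in \<open>G\<close> and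
  reassembled by coassociativity in \<open>F\<close>; an empty \<open>s\<close> needs the right
  counit laws.\<close>

lemma ccomp_lift:
  assumes "chn X A s B" "chn X B t D"
  shows "ccomp G A B D t s \<odot> lift (s @ t) A D = (lift t B D \<otimes>\<^sub>a lift s A B) \<odot> ccomp F A B D t s"
  using assms(1)
proof (induction s arbitrary: A)
  case Nil
  then have X: "B \<in> X" and AB: "A = B" using chn_objs[OF Nil] by simp_all
  have ch: "chn X B [] B" using X by simp
  note simps = F.mon_simps F.point_simps G.point_simps F.ccomp_simps[OF ch assms(2), simplified]
    G.ccomp_simps[OF ch assms(2), simplified] lift_simps'
  \<comment> \<open>After composing with \<open>cunit G\<close> and \<rr>, both sides equal
    \<open>lift t B D\<close>; the arrows added are invertible.\<close>
  have "\<rr> (fo G B D t) \<odot> ((\<one> (fo G B D t) \<otimes>\<^sub>a cunit G B) \<odot> (ccomp G B B D t [] \<odot> lift t B D))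
      = (\<rr> (fo G B D t) \<odot> ((\<one> (fo G B D t) \<otimes>\<^sub>a cunit G B) \<odot> ccomp G B B D t [])) \<odot> lift t B D"
    using X ch assms(2) by (simp add: simps)
  also have "\<dots> = lift t B D \<odot> (\<rr> (fo F B D t) \<odot> ((\<one> (fo F B D t) \<otimes>\<^sub>a cunit F B) \<odot> ccomp F B B D t []))"
    unfolding F.ccomp_counit_right[OF assms(2)] G.ccomp_counit_right[OF assms(2)]
    using assms(2) by (simp add: simps)
  also have "\<dots> = (lift t B D \<odot> \<rr> (fo F B D t)) \<odot> ((\<one> (fo F B D t) \<otimes>\<^sub>a cunit F B) \<odot> ccomp F B B D t [])"
    using X ch assms(2) by (simp add: simps)
  also have "lift t B D \<odot> \<rr> (fo F B D t) = \<rr> (fo G B D t) \<odot> (lift t B D \<otimes>\<^sub>a \<one> \<I>)"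
    using assms(2) by (subst F.mrunit_nat) (simp_all add: simps)
  also have "(\<rr> (fo G B D t) \<odot> (lift t B D \<otimes>\<^sub>a \<one> \<I>)) \<odot> ((\<one> (fo F B D t) \<otimes>\<^sub>a cunit F B) \<odot> ccomp F B B D t [])
      = \<rr> (fo G B D t) \<odot> ((lift t B D \<otimes>\<^sub>a (cunit G B \<odot> lift [] B B)) \<odot> ccomp F B B D t [])"
    unfolding cunit_lift[OF X] using X ch assms(2) by (simp add: simps)
  also have "\<dots> = \<rr> (fo G B D t) \<odot> ((\<one> (fo G B D t) \<otimes>\<^sub>a cunit G B)
      \<odot> ((lift t B D \<otimes>\<^sub>a lift [] B B) \<odot> ccomp F B B D t []))"
    using X ch assms(2) by (simp add: simps del: lift.simps)
  finally have eq: "\<rr> (fo G B D t) \<odot> ((\<one> (fo G B D t) \<otimes>\<^sub>a cunit G B) \<odot> (ccomp G B B D t [] \<odot> lift t B D)) = \<dots>" .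
  have eq': "(\<rr> (fo G B D t) \<odot> (\<one> (fo G B D t) \<otimes>\<^sub>a cunit G B)) \<odot> (ccomp G B B D t [] \<odot> lift t B D)
    = (\<rr> (fo G B D t) \<odot> (\<one> (fo G B D t) \<otimes>\<^sub>a cunit G B)) \<odot> ((lift t B D \<otimes>\<^sub>a lift [] B B) \<odot> ccomp F B B D t [])"
    using eq X ch assms(2) by (simp add: simps del: lift.simps)
  have "ccomp G B B D t [] \<odot> lift t B D = (lift t B D \<otimes>\<^sub>a lift [] B B) \<odot> ccomp F B B D t []"
    by (rule F.U.iso_cancel_left[OF _ _ _ _ _ eq'])
      (use X ch assms(2) in \<open>auto simp: simps simp del: lift.simps intro!: F.U.Isos_comp F.tarr_Isos F.U.Isos_ide\<close>)
  then show ?case by (simp add: AB)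
next
  case (Cons f s)
  obtain E where f: "f = (A, E)" using Cons.prems by (cases f) simp
  let ?f = "[(A, E)]"
  have X: "A \<in> X" "E \<in> X" and ch: "chn X E s B" "chn X A ?f E" "chn X A ((A, E) # s) B"
    using Cons.prems by (simp_all add: f)
  have st: "chn X E (s @ t) D" "chn X A ((A, E) # s @ t) D"
    using coarse.chain_append[OF ch(1) assms(2)] X by simp_all
  note ty = X ch st assms(2) F.ccomp_simps[OF ch(2,1)] G.ccomp_simps[OF ch(2,1)]
    F.ccomp_simps[OF ch(1) assms(2)] G.ccomp_simps[OF ch(1) assms(2)]
    F.ccomp_simps[OF ch(2) st(1)] G.ccomp_simps[OF ch(2) st(1)]
    F.ccomp_simps[OF ch(3) assms(2)] G.ccomp_simps[OF ch(3) assms(2)]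
    F.fo_closed[OF ch(1)] F.fo_closed[OF ch(2)] F.fo_closed[OF ch(3)] F.fo_closed[OF assms(2)]
    G.fo_closed[OF ch(1)] G.fo_closed[OF ch(2)] G.fo_closed[OF ch(3)] G.fo_closed[OF assms(2)]
    T_simps[OF X] lift_simps'[OF ch(1)] lift_simps'[OF ch(3)] lift_simps'[OF st(1)]
    lift_simps'[OF st(2)] lift_simps'[OF assms(2)]
  note simps = F.mon_simps ty[simplified append.simps]
  \<comment> \<open>The added invertible factor completes a side of \<open>ccomp_coassoc\<close> for
    \<open>?f\<close>, \<open>s\<close>, \<open>t\<close>; it reappears at the end of the
    calculation and is cancelled.\<close>
  have "(\<one> (fo G B D t) \<otimes>\<^sub>a ccomp G A E B s ?f)
        \<odot> (ccomp G A B D t ((A, E) # s) \<odot> lift ((A, E) # s @ t) A D)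
      = ((\<one> (fo G B D t) \<otimes>\<^sub>a ccomp G A E B s ?f) \<odot> ccomp G A B D t (?f @ s)) \<odot> lift ((A, E) # s @ t) A D"
    by (simp add: simps del: lift.simps)
  also have "\<dots> = (\<alpha> (fo G B D t) (fo G E B s) (fo G A E ?f)
      \<odot> ((ccomp G E B D t s \<otimes>\<^sub>a \<one> (fo G A E ?f)) \<odot> ccomp G A E D (s @ t) ?f)) \<odot> lift ((A, E) # s @ t) A D"
    by (simp only: G.ccomp_coassoc[OF ch(2,1) assms(2)])
  also have "\<dots> = \<alpha> (fo G B D t) (fo G E B s) (fo G A E ?f)
      \<odot> ((ccomp G E B D t s \<otimes>\<^sub>a \<one> (fo G A E ?f)) \<odot> (ccomp G A E D (s @ t) ?f \<odot> lift ((A, E) # s @ t) A D))"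
    by (simp add: simps del: lift.simps)
  also have "\<dots> = \<alpha> (fo G B D t) (fo G E B s) (fo G A E ?f)
      \<odot> (((ccomp G E B D t s \<odot> lift (s @ t) E D) \<otimes>\<^sub>a T A E) \<odot> ccomp F A E D (s @ t) ?f)"
    unfolding ccomp_lift_Cons[OF X(1) st(1)] by (simp add: simps del: lift.simps)
  also have "\<dots> = (\<alpha> (fo G B D t) (fo G E B s) (fo G A E ?f) \<odot> ((lift t B D \<otimes>\<^sub>a lift s E B) \<otimes>\<^sub>a T A E))
      \<odot> ((ccomp F E B D t s \<otimes>\<^sub>a \<one> (fo F A E ?f)) \<odot> ccomp F A E D (s @ t) ?f)"
    unfolding Cons.IH[OF ch(1)] by (simp add: simps del: lift.simps)
  also have "\<dots> = (lift t B D \<otimes>\<^sub>a (lift s E B \<otimes>\<^sub>a T A E)) \<odot> (\<alpha> (fo F B D t) (fo F E B s) (fo F A E ?f)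
      \<odot> ((ccomp F E B D t s \<otimes>\<^sub>a \<one> (fo F A E ?f)) \<odot> ccomp F A E D (s @ t) ?f))"
    by (subst F.massoc_nat) (simp_all add: simps del: lift.simps)
  also have "\<dots> = (lift t B D \<otimes>\<^sub>a (lift s E B \<otimes>\<^sub>a T A E))
      \<odot> ((\<one> (fo F B D t) \<otimes>\<^sub>a ccomp F A E B s ?f) \<odot> ccomp F A B D t (?f @ s))"
    by (simp only: F.ccomp_coassoc[OF ch(2,1) assms(2)])
  also have "\<dots> = (lift t B D \<otimes>\<^sub>a ((lift s E B \<otimes>\<^sub>a T A E) \<odot> ccomp F A E B s ?f)) \<odot> ccomp F A B D t ((A, E) # s)"
    by (simp add: simps del: lift.simps)
  also have "\<dots> = (lift t B D \<otimes>\<^sub>a (ccomp G A E B s ?f \<odot> lift ((A, E) # s) A B)) \<odot> ccomp F A B D t ((A, E) # s)"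
    by (simp only: ccomp_lift_Cons[OF X(1) ch(1)])
  also have "\<dots> = (\<one> (fo G B D t) \<otimes>\<^sub>a ccomp G A E B s ?f)
      \<odot> ((lift t B D \<otimes>\<^sub>a lift ((A, E) # s) A B) \<odot> ccomp F A B D t ((A, E) # s))"
    by (simp add: simps del: lift.simps)
  finally have eq: "(\<one> (fo G B D t) \<otimes>\<^sub>a ccomp G A E B s ?f)
        \<odot> (ccomp G A B D t ((A, E) # s) \<odot> lift ((A, E) # s @ t) A D) = \<dots>" .
  show ?case unfolding f append_Cons
    by (rule F.U.iso_cancel_left[OF _ _ _ _ _ eq])
      (auto simp: simps simp del: lift.simps intro!: F.tarr_Isos F.U.Isos_ide)
qed

text \<open>\<open>comp_of_col\<close> unrolls a collapse by its first arrow, where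
  \<open>T_comp\<close> applies; the empty path is the case of \<open>T_unit\<close>. In the
  construction of the lift, compatibility of \<open>T\<close> with composition and units enters only
  here.\<close>

lemma lift_col:
  assumes "chn X A s B"
  shows "T A B \<odot> fa F A B (col X A s) = fa G A B (col X A s) \<odot> lift s A B"
  using assms
proof (induction s arbitrary: A)
  case Nil
  then have X: "B \<in> X" and AB: "A = B" using chn_objs[OF Nil] by simp_all
  have ch: "chn X B [] B" using X by simp
  have "T B B \<odot> fa F B B (col X B []) = T B B \<odot> F.unit_of B \<odot> cunit F B"
    unfolding F.unit_of_col[OF X, symmetric] using X
    by (simp add: F.mon_simps T_simps F.unit_of_simps F.cunit_simps)
  also have "\<dots> = G.unit_of B \<odot> (cunit G B \<odot> lift [] B B)"
    unfolding cunit_lift[OF X] T_unit[OF X] ..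
  also have "\<dots> = fa G B B (col X B []) \<odot> lift [] B B"
    unfolding G.unit_of_col[OF X, symmetric] using X ch
    by (simp add: F.mon_simps lift_simps' G.unit_of_simps G.cunit_simps del: lift.simps)
  finally show ?case by (simp add: AB)
next
  case (Cons f s)
  obtain E where f: "f = (A, E)" using Cons.prems by (cases f) simp
  let ?f = "[(A, E)]"
  have X: "A \<in> X" "E \<in> X" "B \<in> X" and ch: "chn X E s B" "chn X A ?f E" "chn X A ((A, E) # s) B"
    using Cons.prems chn_objs[OF Cons.prems] by (simp_all add: f)
  note ty = X ch F.ccomp_simps[OF ch(2,1)] G.ccomp_simps[OF ch(2,1)]
    F.fo_closed[OF ch(1)] F.fo_closed[OF ch(2)] F.fo_closed[OF ch(3)]
    G.fo_closed[OF ch(1)] G.fo_closed[OF ch(2)] G.fo_closed[OF ch(3)]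
    T_simps[OF X(1,2)] T_simps[OF X(1,3)] T_simps[OF X(2,3)] lift_simps'[OF ch(1)] lift_simps'[OF ch(3)]
    F.fa_col_simps[OF ch(1)] G.fa_col_simps[OF ch(1)] F.comp_of_simps[OF X] G.comp_of_simps[OF X]
  note simps = F.mon_simps ty[simplified append.simps]
  have col: "fa F A B (col X A ((A, E) # s)) = F.comp_of A E B
      \<odot> ((fa F E B (col X E s) \<otimes>\<^sub>a \<one> (fo F A E ?f)) \<odot> ccomp F A E B s ?f)"
    "fa G A B (col X A ((A, E) # s)) = G.comp_of A E B
      \<odot> ((fa G E B (col X E s) \<otimes>\<^sub>a \<one> (fo G A E ?f)) \<odot> ccomp G A E B s ?f)"
    using F.comp_of_col[OF ch(2,1)] G.comp_of_col[OF ch(2,1)] X by (simp_all add: F.fa_single G.fa_single)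
  have "T A B \<odot> fa F A B (col X A ((A, E) # s)) = T A B \<odot> F.comp_of A E B
      \<odot> ((fa F E B (col X E s) \<otimes>\<^sub>a \<one> (fo F A E ?f)) \<odot> ccomp F A E B s ?f)"
    by (simp add: col simps)
  also have "\<dots> = G.comp_of A E B \<odot> (((T E B \<odot> fa F E B (col X E s)) \<otimes>\<^sub>a T A E) \<odot> ccomp F A E B s ?f)"
    unfolding T_comp[OF X] by (simp add: simps)
  also have "\<dots> = G.comp_of A E B \<odot> ((fa G E B (col X E s) \<otimes>\<^sub>a \<one> (fo G A E ?f))
      \<odot> ((lift s E B \<otimes>\<^sub>a T A E) \<odot> ccomp F A E B s ?f))"
    unfolding Cons.IH[OF ch(1)] by (simp add: simps)
  also have "\<dots> = fa G A B (col X A ((A, E) # s)) \<odot> lift ((A, E) # s) A B"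
    unfolding ccomp_lift_Cons[OF X(1) ch(1), symmetric] by (simp add: col simps del: lift.simps)
  finally show ?case unfolding f .
qed

text \<open>Composing with the structure 2-cell of \<open>G\<close> splits both sides into a factor
  for \<open>w\<close>, settled by the induction hypothesis, and a factor for the collapse, settled
  by \<open>lift_col\<close>.\<close>

lemma lift_natural:
  assumes "w \<in> cells X A B"
  shows "lift (snd (snd w)) A B \<odot> fa F A B w = fa G A B w \<odot> lift (fst w) A B"
  using assms
proof (induction rule: coarse.path_cells_induct)
  case (Nil A)
  then show ?case
    using lift_simps[of A "[]" A] by (simp add: path_id_ends F.fa_id G.fa_id F.mon_simps del: lift.simps)
next
  case (hcomp A B D w s)
  obtain t u t' where w: "w = (t, u, t')" by (cases w)
  have X: "A \<in> X" "B \<in> X" "D \<in> X" using chn_objs[OF hcomp.hyps(2)] cell_objs[OF hcomp.hyps(1)] by simp_all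
  let ?f = "[(A, B)]" and ?c = "col X A s"
  let ?x = "path_hcomp w ?c"
  have ch: "chn X A s B" "chn X A ?f B" "chn X B t D" "chn X B t' D"
    using hcomp.hyps X coarse.path_cell_chains[OF hcomp.hyps(1)] by (simp_all add: w)
  have ch2: "chn X A (s @ t) D" "chn X A (?f @ t') D"
    by (rule coarse.chain_append[OF ch(1,3)], rule coarse.chain_append[OF ch(2,4)])
  note c = coarse.collapse_closed[OF ch(1)]
  have x: "?x \<in> cells X A D" using hcomp.hyps(1) c by (rule coarse.path_hcomp_closed)
  have ends: "fst w = t" "snd (snd w) = t'" "fst ?c = s" "snd (snd ?c) = ?f" "fst ?x = s @ t" "snd (snd ?x) = ?f @ t'"
    by (simp_all add: w fst_col snd_col[OF ch(1)] path_hcomp_ends)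
  note ty = X ch ch2 F.fa_simps[OF hcomp.hyps(1), unfolded ends] G.fa_simps[OF hcomp.hyps(1), unfolded ends]
    F.fa_col_simps[OF ch(1)] G.fa_col_simps[OF ch(1)]
    F.fa_simps[OF x, unfolded ends] G.fa_simps[OF x, unfolded ends]
    lift_simps'[OF ch(1)] lift_simps'[OF ch(3)] lift_simps'[OF ch(4)] lift_simps'[OF ch2(1)] lift_simps'[OF ch2(2)]
    T_simps[OF X(1,2)] F.ccomp_simps[OF ch(1,3)] G.ccomp_simps[OF ch(1,3)] F.ccomp_simps[OF ch(2,4)] G.ccomp_simps[OF ch(2,4)]
  have nat: "ccomp F A B D t' ?f \<odot> fa F A D ?x = (fa F B D w \<otimes>\<^sub>a fa F A B ?c) \<odot> ccomp F A B D t s"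
    "ccomp G A B D t' ?f \<odot> fa G A D ?x = (fa G B D w \<otimes>\<^sub>a fa G A B ?c) \<odot> ccomp G A B D t s"
    using F.ccomp_nat[OF hcomp.hyps(1) c] G.ccomp_nat[OF hcomp.hyps(1) c] unfolding ends .
  have "ccomp G A B D t' ?f \<odot> (lift (?f @ t') A D \<odot> fa F A D ?x)
      = (ccomp G A B D t' ?f \<odot> lift (?f @ t') A D) \<odot> fa F A D ?x"
    using ty by (simp add: F.mon_simps del: lift.simps append.simps)
  also have "\<dots> = (lift t' B D \<otimes>\<^sub>a T A B) \<odot> (ccomp F A B D t' ?f \<odot> fa F A D ?x)"
    unfolding ccomp_lift[OF ch(2,4)] lift_single[OF X(1,2)]
    using ty by (simp add: F.mon_simps del: lift.simps append.simps)
  also have "\<dots> = ((lift t' B D \<odot> fa F B D w) \<otimes>\<^sub>a (T A B \<odot> fa F A B ?c)) \<odot> ccomp F A B D t s"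
    unfolding nat using ty by (simp add: F.mon_simps del: lift.simps append.simps)
  also have "\<dots> = (fa G B D w \<otimes>\<^sub>a fa G A B ?c) \<odot> ((lift t B D \<otimes>\<^sub>a lift s A B) \<odot> ccomp F A B D t s)"
    unfolding lift_col[OF ch(1)] hcomp.IH[unfolded ends]
    using ty by (simp add: F.mon_simps del: lift.simps append.simps)
  also have "\<dots> = ((fa G B D w \<otimes>\<^sub>a fa G A B ?c) \<odot> ccomp G A B D t s) \<odot> lift (s @ t) A D"
    unfolding ccomp_lift[OF ch(1,3), symmetric]
    using ty by (simp add: F.mon_simps del: lift.simps append.simps)
  also have "\<dots> = ccomp G A B D t' ?f \<odot> (fa G A D ?x \<odot> lift (s @ t) A D)"
    unfolding nat(2)[symmetric]
    using ty by (simp add: F.mon_simps del: lift.simps append.simps)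
  finally have eq: "ccomp G A B D t' ?f \<odot> (lift (?f @ t') A D \<odot> fa F A D ?x) = \<dots>" .
  show ?case unfolding ends
    by (rule F.U.iso_cancel_left[OF _ _ _ _ _ eq])
      (use ty in \<open>simp_all add: F.mon_simps del: lift.simps append.simps\<close>)
qed

definition lift_map :: "'x \<Rightarrow> 'x \<Rightarrow> ('x \<times> 'x) list \<Rightarrow> 'a" where
  "lift_map A B s = (if chn X A s B then lift s A B else undefined)"

lemma point_map_lift_map: "point_map M X F G lift_map"
proof (intro point_map.intro point_map_axioms.intro F.coarse_point_axioms G.coarse_point_axioms)
  fix A B w assume w: "w \<in> cells X A B"
  then show "lift_map A B (snd (snd w)) \<odot> fa F A B w = fa G A B w \<odot> lift_map A B (fst w)"
    using lift_natural[OF w] coarse.path_cell_chains[OF w] by (simp add: lift_map_def)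
next
  fix A B D s t assume st: "chn X A s B" "chn X B t D"
  then show "ccomp G A B D t s \<odot> lift_map A D (s @ t) = (lift_map B D t \<otimes>\<^sub>a lift_map A B s) \<odot> ccomp F A B D t s"
    using ccomp_lift[OF st] coarse.chain_append[OF st] by (simp add: lift_map_def)
qed (simp_all add: lift_map_def F.U.in_Hom_iff lift_simps' cunit_lift del: lift.simps)

lemma enriched_map_lift_map: "point_map.enriched_map X lift_map = T"
proof -
  interpret P: point_map M X F G lift_map by (rule point_map_lift_map)
  show ?thesis
    by (intro ext) (simp add: P.enriched_map_def lift_map_def lift_single efun_ext del: lift.simps)
qed

end

section \<open>The point of an enriched category\<close>

context enriched_category
begin

lemma ehom_simps:
  assumes "A \<in> X" "B \<in> X"
  shows "ehom E A B \<in> Obj (mcat M)"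
  using ehom_closed assms .

lemma ecomp_simps:
  assumes "A \<in> X" "B \<in> X" "D \<in> X"
  shows "ecomp E A B D \<in> Arr (mcat M)"
    "Dom (mcat M) (ecomp E A B D) = ehom E B D \<otimes>\<^sub>o ehom E A B"
    "Cod (mcat M) (ecomp E A B D) = ehom E A D"
  using ecomp_closed[OF assms] by (auto simp: U.in_Hom_iff)

lemma eunit_simps:
  assumes "A \<in> X"
  shows "eunit E A \<in> Arr (mcat M)" "Dom (mcat M) (eunit E A) = \<I>"
    "Cod (mcat M) (eunit E A) = ehom E A A"
  using eunit_closed[OF assms] by (auto simp: U.in_Hom_iff)

text \<open>Later arrows stand further left, in the order of composition, and brackets accumulate on
  the left. Since the recursion ends in \<I>, the path \<open>[(A, B)]\<close> is sent to
  \<open>\<I> \<otimes>\<^sub>o ehom E A B\<close>; this is where the \<ll> in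
  \<open>path_mult_single\<close> and \<open>counit\<close> comes from.\<close>

primrec path_obj :: "('x \<times> 'x) list \<Rightarrow> 'o" where
  "path_obj [] = \<I>"
| "path_obj (f # s) = path_obj s \<otimes>\<^sub>o ehom E (fst f) (snd f)"

text \<open>Rebrackets \<open>path_obj (s @ t)\<close> as
  \<open>path_obj t \<otimes>\<^sub>o path_obj s\<close>, where \<open>s\<close> is the second
  argument. Recursion on \<open>s\<close> follows the recursion of \<open>path_obj\<close> on
  \<open>s @ t\<close>.\<close>

primrec path_assoc :: "('x \<times> 'x) list \<Rightarrow> ('x \<times> 'x) list \<Rightarrow> 'a" where
  "path_assoc t [] = cinv (mcat M) (\<rr> (path_obj t))"
| "path_assoc t (f # s) = \<alpha> (path_obj t) (path_obj s) (ehom E (fst f) (snd f))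
     \<odot> (path_assoc t s \<otimes>\<^sub>a \<one> (ehom E (fst f) (snd f)))"

primrec path_mult :: "('x \<times> 'x) list \<Rightarrow> 'x \<Rightarrow> 'x \<Rightarrow> 'a" where
  "path_mult [] A B = eunit E A"
| "path_mult (f # s) A B = ecomp E A (snd f) B \<odot> (path_mult s (snd f) B \<otimes>\<^sub>a \<one> (ehom E A (snd f)))"

text \<open>The block of the source over the first arrow of the target is multiplied out, and the rest of
  the 2-cell is treated recursively.\<close>

primrec act :: "('x \<times> 'x) list \<Rightarrow> ('x \<times> 'x) list \<Rightarrow> (nat \<Rightarrow> nat) \<Rightarrow> 'a" where
  "act [] s u = \<one> \<I>"
| "act (g # t) s u = (let k = length (fibre s u 0) in
     (act t (drop k s) (restrict (\<lambda>i. u (k + i) - 1) {..<length s - k})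
       \<otimes>\<^sub>a path_mult (take k s) (fst g) (snd g)) \<odot> path_assoc (drop k s) (take k s))"

definition cell_act :: "('x \<times> 'x) path_cell \<Rightarrow> 'a" where
  "cell_act w = act (snd (snd w)) (fst w) (fst (snd w))"

section \<open>Coherence of rebracketing and functoriality of the action\<close>

lemma path_obj_closed: "chn X A s B \<Longrightarrow> path_obj s \<in> Obj (mcat M)"
  by (induction s arbitrary: A) (auto simp: mon_simps ehom_simps)

lemma path_assoc_simps:
  assumes "chn X A s B" "chn X B t D"
  shows "path_assoc t s \<in> Isos (mcat M) \<and> path_assoc t s \<in> Arr (mcat M)
    \<and> Dom (mcat M) (path_assoc t s) = path_obj (s @ t)
    \<and> Cod (mcat M) (path_assoc t s) = path_obj t \<otimes>\<^sub>o path_obj s"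
  using assms(1)
proof (induction s arbitrary: A)
  case Nil
  then show ?case
    using path_obj_closed[OF assms(2)] by (simp add: mon_simps U.cinv_simps U.Isos_cinv)
next
  case (Cons f s)
  obtain F where f: "f = (A, F)" using Cons.prems by (cases f) simp
  have ch: "A \<in> X" "F \<in> X" "chn X F s B" using Cons.prems by (simp_all add: f)
  show ?case
    using Cons.IH[OF ch(3)] path_obj_closed[OF ch(3)] path_obj_closed[OF assms(2)] ch
    by (auto simp: f mon_simps ehom_simps intro!: U.Isos_comp tarr_Isos U.Isos_ide)
qed

lemma path_mult_simps:
  assumes "chn X A s B"
  shows "path_mult s A B \<in> Arr (mcat M) \<and> Dom (mcat M) (path_mult s A B) = path_obj s
    \<and> Cod (mcat M) (path_mult s A B) = ehom E A B"
  using assms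
proof (induction s arbitrary: A)
  case Nil
  then show ?case by (auto simp: eunit_simps)
next
  case (Cons f s)
  obtain F where f: "f = (A, F)" using Cons.prems by (cases f) simp
  have ch: "A \<in> X" "F \<in> X" "chn X F s B" "B \<in> X"
    using Cons.prems chn_objs[OF Cons.prems] by (simp_all add: f)
  show ?case
    using Cons.IH[OF ch(3)] ch by (simp add: f mon_simps ehom_simps ecomp_simps)
qed

lemma cell_act_Nil: "cell_act (path_id []) = \<one> \<I>"
  by (simp add: cell_act_def path_id_def)

text \<open>The fibre over the new first arrow is exactly \<open>s\<close>, so the recursion of
  \<open>act\<close> cuts where the ordinal sum was glued. With \<open>cell_act_Nil\<close> this
  matches \<open>path_cells_induct\<close>, and later proofs never unfold
  \<open>act\<close>.\<close>

lemma cell_act_hcomp: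
  assumes "w \<in> cells X B D" "chn X A s B"
  shows "cell_act (path_hcomp w (col X A s)) = (cell_act w \<otimes>\<^sub>a path_mult s A B) \<odot> path_assoc (fst w) s"
proof -
  obtain t v t' where w: "w = (t, v, t')" by (cases w)
  define x where "x = restrict (\<lambda>i. if i < length s then restrict (\<lambda>_. 0) {..<length s} i
      else 1 + v (i - length s)) {..<length s + length t}"
  have v: "v \<in> {..<length t} \<rightarrow>\<^sub>E {..<length t'}"
    using assms(1) by (auto simp: w path_cells_def)
  have "fibre (s @ t) x 0 = fibre s (restrict (\<lambda>_. 0) {..<length s}) 0"
    unfolding x_def by (subst fibre_hcomp[where m = 1]) auto
  also have "\<dots> = s" by (rule fibre_const)
  finally have k: "length (fibre (s @ t) x 0) = length s" by simp
  \<comment> \<open>The \<open>- 1\<close> undoes the shift by the one arrow in the target of the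
    collapse; outside the range both sides are \<open>undefined\<close>.\<close>
  have "restrict (\<lambda>i. x (length s + i) - 1) {..<length t} i = v i" for i
    using PiE_arb[OF v, of i] by (cases "i < length t") (simp_all add: x_def)
  then have r: "restrict (\<lambda>i. x (length s + i) - 1) {..<length t} = v" by blast
  have "path_hcomp w (col X A s) = (s @ t, x, (A, B) # t')"
    by (simp add: w x_def collapse_coarse[OF assms(2)] cong: if_cong)
  then show ?thesis
    by (simp add: cell_act_def w k r[unfolded One_nat_def])
qed

lemma cell_act_simps:
  assumes "w \<in> cells X A D"
  shows "cell_act w \<in> Arr (mcat M) \<and> Dom (mcat M) (cell_act w) = path_obj (fst w)
    \<and> Cod (mcat M) (cell_act w) = path_obj (snd (snd w))"
  using assms
proof (induction rule: coarse.path_cells_induct)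
  case (Nil A)
  show ?case unfolding cell_act_Nil by (simp add: path_id_def mon_simps)
next
  case (hcomp A B D w s)
  have ch: "chn X B (fst w) D" using coarse.path_cell_chains[OF hcomp.hyps(1)] by simp
  show ?case
    unfolding cell_act_hcomp[OF hcomp.hyps]
    using hcomp.IH path_assoc_simps[OF hcomp.hyps(2) ch] path_mult_simps[OF hcomp.hyps(2)]
    by (simp add: mon_simps path_hcomp_ends fst_col snd_col[OF hcomp.hyps(2)])
qed

text \<open>One more arrow in \<open>f\<close> is a pentagon together with two naturality squares of
  \<alpha>; the empty path needs \<open>mrunit_tensor\<close>.\<close>

lemma path_assoc_coassoc:
  assumes "chn X A f B" "chn X B g D" "chn X D h H"
  shows "\<alpha> (path_obj h) (path_obj g) (path_obj f)
      \<odot> ((path_assoc h g \<otimes>\<^sub>a \<one> (path_obj f)) \<odot> path_assoc (g @ h) f)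
    = (\<one> (path_obj h) \<otimes>\<^sub>a path_assoc g f) \<odot> path_assoc h (f @ g)"
  using assms(1)
proof (induction f arbitrary: A)
  case Nil
  have gh: "chn X B (g @ h) H" using assms(2,3) by (rule coarse.chain_append)
  note ty = path_obj_closed[OF assms(2)] path_obj_closed[OF assms(3)] path_obj_closed[OF gh]
    path_assoc_simps[OF assms(2,3)]
  let ?G = "path_obj g" and ?H = "path_obj h"
  \<comment> \<open>The factor \<rr> removes the inverse that \<open>path_assoc g []\<close>
    introduces; both sides become \<open>path_assoc h g\<close>.\<close>
  have "(\<one> ?H \<otimes>\<^sub>a \<rr> ?G) \<odot> (\<alpha> ?H ?G \<I> \<odot> ((path_assoc h g \<otimes>\<^sub>a \<one> \<I>) \<odot> cinv (mcat M) (\<rr> (path_obj (g @ h)))))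
      = ((\<one> ?H \<otimes>\<^sub>a \<rr> ?G) \<odot> \<alpha> ?H ?G \<I>) \<odot> ((path_assoc h g \<otimes>\<^sub>a \<one> \<I>) \<odot> cinv (mcat M) (\<rr> (path_obj (g @ h))))"
    using ty by (simp add: mon_simps U.cinv_simps)
  also have "\<dots> = (\<rr> (?H \<otimes>\<^sub>o ?G) \<odot> (path_assoc h g \<otimes>\<^sub>a \<one> \<I>)) \<odot> cinv (mcat M) (\<rr> (path_obj (g @ h)))"
    using ty by (simp add: mrunit_tensor mon_simps U.cinv_simps)
  also have "\<dots> = path_assoc h g"
    using ty by (subst mrunit_nat) (simp_all add: mon_simps U.cinv_simps)
  also have "\<dots> = (\<one> ?H \<otimes>\<^sub>a \<rr> ?G) \<odot> ((\<one> ?H \<otimes>\<^sub>a cinv (mcat M) (\<rr> ?G)) \<odot> path_assoc h g)"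
    using ty by (simp add: mon_simps U.cinv_simps)
  finally have eq: "(\<one> ?H \<otimes>\<^sub>a \<rr> ?G) \<odot> (\<alpha> ?H ?G \<I> \<odot> ((path_assoc h g \<otimes>\<^sub>a \<one> \<I>)
      \<odot> cinv (mcat M) (\<rr> (path_obj (g @ h))))) = \<dots>" .
  show ?case
    unfolding path_obj.simps path_assoc.simps append_Nil
    by (rule U.iso_cancel_left[OF _ _ _ _ _ eq])
      (use ty in \<open>simp_all add: mon_simps U.cinv_simps tarr_Isos U.Isos_ide\<close>)
next
  case (Cons x s)
  obtain F where x: "x = (A, F)" using Cons.prems by (cases x) simp
  have ch: "A \<in> X" "F \<in> X" "chn X F s B" using Cons.prems by (simp_all add: x)
  have ch2: "chn X B (g @ h) H" "chn X F (s @ g) D" "chn X F (s @ g @ h) H"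
    using assms(2,3) ch(3) by (auto simp: coarse.chain_append_iff)
  let ?G = "path_obj g" and ?H = "path_obj h" and ?S = "path_obj s" and ?e = "ehom E A F"
  note ty = ch(1,2) path_obj_closed[OF assms(2)] path_obj_closed[OF assms(3)] path_obj_closed[OF ch(3)]
    path_obj_closed[OF ch2(1)] path_obj_closed[OF ch2(2)] path_obj_closed[OF ch2(3)]
    path_assoc_simps[OF assms(2,3)] path_assoc_simps[OF ch(3) ch2(1)] path_assoc_simps[OF ch(3) assms(2)]
    path_assoc_simps[OF ch2(2) assms(3)] ehom_simps[OF ch(1,2)]
  have "\<alpha> ?H ?G (?S \<otimes>\<^sub>o ?e) \<odot> ((path_assoc h g \<otimes>\<^sub>a \<one> (?S \<otimes>\<^sub>o ?e))
        \<odot> (\<alpha> (path_obj (g @ h)) ?S ?e \<odot> (path_assoc (g @ h) s \<otimes>\<^sub>a \<one> ?e)))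
      = \<alpha> ?H ?G (?S \<otimes>\<^sub>o ?e) \<odot> (((path_assoc h g \<otimes>\<^sub>a (\<one> ?S \<otimes>\<^sub>a \<one> ?e))
        \<odot> \<alpha> (path_obj (g @ h)) ?S ?e) \<odot> (path_assoc (g @ h) s \<otimes>\<^sub>a \<one> ?e))"
    using ty by (simp add: mon_simps)
  also have "(path_assoc h g \<otimes>\<^sub>a (\<one> ?S \<otimes>\<^sub>a \<one> ?e)) \<odot> \<alpha> (path_obj (g @ h)) ?S ?e
      = \<alpha> (?H \<otimes>\<^sub>o ?G) ?S ?e \<odot> ((path_assoc h g \<otimes>\<^sub>a \<one> ?S) \<otimes>\<^sub>a \<one> ?e)"
    using ty by (subst massoc_nat) (simp_all add: mon_simps)
  also have "\<alpha> ?H ?G (?S \<otimes>\<^sub>o ?e) \<odot> (\<alpha> (?H \<otimes>\<^sub>o ?G) ?S ?e \<odot> ((path_assoc h g \<otimes>\<^sub>a \<one> ?S) \<otimes>\<^sub>a \<one> ?e)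
        \<odot> (path_assoc (g @ h) s \<otimes>\<^sub>a \<one> ?e))
      = (\<alpha> ?H ?G (?S \<otimes>\<^sub>o ?e) \<odot> \<alpha> (?H \<otimes>\<^sub>o ?G) ?S ?e)
        \<odot> (((path_assoc h g \<otimes>\<^sub>a \<one> ?S) \<odot> path_assoc (g @ h) s) \<otimes>\<^sub>a \<one> ?e)"
    using ty by (simp add: mon_simps)
  also have "\<dots> = (\<one> ?H \<otimes>\<^sub>a \<alpha> ?G ?S ?e) \<odot> (\<alpha> ?H (?G \<otimes>\<^sub>o ?S) ?e
        \<odot> ((\<alpha> ?H ?G ?S \<odot> ((path_assoc h g \<otimes>\<^sub>a \<one> ?S) \<odot> path_assoc (g @ h) s)) \<otimes>\<^sub>a \<one> ?e))"
    using ty by (subst mpentagon) (simp_all add: mon_simps)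
  also have "\<dots> = (\<one> ?H \<otimes>\<^sub>a \<alpha> ?G ?S ?e) \<odot> ((\<alpha> ?H (?G \<otimes>\<^sub>o ?S) ?e
        \<odot> ((\<one> ?H \<otimes>\<^sub>a path_assoc g s) \<otimes>\<^sub>a \<one> ?e)) \<odot> (path_assoc h (s @ g) \<otimes>\<^sub>a \<one> ?e))"
    unfolding Cons.IH[OF ch(3)] using ty by (simp add: mon_simps)
  also have "\<dots> = (\<one> ?H \<otimes>\<^sub>a \<alpha> ?G ?S ?e) \<odot> (((\<one> ?H \<otimes>\<^sub>a (path_assoc g s \<otimes>\<^sub>a \<one> ?e))
        \<odot> \<alpha> ?H (path_obj (s @ g)) ?e) \<odot> (path_assoc h (s @ g) \<otimes>\<^sub>a \<one> ?e))"
    using ty by (subst massoc_nat) (simp_all add: mon_simps)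
  also have "\<dots> = (\<one> ?H \<otimes>\<^sub>a (\<alpha> ?G ?S ?e \<odot> (path_assoc g s \<otimes>\<^sub>a \<one> ?e)))
        \<odot> (\<alpha> ?H (path_obj (s @ g)) ?e \<odot> (path_assoc h (s @ g) \<otimes>\<^sub>a \<one> ?e))"
    using ty by (simp add: mon_simps)
  finally show ?case by (simp add: x)
qed

text \<open>Each arrow is absorbed by \<open>mlunit_tensor\<close>, and the empty path is
  \<open>mlunit_munit\<close>. The right counit law takes no induction, as
  \<open>path_assoc t []\<close> is by definition inverse to \<rr>.\<close>

lemma path_assoc_counit_left:
  assumes "chn X A s B"
  shows "\<ll> (path_obj s) \<odot> path_assoc [] s = \<one> (path_obj s)"
  using assms
proof (induction s arbitrary: A)
  case Nil
  then show ?case by (simp add: mlunit_munit mon_simps U.cinv_simps)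
next
  case (Cons f s)
  obtain F where f: "f = (A, F)" using Cons.prems by (cases f) simp
  have ch: "A \<in> X" "F \<in> X" "chn X F s B" "chn X B [] B"
    using Cons.prems chn_objs[OF Cons.prems] by (simp_all add: f)
  note ty = ch path_obj_closed[OF ch(3)] path_assoc_simps[OF ch(3,4)] ehom_simps[OF ch(1,2)]
  have "\<ll> (path_obj s \<otimes>\<^sub>o ehom E A F) \<odot> (\<alpha> \<I> (path_obj s) (ehom E A F) \<odot> (path_assoc [] s \<otimes>\<^sub>a \<one> (ehom E A F)))
      = (\<ll> (path_obj s \<otimes>\<^sub>o ehom E A F) \<odot> \<alpha> \<I> (path_obj s) (ehom E A F)) \<odot> (path_assoc [] s \<otimes>\<^sub>a \<one> (ehom E A F))"
    using ty by (simp add: mon_simps)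
  also have "\<dots> = (\<ll> (path_obj s) \<odot> path_assoc [] s) \<otimes>\<^sub>a \<one> (ehom E A F)"
    using ty by (simp add: mlunit_tensor mon_simps)
  also have "\<dots> = \<one> (path_obj s \<otimes>\<^sub>o ehom E A F)"
    unfolding Cons.IH[OF ch(3)] using ty by (simp add: mon_simps)
  finally show ?case by (simp add: f)
qed

text \<open>Generalised associativity: each arrow of \<open>s\<close> costs one use of
  \<open>ecomp_assoc\<close>, and the unit in which \<open>path_mult s\<close> ends is absorbed by
  \<open>ecomp_runit\<close>.\<close>

lemma path_mult_append:
  assumes "chn X A s B" "chn X B t D"
  shows "path_mult (s @ t) A D
    = ecomp E A B D \<odot> ((path_mult t B D \<otimes>\<^sub>a path_mult s A B) \<odot> path_assoc t s)"
  using assms(1)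
proof (induction s arbitrary: A)
  case Nil
  then have X: "B \<in> X" "D \<in> X" and AB: "A = B" using chn_objs[OF Nil] chn_objs[OF assms(2)] by simp_all
  note ty = X path_obj_closed[OF assms(2)] path_mult_simps[OF assms(2)] ehom_simps[OF X] eunit_simps[OF X(1)]
    ecomp_simps[OF X(1) X]
  have "ecomp E B B D \<odot> ((path_mult t B D \<otimes>\<^sub>a eunit E B) \<odot> cinv (mcat M) (\<rr> (path_obj t)))
      = (ecomp E B B D \<odot> (\<one> (ehom E B D) \<otimes>\<^sub>a eunit E B)) \<odot> ((path_mult t B D \<otimes>\<^sub>a \<one> \<I>) \<odot> cinv (mcat M) (\<rr> (path_obj t)))"
    using ty ehom_simps[OF X(1) X(1)] by (simp add: mon_simps U.cinv_simps)
  also have "\<dots> = (\<rr> (ehom E B D) \<odot> (path_mult t B D \<otimes>\<^sub>a \<one> \<I>)) \<odot> cinv (mcat M) (\<rr> (path_obj t))"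
    unfolding ecomp_runit[OF X] using ty by (simp add: mon_simps U.cinv_simps)
  also have "\<dots> = path_mult t B D"
    using ty by (subst mrunit_nat) (simp_all add: mon_simps U.cinv_simps)
  finally show ?case by (simp add: AB)
next
  case (Cons f s)
  obtain F where f: "f = (A, F)" using Cons.prems by (cases f) simp
  have X: "A \<in> X" "F \<in> X" "B \<in> X" "D \<in> X" and ch: "chn X F s B"
    using Cons.prems chn_objs[OF Cons.prems] chn_objs[OF assms(2)] by (simp_all add: f)
  let ?e = "ehom E A F"
  note ty = X path_obj_closed[OF ch] path_obj_closed[OF assms(2)] path_mult_simps[OF ch] path_mult_simps[OF assms(2)]
    path_assoc_simps[OF ch assms(2)] ehom_simps ecomp_simps
  have "ecomp E A F D \<odot> (path_mult (s @ t) F D \<otimes>\<^sub>a \<one> ?e)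
      = (ecomp E A F D \<odot> (ecomp E F B D \<otimes>\<^sub>a \<one> ?e))
        \<odot> (((path_mult t B D \<otimes>\<^sub>a path_mult s F B) \<otimes>\<^sub>a \<one> ?e) \<odot> (path_assoc t s \<otimes>\<^sub>a \<one> ?e))"
    unfolding Cons.IH[OF ch] using ty by (simp add: mon_simps)
  also have "\<dots> = ecomp E A B D \<odot> ((\<one> (ehom E B D) \<otimes>\<^sub>a ecomp E A F B)
        \<odot> ((\<alpha> (ehom E B D) (ehom E F B) ?e \<odot> ((path_mult t B D \<otimes>\<^sub>a path_mult s F B) \<otimes>\<^sub>a \<one> ?e))
          \<odot> (path_assoc t s \<otimes>\<^sub>a \<one> ?e)))"
    unfolding ecomp_assoc[OF X] using ty by (simp add: mon_simps)
  also have "\<dots> = ecomp E A B D \<odot> ((\<one> (ehom E B D) \<otimes>\<^sub>a ecomp E A F B)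
        \<odot> (((path_mult t B D \<otimes>\<^sub>a (path_mult s F B \<otimes>\<^sub>a \<one> ?e)) \<odot> \<alpha> (path_obj t) (path_obj s) ?e)
          \<odot> (path_assoc t s \<otimes>\<^sub>a \<one> ?e)))"
    using ty by (subst massoc_nat) (simp_all add: mon_simps)
  also have "\<dots> = ecomp E A B D \<odot> ((path_mult t B D \<otimes>\<^sub>a (ecomp E A F B \<odot> (path_mult s F B \<otimes>\<^sub>a \<one> ?e)))
        \<odot> (\<alpha> (path_obj t) (path_obj s) ?e \<odot> (path_assoc t s \<otimes>\<^sub>a \<one> ?e)))"
    using ty by (simp add: mon_simps)
  finally show ?case by (simp add: f)
qed

lemma path_mult_single:
  assumes "A \<in> X" "B \<in> X"
  shows "path_mult [(A, B)] A B = \<ll> (ehom E A B)"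
  using ecomp_lunit[OF assms] by simp

text \<open>An identity 2-cell is an ordinal sum of collapses of single arrows. Each contributes
  \<ll> from \<open>path_mult_single\<close> and an inverse of \<rr> from \<open>path_assoc\<close>,
  which the triangle cancels.\<close>

lemma cell_act_id:
  assumes "chn X A s B"
  shows "cell_act (path_id s) = \<one> (path_obj s)"
  using assms
proof (induction s arbitrary: A)
  case Nil
  then show ?case by (simp add: cell_act_Nil)
next
  case (Cons f s)
  obtain F where f: "f = (A, F)" using Cons.prems by (cases f) simp
  have ch: "A \<in> X" "F \<in> X" "chn X F s B" "chn X A [(A, F)] F"
    using Cons.prems by (simp_all add: f)
  let ?e = "ehom E A F"
  note ty = path_obj_closed[OF ch(3)] ehom_simps[OF ch(1,2)]
  have "path_id (f # s) = path_hcomp (path_id s) (col X A [(A, F)])"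
    by (simp add: col_single ch path_hcomp_id f)
  then have "cell_act (path_id (f # s)) = (\<one> (path_obj s) \<otimes>\<^sub>a \<ll> ?e)
      \<odot> (\<alpha> (path_obj s) \<I> ?e \<odot> (cinv (mcat M) (\<rr> (path_obj s)) \<otimes>\<^sub>a \<one> ?e))"
    using cell_act_hcomp[OF coarse.path_id_mem[OF ch(3)] ch(4)] path_mult_single[OF ch(1,2)]
    by (simp add: Cons.IH[OF ch(3)] path_id_ends)
  also have "\<dots> = ((\<one> (path_obj s) \<otimes>\<^sub>a \<ll> ?e) \<odot> \<alpha> (path_obj s) \<I> ?e) \<odot> (cinv (mcat M) (\<rr> (path_obj s)) \<otimes>\<^sub>a \<one> ?e)"
    using ty by (simp add: mon_simps U.cinv_simps)
  also have "\<dots> = \<one> (path_obj s \<otimes>\<^sub>o ?e)"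
    using ty by (subst mtriangle) (simp_all add: mon_simps U.cinv_simps)
  finally show ?case by (simp add: f)
qed

text \<open>Induction over \<open>z\<close>, the part travelled first, because blocks are peeled off
  at the start; by \<open>path_hcomp_assoc\<close> the first block of \<open>z\<close> is also the
  first block of the whole. What remains is \<open>path_assoc_coassoc\<close>.\<close>

lemma cell_act_natural:
  assumes "z \<in> cells X A B" "w \<in> cells X B D"
  shows "path_assoc (snd (snd w)) (snd (snd z)) \<odot> cell_act (path_hcomp w z)
    = (cell_act w \<otimes>\<^sub>a cell_act z) \<odot> path_assoc (fst w) (fst z)"
  using assms
proof (induction rule: coarse.path_cells_induct)
  case (Nil A)
  note ch = coarse.path_cell_chains[OF Nil(2)]
  let ?a = "fst w" and ?b = "snd (snd w)"
  note ty = path_obj_closed[OF conjunct1[OF ch]] path_obj_closed[OF conjunct2[OF ch]] cell_act_simps[OF Nil(2)]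
  have "\<rr> (path_obj ?b) \<odot> (cinv (mcat M) (\<rr> (path_obj ?b)) \<odot> cell_act w) = cell_act w"
    using ty by (simp add: mon_simps U.cinv_cancel)
  also have "\<dots> = (cell_act w \<odot> \<rr> (path_obj ?a)) \<odot> cinv (mcat M) (\<rr> (path_obj ?a))"
    using ty by (simp add: mon_simps U.cinv_simps)
  also have "cell_act w \<odot> \<rr> (path_obj ?a) = \<rr> (path_obj ?b) \<odot> (cell_act w \<otimes>\<^sub>a \<one> \<I>)"
    using ty by (subst mrunit_nat) simp_all
  also have "\<dots> \<odot> cinv (mcat M) (\<rr> (path_obj ?a))
      = \<rr> (path_obj ?b) \<odot> ((cell_act w \<otimes>\<^sub>a \<one> \<I>) \<odot> cinv (mcat M) (\<rr> (path_obj ?a)))"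
    using ty by (simp add: mon_simps U.cinv_simps)
  finally have eq: "\<rr> (path_obj ?b) \<odot> (cinv (mcat M) (\<rr> (path_obj ?b)) \<odot> cell_act w) = \<dots>" .
  have "cinv (mcat M) (\<rr> (path_obj ?b)) \<odot> cell_act w
      = (cell_act w \<otimes>\<^sub>a \<one> \<I>) \<odot> cinv (mcat M) (\<rr> (path_obj ?a))"
    by (rule U.iso_cancel_left[OF _ _ _ _ _ eq]) (use ty in \<open>simp_all add: mon_simps U.cinv_simps\<close>)
  then show ?case
    by (simp add: path_hcomp_id_Nil[OF Nil(2)] path_id_ends cell_act_Nil)
next
  case (hcomp A B' B z s)
  obtain a u b where z: "z = (a, u, b)" by (cases z)
  obtain c v d where w: "w = (c, v, d)" by (cases w)
  have X: "A \<in> X" "B' \<in> X" using chn_objs[OF hcomp.hyps(2)] by simp_all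
  have ch: "chn X B' a B" "chn X B' b B" "chn X B c D" "chn X B d D"
    using coarse.path_cell_chains[OF hcomp.hyps(1)] coarse.path_cell_chains[OF hcomp.prems]
    by (simp_all add: z w)
  have ch2: "chn X B' (a @ c) D" by (rule coarse.chain_append[OF ch(1,3)])
  have wz: "path_hcomp w z \<in> cells X B' D"
    by (rule coarse.path_hcomp_closed[OF hcomp.prems hcomp.hyps(1)])
  have ends: "fst w = c" "snd (snd w) = d" "fst z = a" "snd (snd z) = b"
    "fst (path_hcomp w z) = a @ c" "snd (snd (path_hcomp w z)) = b @ d"
    by (simp_all add: z w)
  have sa: "chn X A (s @ a) B" by (rule coarse.chain_append[OF hcomp.hyps(2) ch(1)])
  let ?e = "ehom E A B'"
  note ty = ehom_simps[OF X] path_obj_closed[OF ch(1)] path_obj_closed[OF ch(2)] path_obj_closed[OF ch(3)]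
    path_obj_closed[OF ch(4)] path_obj_closed[OF hcomp.hyps(2)] path_obj_closed[OF ch2]
    cell_act_simps[OF hcomp.hyps(1), unfolded ends] cell_act_simps[OF hcomp.prems, unfolded ends]
    cell_act_simps[OF wz, unfolded ends] path_mult_simps[OF hcomp.hyps(2)]
    path_assoc_simps[OF ch(1,3)] path_assoc_simps[OF ch(2,4)] path_assoc_simps[OF hcomp.hyps(2) ch(1)]
    path_assoc_simps[OF hcomp.hyps(2) ch2] path_assoc_simps[OF sa ch(3), simplified]
  have "path_assoc d ((A, B') # b) \<odot> cell_act (path_hcomp w (path_hcomp z (col X A s)))
      = (\<alpha> (path_obj d) (path_obj b) ?e \<odot> (path_assoc d b \<otimes>\<^sub>a \<one> ?e))
        \<odot> ((cell_act (path_hcomp w z) \<otimes>\<^sub>a path_mult s A B') \<odot> path_assoc (a @ c) s)"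
    by (simp add: path_hcomp_assoc[symmetric] cell_act_hcomp[OF wz hcomp.hyps(2)] ends del: path_hcomp.simps)
  also have "\<dots> = \<alpha> (path_obj d) (path_obj b) ?e
      \<odot> (((path_assoc d b \<odot> cell_act (path_hcomp w z)) \<otimes>\<^sub>a path_mult s A B') \<odot> path_assoc (a @ c) s)"
    using ty by (simp add: mon_simps)
  also have "\<dots> = (\<alpha> (path_obj d) (path_obj b) ?e \<odot> ((cell_act w \<otimes>\<^sub>a cell_act z) \<otimes>\<^sub>a path_mult s A B'))
      \<odot> ((path_assoc c a \<otimes>\<^sub>a \<one> (path_obj s)) \<odot> path_assoc (a @ c) s)"
    unfolding hcomp.IH[OF hcomp.prems, unfolded ends] using ty by (simp add: mon_simps)
  also have "\<dots> = (cell_act w \<otimes>\<^sub>a (cell_act z \<otimes>\<^sub>a path_mult s A B')) \<odot> (\<alpha> (path_obj c) (path_obj a) (path_obj s)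
      \<odot> ((path_assoc c a \<otimes>\<^sub>a \<one> (path_obj s)) \<odot> path_assoc (a @ c) s))"
    using ty by (subst massoc_nat) (simp_all add: mon_simps)
  also have "\<dots> = (cell_act w \<otimes>\<^sub>a ((cell_act z \<otimes>\<^sub>a path_mult s A B') \<odot> path_assoc a s)) \<odot> path_assoc c (s @ a)"
    unfolding path_assoc_coassoc[OF hcomp.hyps(2) ch(1,3)] using ty by (simp add: mon_simps)
  finally show ?case
    by (simp add: cell_act_hcomp[OF hcomp.hyps] path_hcomp_ends fst_col snd_col[OF hcomp.hyps(2)] ends
        del: path_hcomp.simps path_assoc.simps)
qed

text \<open>By \<open>path_mult_append\<close> the first block may be multiplied separately from the
  rest. This is functoriality for a 2-cell followed by a collapse, the case on which
  \<open>cell_act_vcomp\<close> rests.\<close>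

lemma path_mult_cell_act:
  assumes "w \<in> cells X A B"
  shows "path_mult (snd (snd w)) A B \<odot> cell_act w = path_mult (fst w) A B"
  using assms
proof (induction rule: coarse.path_cells_induct)
  case (Nil A)
  then show ?case by (simp add: path_id_ends cell_act_Nil mon_simps eunit_simps)
next
  case (hcomp A B D w s)
  obtain a u b where w: "w = (a, u, b)" by (cases w)
  have X: "A \<in> X" "B \<in> X" "D \<in> X" using chn_objs[OF hcomp.hyps(2)] cell_objs[OF hcomp.hyps(1)] by simp_all
  have ch: "chn X B a D" "chn X B b D"
    using coarse.path_cell_chains[OF hcomp.hyps(1)] by (simp_all add: w)
  have ends: "fst w = a" "snd (snd w) = b" by (simp_all add: w)
  note ty = ehom_simps[OF X(1,2)] cell_act_simps[OF hcomp.hyps(1), unfolded ends] path_mult_simps[OF hcomp.hyps(2)]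
    path_mult_simps[OF ch(1)] path_mult_simps[OF ch(2)] path_assoc_simps[OF hcomp.hyps(2) ch(1)] ecomp_simps[OF X]
  have "path_mult ((A, B) # b) A D \<odot> ((cell_act w \<otimes>\<^sub>a path_mult s A B) \<odot> path_assoc a s)
      = ecomp E A B D \<odot> (((path_mult b B D \<odot> cell_act w) \<otimes>\<^sub>a path_mult s A B) \<odot> path_assoc a s)"
    using ty by (simp add: mon_simps)
  also have "\<dots> = path_mult (s @ a) A D"
    using hcomp.IH by (simp add: path_mult_append[OF hcomp.hyps(2) ch(1)] ends)
  finally show ?case
    by (simp add: cell_act_hcomp[OF hcomp.hyps] path_hcomp_ends fst_col snd_col[OF hcomp.hyps(2)] ends
        del: path_hcomp.simps path_mult.simps)
qed

text \<open>Induction over the later 2-cell, along whose blocks \<open>w\<close> is split. Over the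
  first block \<open>path_mult_cell_act\<close> applies, over the others the induction hypothesis,
  and \<open>cell_act_natural\<close> puts the pieces of \<open>w\<close> together again.\<close>

lemma cell_act_vcomp:
  assumes "z \<in> cells X A B" "w \<in> cells X A B" "snd (snd w) = fst z"
  shows "cell_act (path_vcomp z w) = cell_act z \<odot> cell_act w"
  using assms
proof (induction arbitrary: w rule: coarse.path_cells_induct)
  case (Nil A)
  have "path_vcomp (path_id []) w = w"
    using coarse.path_vcomp_id(2)[OF Nil(2)] Nil(3) by (simp add: path_id_ends)
  then show ?case
    using cell_act_simps[OF Nil(2)] Nil(3) by (simp add: path_id_ends cell_act_Nil mon_simps)
next
  case (hcomp A B D z t)
  have "snd (snd w) = t @ fst z"
    using hcomp.prems(2) by (simp add: path_hcomp_ends fst_col)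
  then obtain x y where xy: "x \<in> cells X B D" "y \<in> cells X A B" "snd (snd x) = fst z"
    "snd (snd y) = t" "w = path_hcomp x y"
    "path_vcomp (path_hcomp z (col X A t)) w = path_hcomp (path_vcomp z x) (col X A (fst y))"
    using coarse.path_vcomp_hcomp_collapse[OF hcomp.hyps hcomp.prems(1)] by metis
  have ch: "chn X A (fst y) B" "chn X B (fst x) D" "chn X B (fst z) D"
    using coarse.path_cell_chains[OF xy(2)] coarse.path_cell_chains[OF xy(1)]
      coarse.path_cell_chains[OF hcomp.hyps(1)] by simp_all
  have zx: "path_vcomp z x \<in> cells X B D"
    by (rule coarse.path_vcomp_closed[OF xy(1) hcomp.hyps(1) xy(3)])
  have fst_zx: "fst (path_vcomp z x) = fst x"
    by (cases z; cases x) simp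
  have h: "path_hcomp x y \<in> cells X A D"
    by (rule coarse.path_hcomp_closed[OF xy(1,2)])
  note ty = cell_act_simps[OF hcomp.hyps(1)] cell_act_simps[OF xy(1)] cell_act_simps[OF xy(2)] cell_act_simps[OF h]
    path_mult_simps[OF ch(1)] path_mult_simps[OF hcomp.hyps(2)] path_assoc_simps[OF ch(1,2)]
    path_assoc_simps[OF hcomp.hyps(2) ch(3)] xy(3,4)
  have "cell_act (path_vcomp (path_hcomp z (col X A t)) w)
      = ((cell_act z \<odot> cell_act x) \<otimes>\<^sub>a path_mult (fst y) A B) \<odot> path_assoc (fst x) (fst y)"
    unfolding xy(6) cell_act_hcomp[OF zx ch(1)] fst_zx hcomp.IH[OF xy(1,3)] ..
  also have "\<dots> = (cell_act z \<otimes>\<^sub>a path_mult t A B) \<odot> ((cell_act x \<otimes>\<^sub>a cell_act y) \<odot> path_assoc (fst x) (fst y))"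
    unfolding path_mult_cell_act[OF xy(2), symmetric] using ty by (simp add: mon_simps)
  also have "\<dots> = (cell_act z \<otimes>\<^sub>a path_mult t A B) \<odot> (path_assoc (fst z) t \<odot> cell_act w)"
    using cell_act_natural[OF xy(2,1)] xy(3-5) by simp
  also have "\<dots> = cell_act (path_hcomp z (col X A t)) \<odot> cell_act w"
    unfolding cell_act_hcomp[OF hcomp.hyps] using ty by (simp add: mon_simps xy(5) path_hcomp_ends)
  finally show ?case .
qed

section \<open>The point of an enriched category and its comparison with the original\<close>

definition free_point :: "('x, ('x \<times> 'x) list, ('x \<times> 'x) path_cell, unit, 'o, 'a) colax" where
  "free_point = \<lparr>cobj = restrict (\<lambda>_. ()) X,
     chom = (\<lambda>A B. if A \<in> X \<and> B \<in> X then
       \<lparr>omap = restrict path_obj {s. chn X A s B}, amap = restrict cell_act (cells X A B)\<rparr> else undefined),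
     ccomp = (\<lambda>A B D t s. if chn X A s B \<and> chn X B t D then path_assoc t s else undefined),
     cunit = restrict (\<lambda>_. \<one> \<I>) X\<rparr>"

lemma free_point_simps:
  "chn X A s B \<Longrightarrow> fo free_point A B s = path_obj s"
  "w \<in> cells X A B \<Longrightarrow> fa free_point A B w = cell_act w"
  "chn X A s B \<Longrightarrow> chn X B t D \<Longrightarrow> ccomp free_point A B D t s = path_assoc t s"
  "A \<in> X \<Longrightarrow> cunit free_point A = \<one> \<I>"
  using chn_objs[of X A s B] cell_objs[of w X A B] by (simp_all add: free_point_def)

lemma coarse_point_free_point: "coarse_point M X free_point"
proof (intro coarse_point.intro coarse_point_axioms.intro monoidal_category_axioms)
  fix A B assume X: "A \<in> X" "B \<in> X"
  note s = coarse.path_hom_simps coarse.in_Hom_path_hom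
  show "cat_functor (path_hom (coarse X) A B) (mcat M) (chom free_point A B)"
  proof (intro cat_functor.intro cat_functor_axioms.intro coarse.path_hom_category underlying)
    fix f s t g r
    assume fg: "f \<in> Hom (path_hom (coarse X) A B) s t" "g \<in> Hom (path_hom (coarse X) A B) t r"
    have "path_vcomp g f \<in> cells X A B"
      using fg by (intro coarse.path_vcomp_closed) (simp_all add: s)
    then show "fa free_point A B (g \<cdot>\<^bsub>path_hom (coarse X) A B\<^esub> f) = fa free_point A B g \<odot> fa free_point A B f"
      using fg cell_act_vcomp[of g A B f] by (simp add: s free_point_simps)
  next
    fix f s t assume f: "f \<in> Hom (path_hom (coarse X) A B) s t"
    then show "fa free_point A B f \<in> Hom (mcat M) (fo free_point A B s) (fo free_point A B t)"
      using coarse.path_cell_chains[of f X A B]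
      by (auto simp: s free_point_simps U.in_Hom_iff cell_act_simps)
  qed (use X in \<open>auto simp: s free_point_simps path_obj_closed coarse.path_id_mem
      cell_act_id free_point_def\<close>)
next
  fix A B D w z assume wz: "w \<in> cells X B D" "z \<in> cells X A B"
  then show "ccomp free_point A B D (snd (snd w)) (snd (snd z)) \<odot> fa free_point A D (path_hcomp w z)
      = (fa free_point B D w \<otimes>\<^sub>a fa free_point A B z) \<odot> ccomp free_point A B D (fst w) (fst z)"
    using cell_act_natural[OF wz(2,1)] coarse.path_cell_chains[OF wz(1)] coarse.path_cell_chains[OF wz(2)]
      coarse.path_hcomp_closed[OF wz] by (simp add: free_point_simps)
next
  fix A B D H f g h assume fgh: "chn X A f B" "chn X B g D" "chn X D h H"
  then have "chn X A (f @ g) D" "chn X B (g @ h) H"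
    by (auto simp: coarse.chain_append_iff)
  then show "\<alpha> (fo free_point D H h) (fo free_point B D g) (fo free_point A B f)
      \<odot> ((ccomp free_point B D H h g \<otimes>\<^sub>a \<one> (fo free_point A B f)) \<odot> ccomp free_point A B H (g @ h) f)
    = (\<one> (fo free_point D H h) \<otimes>\<^sub>a ccomp free_point A B D g f) \<odot> ccomp free_point A D H h (f @ g)"
    using fgh path_assoc_coassoc[OF fgh] by (simp add: free_point_simps)
next
  fix A B f assume f: "chn X A f B"
  then have ch: "chn X A [] A" "chn X B [] B" "A \<in> X" "B \<in> X"
    using chn_objs[OF f] by simp_all
  show "\<ll> (fo free_point A B f) \<odot> ((cunit free_point B \<otimes>\<^sub>a \<one> (fo free_point A B f)) \<odot> ccomp free_point A B B [] f)
      = \<one> (fo free_point A B f)"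
    using path_assoc_counit_left[OF f] f ch path_assoc_simps[OF f ch(2)] path_obj_closed[OF f]
    by (simp add: free_point_simps mon_simps)
  show "\<rr> (fo free_point A B f) \<odot> ((\<one> (fo free_point A B f) \<otimes>\<^sub>a cunit free_point A) \<odot> ccomp free_point A A B f [])
      = \<one> (fo free_point A B f)"
    using f ch path_obj_closed[OF f] by (simp add: free_point_simps mon_simps U.cinv_simps)
next
  fix A B D s t assume st: "chn X A s B" "chn X B t D"
  then show "ccomp free_point A B D t s \<in> Isos (mcat M)
      \<inter> Hom (mcat M) (fo free_point A D (s @ t)) (fo free_point B D t \<otimes>\<^sub>o fo free_point A B s)"
    using path_assoc_simps[OF st] coarse.chain_append[OF st] by (simp add: free_point_simps U.in_Hom_iff)
qed (auto simp: free_point_simps mon_simps U.in_Hom_iff U.Isos_ide, auto simp: free_point_def)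

definition counit :: "'x \<Rightarrow> 'x \<Rightarrow> 'a" where
  "counit A B = (if A \<in> X \<and> B \<in> X then \<ll> (ehom E A B) else undefined)"

lemma counit_Isos: "A \<in> X \<Longrightarrow> B \<in> X \<Longrightarrow> counit A B \<in> Isos (mcat M)"
  by (simp add: counit_def mon_simps ehom_simps)

text \<open>\<ll> is \<open>path_mult\<close> of a single arrow, so both laws come from
  \<open>path_mult_cell_act\<close> at a collapse: of two arrows, where
  \<open>path_mult_append\<close> brings in \<open>ecomp\<close>, and of the empty path, where
  \<open>path_mult\<close> is the unit.\<close>

lemma enriched_functor_counit: "enriched_functor M X (coarse_point.enriched M X free_point) E counit"
proof -
  interpret P: coarse_point M X free_point by (rule coarse_point_free_point)
  have T: "counit A B = path_mult [(A, B)] A B" if "A \<in> X" "B \<in> X" for A B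
    using path_mult_single[OF that] that by (simp add: counit_def)
  have T_simps: "counit A B \<in> Arr (mcat M)" "Dom (mcat M) (counit A B) = path_obj [(A, B)]"
    "Cod (mcat M) (counit A B) = ehom E A B" if "A \<in> X" "B \<in> X" for A B
    using path_mult_simps[of A "[(A, B)]" B] that by (simp_all add: T del: path_mult.simps)
  show ?thesis
  proof (intro enriched_functor.intro enriched_functor_axioms.intro P.enriched_category_enriched
      enriched_category_axioms)
    fix A B D assume X: "A \<in> X" "B \<in> X" "D \<in> X"
    let ?f = "[(A, B)]" and ?g = "[(B, D)]"
    have ch: "chn X A ?f B" "chn X B ?g D" "chn X A (?f @ ?g) D" "chn X A [(A, D)] D"
      using X by simp_all
    note obj = P.fo_closed[OF ch(1)] P.fo_closed[OF ch(2)]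
    note ass = P.ccomp_simps[OF ch(1,2)]
    have "counit A D \<odot> P.comp_of A B D \<odot> ccomp free_point A B D ?g ?f
        = counit A D \<odot> (P.comp_of A B D \<odot> ccomp free_point A B D ?g ?f)"
      using X ass obj by (simp add: mon_simps P.comp_of_simps T_simps free_point_simps)
    also have "\<dots> = path_mult [(A, D)] A D \<odot> cell_act (col X A (?f @ ?g))"
      using P.comp_of_col[OF ch(1,2)] X ass obj coarse.collapse_closed[OF ch(3)]
      by (simp add: P.fa_single mon_simps T free_point_simps(2) del: path_mult.simps)
    also have "\<dots> = path_mult (?f @ ?g) A D"
      using path_mult_cell_act[OF coarse.collapse_closed[OF ch(3)]]
      by (simp only: fst_col snd_col[OF ch(3)])
    also have "\<dots> = ecomp E A B D \<odot> ((counit B D \<otimes>\<^sub>a counit A B) \<odot> ccomp free_point A B D ?g ?f)"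
      unfolding path_mult_append[OF ch(1,2)] T[OF X(1,2)] T[OF X(2,3)] free_point_simps(3)[OF ch(1,2)] ..
    also have "\<dots> = ecomp E A B D \<odot> (counit B D \<otimes>\<^sub>a counit A B) \<odot> ccomp free_point A B D ?g ?f"
      using X ass ch by (simp add: mon_simps T_simps ecomp_simps free_point_simps)
    finally have eq: "counit A D \<odot> P.comp_of A B D \<odot> ccomp free_point A B D ?g ?f = \<dots>" .
    have "counit A D \<odot> P.comp_of A B D = ecomp E A B D \<odot> (counit B D \<otimes>\<^sub>a counit A B)"
      by (rule U.iso_cancel_right[OF ass(1) _ _ _ _ eq])
        (use X ass ch in \<open>simp_all add: mon_simps P.comp_of_simps T_simps ecomp_simps free_point_simps\<close>)
    then show "counit A D \<odot> ecomp P.enriched A B D = ecomp E A B D \<odot> (counit B D \<otimes>\<^sub>a counit A B)"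
      using X by (simp add: P.enriched_simps)
  next
    fix A assume A: "A \<in> X"
    have ch: "chn X A [] A" using A by simp
    \<comment> \<open>The structure 2-cell \<open>cunit free_point A\<close> is an identity, so
      \<open>P.unit_of A\<close> is itself the action of a collapse.\<close>
    have "P.unit_of A = P.unit_of A \<odot> cunit free_point A"
      using A by (simp add: free_point_simps mon_simps P.unit_of_simps)
    also have "\<dots> = cell_act (col X A [])"
      using P.unit_of_col[OF A] coarse.collapse_closed[OF ch] by (simp add: free_point_simps)
    finally have "counit A A \<odot> P.unit_of A = path_mult [(A, A)] A A \<odot> cell_act (col X A [])"
      using A by (simp add: T del: path_mult.simps)
    also have "\<dots> = eunit E A"
      using path_mult_cell_act[OF coarse.collapse_closed[OF ch]] by (simp add: fst_col snd_col[OF ch])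
    finally show "counit A A \<odot> eunit P.enriched A = eunit E A"
      using A by (simp add: P.enriched_simps)
  next
    fix A B assume X: "A \<in> X" "B \<in> X"
    then show "counit A B \<in> Hom (mcat M) (ehom P.enriched A B) (ehom E A B)"
      using T_simps[OF X] free_point_simps(1)[of A "[(A, B)]" B]
      by (simp add: P.enriched_simps U.in_Hom_iff del: path_obj.simps)
  qed (auto simp: counit_def)
qed

end

section \<open>The equivalence\<close>

lemma (in coarse_point) point_map_id:
  "point_map M X F F (\<lambda>A B s. if chn X A s B then \<one> (fo F A B s) else undefined)"
proof (intro point_map.intro point_map_axioms.intro coarse_point_axioms)
  fix A B w assume w: "w \<in> cells X A B"
  show "(if chn X A (snd (snd w)) B then \<one> (fo F A B (snd (snd w))) else undefined) \<odot> fa F A B w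
      = fa F A B w \<odot> (if chn X A (fst w) B then \<one> (fo F A B (fst w)) else undefined)"
    using coarse.path_cell_chains[OF w] fa_simps[OF w] by (simp add: mon_simps)
next
  fix A B D s t assume st: "chn X A s B" "chn X B t D"
  show "ccomp F A B D t s \<odot> (if chn X A (s @ t) D then \<one> (fo F A D (s @ t)) else undefined)
      = ((if chn X B t D then \<one> (fo F B D t) else undefined)
          \<otimes>\<^sub>a (if chn X A s B then \<one> (fo F A B s) else undefined)) \<odot> ccomp F A B D t s"
    using st coarse.chain_append[OF st] by (simp add: mon_simps point_simps)
qed (simp_all add: mon_simps point_simps U.in_Hom_iff)

lemma point_map_comp:
  assumes "point_map M X F G \<sigma>" "point_map M X G H \<tau>"
  shows "point_map M X F H (\<lambda>A B s. if chn X A s B then \<tau> A B s \<cdot>\<^bsub>mcat M\<^esub> \<sigma> A B s else undefined)"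
proof -
  interpret S: point_map M X F G \<sigma> by fact
  interpret T: point_map M X G H \<tau> by fact
  note simps = S.F.mon_simps S.sigma_simps T.sigma_simps
  show ?thesis
  proof (intro point_map.intro point_map_axioms.intro S.F.coarse_point_axioms T.G.coarse_point_axioms)
    fix A B w assume w: "w \<in> cells X A B"
    let ?s = "fst w" and ?t = "snd (snd w)"
    have ch: "chn X A ?s B" "chn X A ?t B" using coarse.path_cell_chains[OF w] by simp_all
    note ty = ch S.F.fa_simps[OF w] S.G.fa_simps[OF w] T.G.fa_simps[OF w]
    have "(\<tau> A B ?t \<odot>\<^bsub>M\<^esub> \<sigma> A B ?t) \<odot>\<^bsub>M\<^esub> fa F A B w = \<tau> A B ?t \<odot>\<^bsub>M\<^esub> (\<sigma> A B ?t \<odot>\<^bsub>M\<^esub> fa F A B w)"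
      using ty by (simp add: simps)
    also have "\<dots> = (\<tau> A B ?t \<odot>\<^bsub>M\<^esub> fa G A B w) \<odot>\<^bsub>M\<^esub> \<sigma> A B ?s"
      unfolding S.sigma_natural[OF w] using ty by (simp add: simps)
    also have "\<dots> = fa H A B w \<odot>\<^bsub>M\<^esub> (\<tau> A B ?s \<odot>\<^bsub>M\<^esub> \<sigma> A B ?s)"
      unfolding T.sigma_natural[OF w] using ty by (simp add: simps)
    finally show "(if chn X A ?t B then \<tau> A B ?t \<odot>\<^bsub>M\<^esub> \<sigma> A B ?t else undefined) \<odot>\<^bsub>M\<^esub> fa F A B w
      = fa H A B w \<odot>\<^bsub>M\<^esub> (if chn X A ?s B then \<tau> A B ?s \<odot>\<^bsub>M\<^esub> \<sigma> A B ?s else undefined)"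
      using ch by simp
  next
    fix A B D s t assume st: "chn X A s B" "chn X B t D"
    note app = coarse.chain_append[OF st]
    note ty = st app S.F.ccomp_simps[OF st] S.G.ccomp_simps[OF st] T.G.ccomp_simps[OF st]
    have "ccomp H A B D t s \<odot>\<^bsub>M\<^esub> (\<tau> A D (s @ t) \<odot>\<^bsub>M\<^esub> \<sigma> A D (s @ t))
        = (ccomp H A B D t s \<odot>\<^bsub>M\<^esub> \<tau> A D (s @ t)) \<odot>\<^bsub>M\<^esub> \<sigma> A D (s @ t)"
      using ty by (simp add: simps)
    also have "\<dots> = (\<tau> B D t \<otimes>\<^sub>a\<^bsub>M\<^esub> \<tau> A B s) \<odot>\<^bsub>M\<^esub> (ccomp G A B D t s \<odot>\<^bsub>M\<^esub> \<sigma> A D (s @ t))"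
      unfolding T.sigma_ccomp[OF st] using ty by (simp add: simps)
    also have "\<dots> = ((\<tau> B D t \<odot>\<^bsub>M\<^esub> \<sigma> B D t) \<otimes>\<^sub>a\<^bsub>M\<^esub> (\<tau> A B s \<odot>\<^bsub>M\<^esub> \<sigma> A B s)) \<odot>\<^bsub>M\<^esub> ccomp F A B D t s"
      unfolding S.sigma_ccomp[OF st] using ty by (simp add: simps)
    finally show "ccomp H A B D t s \<odot>\<^bsub>M\<^esub> (if chn X A (s @ t) D then \<tau> A D (s @ t) \<odot>\<^bsub>M\<^esub> \<sigma> A D (s @ t) else undefined)
      = ((if chn X B t D then \<tau> B D t \<odot>\<^bsub>M\<^esub> \<sigma> B D t else undefined)
          \<otimes>\<^sub>a\<^bsub>M\<^esub> (if chn X A s B then \<tau> A B s \<odot>\<^bsub>M\<^esub> \<sigma> A B s else undefined)) \<odot>\<^bsub>M\<^esub> ccomp F A B D t s"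
      using st app by simp
  next
    fix A assume A: "A \<in> X"
    then have ch: "chn X A [] A" by simp
    have "cunit H A \<odot>\<^bsub>M\<^esub> (\<tau> A A [] \<odot>\<^bsub>M\<^esub> \<sigma> A A []) = (cunit H A \<odot>\<^bsub>M\<^esub> \<tau> A A []) \<odot>\<^bsub>M\<^esub> \<sigma> A A []"
      using A ch T.G.cunit_simps[OF A] by (simp add: simps)
    then show "cunit H A \<odot>\<^bsub>M\<^esub> (if chn X A [] A then \<tau> A A [] \<odot>\<^bsub>M\<^esub> \<sigma> A A [] else undefined) = cunit F A"
      using A by (simp add: T.sigma_cunit S.sigma_cunit)
  qed (simp_all add: simps S.F.U.in_Hom_iff)
qed

lemma (in monoidal_category) points_simps:
  "Obj (points (coarse X) (deloop M) (Iso_cells (deloop M))) = {F. coarse_point M X F}"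
  "Arr (points (coarse X) (deloop M) (Iso_cells (deloop M))) = {(F, \<sigma>, G). point_map M X F G \<sigma>}"
  "Dom (points (coarse X) (deloop M) (Iso_cells (deloop M))) = fst"
  "Cod (points (coarse X) (deloop M) (Iso_cells (deloop M))) = (\<lambda>w. snd (snd w))"
  "Ide (points (coarse X) (deloop M) (Iso_cells (deloop M))) F
    = (F, (\<lambda>A B s. if chn X A s B then \<one> (fo F A B s) else undefined), F)"
  "Comp (points (coarse X) (deloop M) (Iso_cells (deloop M))) (G', \<tau>, H) (F, \<sigma>, G)
    = (F, (\<lambda>A B s. if chn X A s B then \<tau> A B s \<odot> \<sigma> A B s else undefined), H)"
proof -
  have "A \<in> X \<and> B \<in> X \<and> chn X A s B \<longleftrightarrow> chn X A s B" for A B s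
    using chn_objs[of X A s B] by auto
  moreover have "coarse_point M X F \<and> coarse_point M X G
      \<and> colax_transformation (path_bicat (coarse X)) (deloop M) F G \<sigma> \<longleftrightarrow> point_map M X F G \<sigma>" for F G \<sigma>
    using point_map_iff[of X F G \<sigma>] by (auto simp: point_map_def)
  ultimately show
    "Obj (points (coarse X) (deloop M) (Iso_cells (deloop M))) = {F. coarse_point M X F}"
    "Arr (points (coarse X) (deloop M) (Iso_cells (deloop M))) = {(F, \<sigma>, G). point_map M X F G \<sigma>}"
    "Dom (points (coarse X) (deloop M) (Iso_cells (deloop M))) = fst"
    "Cod (points (coarse X) (deloop M) (Iso_cells (deloop M))) = (\<lambda>w. snd (snd w))"
    "Ide (points (coarse X) (deloop M) (Iso_cells (deloop M))) F
      = (F, (\<lambda>A B s. if chn X A s B then \<one> (fo F A B s) else undefined), F)"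
    "Comp (points (coarse X) (deloop M) (Iso_cells (deloop M))) (G', \<tau>, H) (F, \<sigma>, G)
      = (F, (\<lambda>A B s. if chn X A s B then \<tau> A B s \<odot> \<sigma> A B s else undefined), H)"
    by (simp_all add: points_def coarse_point_iff deloop_simps cong: if_cong)
qed

lemma (in monoidal_category) category_points:
  "category (points (coarse X) (deloop M) (Iso_cells (deloop M)))"
proof
  let ?P = "points (coarse X) (deloop M) (Iso_cells (deloop M))"
  show "Dom ?P f \<in> Obj ?P" "Cod ?P f \<in> Obj ?P" if "f \<in> Arr ?P" for f
    using that by (auto simp: points_simps point_map_def)
  show "Ide ?P F \<in> Hom ?P F F" if "F \<in> Obj ?P" for F
    using that by (auto simp: Hom_def points_simps coarse_point.point_map_id)
  show "g \<cdot>\<^bsub>?P\<^esub> f \<in> Hom ?P F H" if "f \<in> Hom ?P F G" "g \<in> Hom ?P G H" for f g F G H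
    using that by (auto simp: Hom_def points_simps point_map_comp)
  show "Ide ?P G \<cdot>\<^bsub>?P\<^esub> f = f" "f \<cdot>\<^bsub>?P\<^esub> Ide ?P F = f" if hyp: "f \<in> Hom ?P F G" for f F G
  proof -
    obtain \<sigma> where f: "f = (F, \<sigma>, G)" and "point_map M X F G \<sigma>"
      using hyp by (auto simp: Hom_def points_simps)
    then interpret S: point_map M X F G \<sigma> by simp
    show "Ide ?P G \<cdot>\<^bsub>?P\<^esub> f = f" "f \<cdot>\<^bsub>?P\<^esub> Ide ?P F = f"
      by (auto simp: f points_simps fun_eq_iff mon_simps S.sigma_simps S.sigma_undefined)
  qed
  show "h \<cdot>\<^bsub>?P\<^esub> g \<cdot>\<^bsub>?P\<^esub> f = h \<cdot>\<^bsub>?P\<^esub> (g \<cdot>\<^bsub>?P\<^esub> f)"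
    if hyp: "f \<in> Hom ?P F G" "g \<in> Hom ?P G H" "h \<in> Hom ?P H K" for f g h F G H K
  proof -
    obtain \<rho> \<sigma> \<tau> where fgh: "f = (F, \<rho>, G)" "g = (G, \<sigma>, H)" "h = (H, \<tau>, K)"
      and "point_map M X F G \<rho>" "point_map M X G H \<sigma>" "point_map M X H K \<tau>"
      using hyp by (auto simp: Hom_def points_simps)
    then interpret R: point_map M X F G \<rho> + S: point_map M X G H \<sigma> + T: point_map M X H K \<tau>
      by simp_all
    show ?thesis
      by (auto simp: fgh points_simps fun_eq_iff mon_simps R.sigma_simps S.sigma_simps T.sigma_simps)
  qed
qed

section \<open>The category of enriched categories\<close>

context enriched_functor
begin

lemma efun_simps:
  assumes "A \<in> X" "B \<in> X"
  shows "T A B \<in> Arr (mcat M)" "Dom (mcat M) (T A B) = ehom E A B" "Cod (mcat M) (T A B) = ehom E' A B"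
  using efun_closed[OF assms] by (auto simp: E.U.in_Hom_iff)

text \<open>The laws for the inverses follow by cancelling \<open>T\<close>. Essential surjectivity
  needs this: componentwise invertibility of \<open>counit\<close> becomes an isomorphism of
  enriched categories.\<close>

lemma enriched_functor_inverse:
  assumes iso: "\<And>A B. A \<in> X \<Longrightarrow> B \<in> X \<Longrightarrow> T A B \<in> Isos (mcat M)"
  shows "enriched_functor M X E' E (\<lambda>A B. if A \<in> X \<and> B \<in> X then cinv (mcat M) (T A B) else undefined)"
proof (intro enriched_functor.intro enriched_functor_axioms.intro E.enriched_category_axioms
    E'.enriched_category_axioms)
  fix A B D assume X: "A \<in> X" "B \<in> X" "D \<in> X"
  note simps = E.mon_simps E.U.cinv_simps E.U.cinv_cancel efun_simps E.ecomp_simps E'.ecomp_simps iso X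
    E.ehom_simps E'.ehom_simps
  have "T A D \<odot> (cinv (mcat M) (T A D) \<odot> ecomp E' A B D) = ecomp E' A B D"
    by (simp add: simps)
  also have "\<dots> = (ecomp E' A B D \<odot> (T B D \<otimes>\<^sub>a T A B)) \<odot> (cinv (mcat M) (T B D) \<otimes>\<^sub>a cinv (mcat M) (T A B))"
    by (simp add: simps)
  also have "\<dots> = T A D \<odot> (ecomp E A B D \<odot> (cinv (mcat M) (T B D) \<otimes>\<^sub>a cinv (mcat M) (T A B)))"
    unfolding efun_comp[OF X, symmetric] by (simp add: simps)
  finally have eq: "T A D \<odot> (cinv (mcat M) (T A D) \<odot> ecomp E' A B D) = \<dots>" .
  have "cinv (mcat M) (T A D) \<odot> ecomp E' A B D
      = ecomp E A B D \<odot> (cinv (mcat M) (T B D) \<otimes>\<^sub>a cinv (mcat M) (T A B))"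
    by (rule E.U.iso_cancel_left[OF _ _ _ _ _ eq]) (simp_all add: simps)
  then show "(if A \<in> X \<and> D \<in> X then cinv (mcat M) (T A D) else undefined) \<odot> ecomp E' A B D
      = ecomp E A B D \<odot> ((if B \<in> X \<and> D \<in> X then cinv (mcat M) (T B D) else undefined)
        \<otimes>\<^sub>a (if A \<in> X \<and> B \<in> X then cinv (mcat M) (T A B) else undefined))"
    using X by simp
next
  fix A assume A: "A \<in> X"
  show "(if A \<in> X \<and> A \<in> X then cinv (mcat M) (T A A) else undefined) \<odot> eunit E' A = eunit E A"
    unfolding efun_unit[OF A, symmetric]
    using A by (simp add: E.U.cinv_cancel iso efun_simps E.eunit_simps)
qed (auto simp: E.U.in_Hom_iff E.U.cinv_simps iso efun_simps)

end

lemma (in enriched_category) enriched_functor_id: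
  "enriched_functor M X E E (\<lambda>A B. if A \<in> X \<and> B \<in> X then \<one> (ehom E A B) else undefined)"
  by (intro enriched_functor.intro enriched_functor_axioms.intro enriched_category_axioms)
    (auto simp: mon_simps ehom_simps ecomp_simps eunit_simps U.in_Hom_iff)

lemma enriched_functor_comp:
  assumes "enriched_functor M X E E' T" "enriched_functor M X E' E'' T'"
  shows "enriched_functor M X E E'' (\<lambda>A B. if A \<in> X \<and> B \<in> X then T' A B \<cdot>\<^bsub>mcat M\<^esub> T A B else undefined)"
proof -
  interpret S: enriched_functor M X E E' T by fact
  interpret T: enriched_functor M X E' E'' T' by fact
  note simps = S.E.mon_simps S.efun_simps T.efun_simps S.E.ecomp_simps S.E'.ecomp_simps T.E'.ecomp_simps
    S.E.eunit_simps
  show ?thesis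
  proof (intro enriched_functor.intro enriched_functor_axioms.intro S.E.enriched_category_axioms
      T.E'.enriched_category_axioms)
    fix A B D assume X: "A \<in> X" "B \<in> X" "D \<in> X"
    have "(T' A D \<odot>\<^bsub>M\<^esub> T A D) \<odot>\<^bsub>M\<^esub> ecomp E A B D = T' A D \<odot>\<^bsub>M\<^esub> (T A D \<odot>\<^bsub>M\<^esub> ecomp E A B D)"
      using X by (simp add: simps)
    also have "\<dots> = (T' A D \<odot>\<^bsub>M\<^esub> ecomp E' A B D) \<odot>\<^bsub>M\<^esub> (T B D \<otimes>\<^sub>a\<^bsub>M\<^esub> T A B)"
      unfolding S.efun_comp[OF X] using X by (simp add: simps)
    also have "\<dots> = ecomp E'' A B D \<odot>\<^bsub>M\<^esub> ((T' B D \<odot>\<^bsub>M\<^esub> T B D) \<otimes>\<^sub>a\<^bsub>M\<^esub> (T' A B \<odot>\<^bsub>M\<^esub> T A B))"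
      unfolding T.efun_comp[OF X] using X by (simp add: simps)
    finally show "(if A \<in> X \<and> D \<in> X then T' A D \<odot>\<^bsub>M\<^esub> T A D else undefined) \<odot>\<^bsub>M\<^esub> ecomp E A B D
      = ecomp E'' A B D \<odot>\<^bsub>M\<^esub> ((if B \<in> X \<and> D \<in> X then T' B D \<odot>\<^bsub>M\<^esub> T B D else undefined)
          \<otimes>\<^sub>a\<^bsub>M\<^esub> (if A \<in> X \<and> B \<in> X then T' A B \<odot>\<^bsub>M\<^esub> T A B else undefined))"
      using X by simp
  qed (auto simp: simps S.E.U.in_Hom_iff S.efun_unit T.efun_unit)
qed

lemma enriched_categories_simps:
  "Obj (enriched_categories M X) = {E. enriched_category M X E}"
  "Arr (enriched_categories M X) = {(E, T, E'). enriched_functor M X E E' T}"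
  "Dom (enriched_categories M X) = fst"
  "Cod (enriched_categories M X) = (\<lambda>w. snd (snd w))"
  "Ide (enriched_categories M X) E
    = (E, (\<lambda>A B. if A \<in> X \<and> B \<in> X then Ide (mcat M) (ehom E A B) else undefined), E)"
  "Comp (enriched_categories M X) (E0, T', E'') (E, T, E')
    = (E, (\<lambda>A B. if A \<in> X \<and> B \<in> X then T' A B \<cdot>\<^bsub>mcat M\<^esub> T A B else undefined), E'')"
  by (simp_all add: enriched_categories_def)

lemma (in monoidal_category) category_enriched_categories: "category (enriched_categories M X)"
proof
  let ?P = "enriched_categories M X"
  show "Dom ?P f \<in> Obj ?P" "Cod ?P f \<in> Obj ?P" if "f \<in> Arr ?P" for f
    using that by (auto simp: enriched_categories_simps enriched_functor_def)
  show "Ide ?P F \<in> Hom ?P F F" if "F \<in> Obj ?P" for F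
    using that by (auto simp: Hom_def enriched_categories_simps enriched_category.enriched_functor_id)
  show "g \<cdot>\<^bsub>?P\<^esub> f \<in> Hom ?P F H" if "f \<in> Hom ?P F G" "g \<in> Hom ?P G H" for f g F G H
    using that by (auto simp: Hom_def enriched_categories_simps enriched_functor_comp)
  show "Ide ?P G \<cdot>\<^bsub>?P\<^esub> f = f" "f \<cdot>\<^bsub>?P\<^esub> Ide ?P F = f" if hyp: "f \<in> Hom ?P F G" for f F G
  proof -
    obtain \<sigma> where f: "f = (F, \<sigma>, G)" and "enriched_functor M X F G \<sigma>"
      using hyp by (auto simp: Hom_def enriched_categories_simps)
    then interpret S: enriched_functor M X F G \<sigma> by simp
    show "Ide ?P G \<cdot>\<^bsub>?P\<^esub> f = f" "f \<cdot>\<^bsub>?P\<^esub> Ide ?P F = f"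
      by (auto simp: f enriched_categories_simps fun_eq_iff mon_simps S.efun_simps S.efun_ext)
  qed
  show "h \<cdot>\<^bsub>?P\<^esub> g \<cdot>\<^bsub>?P\<^esub> f = h \<cdot>\<^bsub>?P\<^esub> (g \<cdot>\<^bsub>?P\<^esub> f)"
    if hyp: "f \<in> Hom ?P F G" "g \<in> Hom ?P G H" "h \<in> Hom ?P H K" for f g h F G H K
  proof -
    obtain \<rho> \<sigma> \<tau> where fgh: "f = (F, \<rho>, G)" "g = (G, \<sigma>, H)" "h = (H, \<tau>, K)"
      and "enriched_functor M X F G \<rho>" "enriched_functor M X G H \<sigma>" "enriched_functor M X H K \<tau>"
      using hyp by (auto simp: Hom_def enriched_categories_simps)
    then interpret R: enriched_functor M X F G \<rho> + S: enriched_functor M X G H \<sigma> + T: enriched_functor M X H K \<tau>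
      by simp_all
    show ?thesis
      by (auto simp: fgh enriched_categories_simps fun_eq_iff mon_simps R.efun_simps S.efun_simps T.efun_simps)
  qed
qed

section \<open>The comparison functor\<close>

context monoidal_category
begin

definition to_enriched where
  "to_enriched X = \<lparr>omap = restrict (coarse_point.enriched M X) {F. coarse_point M X F},
     amap = restrict (\<lambda>(F, \<sigma>, G). (coarse_point.enriched M X F, point_map.enriched_map X \<sigma>,
       coarse_point.enriched M X G)) {(F, \<sigma>, G). point_map M X F G \<sigma>}\<rparr>"

lemma to_enriched_simps:
  "coarse_point M X F \<Longrightarrow> omap (to_enriched X) F = coarse_point.enriched M X F"
  "point_map M X F G \<sigma> \<Longrightarrow> amap (to_enriched X) (F, \<sigma>, G)
    = (coarse_point.enriched M X F, point_map.enriched_map X \<sigma>, coarse_point.enriched M X G)"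
  by (simp_all add: to_enriched_def)

lemma cat_functor_to_enriched:
  "cat_functor (points (coarse X) (deloop M) (Iso_cells (deloop M))) (enriched_categories M X)
     (to_enriched X)"
proof (intro cat_functor.intro cat_functor_axioms.intro category_points category_enriched_categories)
  let ?P = "points (coarse X) (deloop M) (Iso_cells (deloop M))" and ?E = "enriched_categories M X"
  fix f F G assume f: "f \<in> Hom ?P F G"
  then obtain \<sigma> where f_eq: "f = (F, \<sigma>, G)" and \<sigma>: "point_map M X F G \<sigma>"
    by (auto simp: Hom_def points_simps)
  interpret S: point_map M X F G \<sigma> by fact
  show "amap (to_enriched X) f \<in> Hom ?E (omap (to_enriched X) F) (omap (to_enriched X) G)"
    using S.enriched_functor_enriched_map S.F.coarse_point_axioms S.G.coarse_point_axioms
    by (simp add: f_eq \<sigma> to_enriched_simps Hom_def enriched_categories_simps)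
  fix g H assume g: "g \<in> Hom ?P G H"
  then obtain \<tau> where g_eq: "g = (G, \<tau>, H)" and \<tau>: "point_map M X G H \<tau>"
    by (auto simp: Hom_def points_simps)
  interpret T: point_map M X G H \<tau> by fact
  let ?c = "\<lambda>A B s. if chn X A s B then \<tau> A B s \<odot> \<sigma> A B s else undefined"
  interpret C: point_map M X F H ?c by (rule point_map_comp[OF \<sigma> \<tau>])
  have "C.enriched_map = (\<lambda>A B. if A \<in> X \<and> B \<in> X then T.enriched_map A B \<odot> S.enriched_map A B else undefined)"
    by (simp add: fun_eq_iff C.enriched_map_def T.enriched_map_def S.enriched_map_def)
  then show "amap (to_enriched X) (g \<cdot>\<^bsub>?P\<^esub> f) = amap (to_enriched X) g \<cdot>\<^bsub>?E\<^esub> amap (to_enriched X) f"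
    using C.point_map_axioms
    by (simp add: f_eq g_eq points_simps to_enriched_simps \<sigma> \<tau> enriched_categories_simps)
next
  let ?P = "points (coarse X) (deloop M) (Iso_cells (deloop M))" and ?E = "enriched_categories M X"
  fix F assume "F \<in> Obj ?P"
  then interpret coarse_point M X F by (simp add: points_simps)
  show "omap (to_enriched X) F \<in> Obj ?E"
    using enriched_category_enriched coarse_point_axioms
    by (simp add: to_enriched_simps enriched_categories_simps)
  interpret I: point_map M X F F "\<lambda>A B s. if chn X A s B then \<one> (fo F A B s) else undefined"
    by (rule point_map_id)
  have "I.enriched_map = (\<lambda>A B. if A \<in> X \<and> B \<in> X then \<one> (ehom enriched A B) else undefined)"
    by (simp add: fun_eq_iff I.enriched_map_def enriched_simps)
  then show "amap (to_enriched X) (Ide ?P F) = Ide ?E (omap (to_enriched X) F)"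
    using I.point_map_axioms coarse_point_axioms
    by (simp add: points_simps to_enriched_simps enriched_categories_simps)
qed (simp_all add: to_enriched_def points_simps)

end

theorem proposition10:
  fixes M :: "('o, 'a) moncat" and X :: "'x set"
  assumes "monoidal_category M"
    and "X \<noteq> {}"
  shows "equivalent_categories
           (points (coarse X) (deloop M) (Iso_cells (deloop M)))
           (enriched_categories M X)"
proof -
  let ?P = "points (coarse X) (deloop M) (Iso_cells (deloop M))" and ?E = "enriched_categories M X"
  interpret monoidal_category M by fact
  show ?thesis
  proof (rule equivalent_categories_fully_faithful[OF cat_functor_to_enriched])
    \<comment> \<open>Fullness: the enriched functor is extended along paths.\<close>
    fix F G t assume "F \<in> Obj ?P" "G \<in> Obj ?P"
      and t: "t \<in> Hom ?E (omap (to_enriched X) F) (omap (to_enriched X) G)"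
    then interpret F: coarse_point M X F + G: coarse_point M X G
      by (simp_all add: points_simps)
    obtain T where t_eq: "t = (F.enriched, T, G.enriched)"
      and T: "enriched_functor M X F.enriched G.enriched T"
      using t F.coarse_point_axioms G.coarse_point_axioms
      by (auto simp: Hom_def enriched_categories_simps to_enriched_simps)
    interpret L: enriched_lift M X F G T
      by (intro enriched_lift.intro F.coarse_point_axioms G.coarse_point_axioms T)
    show "\<exists>f \<in> Hom ?P F G. amap (to_enriched X) f = t"
      using L.point_map_lift_map
      by (intro bexI[of _ "(F, L.lift_map, G)"])
        (simp_all add: to_enriched_simps t_eq L.enriched_map_lift_map Hom_def points_simps)
  next
    \<comment> \<open>Faithfulness: equal images mean equal components on single arrows, which
      suffices by \<open>point_map_eqI\<close>.\<close>
    fix F G f f' assume "f \<in> Hom ?P F G" "f' \<in> Hom ?P F G"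
      and eq: "amap (to_enriched X) f = amap (to_enriched X) f'"
    then obtain \<sigma> \<tau> where f: "f = (F, \<sigma>, G)" "f' = (F, \<tau>, G)"
      and \<sigma>: "point_map M X F G \<sigma>" and \<tau>: "point_map M X F G \<tau>"
      by (auto simp: Hom_def points_simps)
    interpret S: point_map M X F G \<sigma> by fact
    interpret T: point_map M X F G \<tau> by fact
    have "S.enriched_map = T.enriched_map"
      using eq by (simp add: f to_enriched_simps \<sigma> \<tau>)
    then have "\<sigma> A B [(A, B)] = \<tau> A B [(A, B)]" if "A \<in> X" "B \<in> X" for A B
      using that by (metis S.enriched_map_def T.enriched_map_def)
    then show "f = f'"
      using point_map_eqI[OF \<sigma> \<tau>] by (simp add: f)
  next
    \<comment> \<open>Essential surjectivity: the preimage is the free point of \<open>E\<close>,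
      and the isomorphism is \<open>E.counit\<close>.\<close>
    fix E assume "E \<in> Obj ?E"
    then interpret E: enriched_category M X E by (simp add: enriched_categories_simps)
    let ?F = "E.free_point"
    interpret F: coarse_point M X ?F by (rule E.coarse_point_free_point)
    interpret T: enriched_functor M X F.enriched E E.counit by (rule E.enriched_functor_counit)
    interpret C: category ?E by (rule category_enriched_categories)
    let ?i = "\<lambda>A B. if A \<in> X \<and> B \<in> X then cinv (mcat M) (E.counit A B) else undefined"
    have i: "enriched_functor M X E F.enriched ?i"
      by (rule T.enriched_functor_inverse) (rule E.counit_Isos)
    have H: "(F.enriched, E.counit, E) \<in> Hom ?E F.enriched E" "(E, ?i, F.enriched) \<in> Hom ?E E F.enriched"
      using T.enriched_functor_axioms i by (simp_all add: Hom_def enriched_categories_simps)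
    have "(F.enriched, E.counit, E) \<in> Isos ?E"
      by (rule C.IsosI[OF H])
        (simp_all add: enriched_categories_simps fun_eq_iff U.cinv_simps E.counit_Isos T.efun_simps)
    then show "\<exists>F \<in> Obj ?P. Isos ?E \<inter> Hom ?E (omap (to_enriched X) F) E \<noteq> {}"
      using H(1) F.coarse_point_axioms
      by (intro bexI[of _ ?F]) (auto simp: points_simps to_enriched_simps)
  qed
qed

end
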